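(* Fix $Ek>0$ and let $(\boldsymbol u,\boldsymbol B,P,T)$ be a smooth solution, with nontrivial magnetic field, of the viscous inertialess model (see context). Suppose that the magnetic flux is exact and that the temperature satisfies isothermal boundary conditions. Let $\boldsymbol J=\nabla\times\boldsymbol B$. Let $0<\gamma<1$ and suppose that $$ Rm<\frac{2\,Ek^{1-\gamma}}{C_m^2C_{\mathrm P}^2}. $$ If at some instant of time there is magnetic enstrophy growth, $\frac{\mathrm d}{\mathrm dt}\left(\frac12\int_V|\boldsymbol J|^2\,\mathrm dV\right)\ge0$, then at that instant either $$ C_n\,Ra\,\big\|\overline{\nabla\times\nabla\times T\boldsymbol e_z}\big\|_{L^2}+Ra^2\,Ek^{1-\gamma}\,\big\|\nabla\times\overline{\nabla\times\nabla\times T\boldsymbol e_z}\big\|_{L^2}^2\ \ge\ \frac1{2Rm}, $$ or the following two-sided inequality does not hold: $$ Ek^\gamma\ \le\ 2\Lambda\int_V|\nabla\boldsymbol J|^2\,\mathrm dV\ \le\ Ek^\gamma\left(\frac{4}{C_m^2C_{\mathrm P}^2}\,\frac1{Rm\,Ek^{\gamma-1}}-1\right). $$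
   Context: Domain: $V=[0,L_x]\times[0,L_y]\times[0,1]$ with $L_x,L_y>0$; all fields are periodic in $x$ and $y$. $S_-=\{z=0\}$, $S_+=\{z=1\}$, $\boldsymbol n_\pm=\pm\boldsymbol e_z$. $L^p$ norms are over $V$. Viscous inertialess model, with positive parameters $Ek,\Lambda,Ra,Rm,Pe$ and heat source $Q=Q(\boldsymbol x)$: velocity $\boldsymbol u$, pressure $P$, magnetic field $\boldsymbol B$, temperature $T$ satisfy $$\boldsymbol e_z\times\boldsymbol u+\nabla P-Ek\nabla^2\boldsymbol u=\Lambda(\nabla\times\boldsymbol B)\times\boldsymbol B+Ra\,T\boldsymbol e_z,\quad\nabla\cdot\boldsymbol u=0,$$ $$\partial_t\boldsymbol B-\nabla\times(\boldsymbol u\times\boldsymbol B)=\tfrac1{Rm}\nabla^2\boldsymbol B,\quad\nabla\cdot\boldsymbol B=0,\quad \partial_tT+\nabla\cdot(\boldsymbol uT)=\tfrac1{Pe}\nabla^2T+\tfrac{Q}{Pe},$$ with boundary conditions on $S_\pm$: $\boldsymbol u\cdot\boldsymbol n_\pm=0$ (no penetration), $(\nabla\times\boldsymbol u)\times\boldsymbol n_\pm=0$ (stress-free), $\boldsymbol B\times\boldsymbol n_\pm=0$ (ferromagnetic), $T=T_\pm$ with $T_\pm$ constants (isothermal). Magnetic flux is exact if $\int_{S_\pm}\boldsymbol n_\pm\cdot\boldsymbol B\,\mathrm dS_\pm=0$. The overline denotes the (componentwise) vertical primitive: $\overline f(x,y,z)=\int_0^zf(x,y,z')\,\mathrm dz'$.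 Constants: $\lambda_1=\min\{\pi,2\pi/L_x,2\pi/L_y\}$, $C_{\mathrm P}=1/\lambda_1$, $C_3=\frac{2^{2/3}}{\pi^{2/3}\sqrt3}$, $C_{\mathrm S}=2\sqrt2\,C_3\Big(1+\frac{\sqrt{1+L_x^{-2}+L_y^{-2}}}{\lambda_1}\Big)$, $C_m=3C_{\mathrm S}^{3/2}C_{\mathrm P}^{1/2}$, $C_n=C_b(1+C_{\mathrm P}^2+C_{\mathrm P}^4)^{1/2}+C_{\mathrm S}^{3/2}C_{\mathrm P}^{1/2}$, where, with $\lambda_{mnk}=(2\pi m/L_x)^2+(2\pi n/L_y)^2+k^2\pi^2$, $$C_b=\left[\frac1{L_xL_y}\sum_{\substack{m,n\in\mathbb Z,\ k\in\mathbb N_0\\(m,n,k)\ne(0,0,0)}}\frac{2-\delta_{k0}}{1+\lambda_{mnk}+\lambda_{mnk}^2}\right]^{1/2}.$$ *)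

theory Defs
  imports "HOL-Analysis.Analysis"
begin

text \<open>
  A field on \<open>V\<close> that is periodic in the horizontal directions is a periodic function on the
  slab \<open>\<real>\<^sup>2 \<times> [0,1]\<close>. Values outside the slab are irrelevant: every derivative is taken
  within the slab, so it is one-sided at the boundaries \<open>z = 0\<close> and \<open>z = 1\<close>.
  Likewise time derivatives are taken within the time interval \<open>I\<close>, which may be any
  nondegenerate interval.
\<close>

definition slab :: "(real^3) set" where
  "slab = {x. 0 \<le> x$3 \<and> x$3 \<le> 1}"

definition cell :: "real \<Rightarrow> real \<Rightarrow> (real^3) set" where
  "cell Lx Ly = {x. 0 \<le> x$1 \<and> x$1 \<le> Lx \<and> 0 \<le> x$2 \<and> x$2 \<le> Ly \<and> 0 \<le> x$3 \<and> x$3 \<le> 1}"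

definition bottom :: "(real^3) set" where
  "bottom = {x. x$3 = 0}"

definition top_lid :: "(real^3) set" where
  "top_lid = {x. x$3 = 1}"

definition ez :: "real^3" where
  "ez = axis 3 1"

definition periodic :: "real \<Rightarrow> real \<Rightarrow> (real^3 \<Rightarrow> 'b) \<Rightarrow> bool" where
  "periodic Lx Ly f \<longleftrightarrow>
     (\<forall>x\<in>slab. f (x + axis 1 Lx) = f x \<and> f (x + axis 2 Ly) = f x)"


subsection \<open>Differential operators\<close>

text \<open>
  \<open>Ck_on k f S\<close>: all partial derivatives of \<open>f\<close> up to order \<open>k\<close>, taken within \<open>S\<close>,
  exist and are continuous. It is used for convex \<open>S\<close> with nonempty interior, where the
  derivative within \<open>S\<close> is unique at every point of \<open>S\<close>, boundary points included.
\<close>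

primrec Ck_on :: "nat \<Rightarrow> ('a::euclidean_space \<Rightarrow> 'b::real_normed_vector) \<Rightarrow> 'a set \<Rightarrow> bool" where
  "Ck_on 0 f S \<longleftrightarrow> continuous_on S f"
| "Ck_on (Suc k) f S \<longleftrightarrow> f differentiable_on S \<and>
     (\<forall>e\<in>Basis. Ck_on k (\<lambda>x. frechet_derivative f (at x within S) e) S)"

definition smooth_on :: "('a::euclidean_space \<Rightarrow> 'b::real_normed_vector) \<Rightarrow> 'a set \<Rightarrow> bool" where
  "smooth_on f S \<longleftrightarrow> (\<forall>k. Ck_on k f S)"

definition smooth_field :: "real set \<Rightarrow> (real \<Rightarrow> real^3 \<Rightarrow> 'b::real_normed_vector) \<Rightarrow> bool" where
  "smooth_field I f \<longleftrightarrow> smooth_on (\<lambda>(t, x). f t x) (I \<times> slab)"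

definition ddt :: "real set \<Rightarrow> (real \<Rightarrow> 'b::real_normed_vector) \<Rightarrow> real \<Rightarrow> 'b" where
  "ddt I f t = vector_derivative f (at t within I)"

definition pd :: "3 \<Rightarrow> (real^3 \<Rightarrow> 'b::real_normed_vector) \<Rightarrow> real^3 \<Rightarrow> 'b" where
  "pd i f x = frechet_derivative f (at x within slab) (axis i 1)"

definition gradient :: "(real^3 \<Rightarrow> real) \<Rightarrow> real^3 \<Rightarrow> real^3" where
  "gradient f x = (\<chi> i. pd i f x)"

definition divergence :: "(real^3 \<Rightarrow> real^3) \<Rightarrow> real^3 \<Rightarrow> real" where
  "divergence F x = (\<Sum>i\<in>UNIV. pd i (\<lambda>y. F y $ i) x)"

definition curl :: "(real^3 \<Rightarrow> real^3) \<Rightarrow> real^3 \<Rightarrow> real^3" where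
  "curl F x = vector
     [pd 2 (\<lambda>y. F y $ 3) x - pd 3 (\<lambda>y. F y $ 2) x,
      pd 3 (\<lambda>y. F y $ 1) x - pd 1 (\<lambda>y. F y $ 3) x,
      pd 1 (\<lambda>y. F y $ 2) x - pd 2 (\<lambda>y. F y $ 1) x]"

definition laplacian :: "(real^3 \<Rightarrow> 'b::real_normed_vector) \<Rightarrow> real^3 \<Rightarrow> 'b" where
  "laplacian f x = (\<Sum>i\<in>UNIV. pd i (pd i f) x)"

definition grad_norm_sq :: "(real^3 \<Rightarrow> real^3) \<Rightarrow> real^3 \<Rightarrow> real" where
  "grad_norm_sq F x = (\<Sum>i\<in>UNIV. \<Sum>j\<in>UNIV. (pd i (\<lambda>y. F y $ j) x)\<^sup>2)"

definition vprim :: "(real^3 \<Rightarrow> real^3) \<Rightarrow> real^3 \<Rightarrow> real^3" where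
  "vprim f x = integral {0..x$3} (\<lambda>s. f (vector [x$1, x$2, s]))"

definition L2norm :: "real \<Rightarrow> real \<Rightarrow> (real^3 \<Rightarrow> real^3) \<Rightarrow> real" where
  "L2norm Lx Ly f = sqrt (integral (cell Lx Ly) (\<lambda>x. (norm (f x))\<^sup>2))"


subsection \<open>The viscous inertialess model\<close>

definition viscous_inertialess_solution ::
  "real set \<Rightarrow> real \<Rightarrow> real \<Rightarrow> real \<Rightarrow> real \<Rightarrow> real \<Rightarrow> real \<Rightarrow> real \<Rightarrow> (real^3 \<Rightarrow> real) \<Rightarrow>
   (real \<Rightarrow> real^3 \<Rightarrow> real^3) \<Rightarrow> (real \<Rightarrow> real^3 \<Rightarrow> real) \<Rightarrow>
   (real \<Rightarrow> real^3 \<Rightarrow> real^3) \<Rightarrow> (real \<Rightarrow> real^3 \<Rightarrow> real) \<Rightarrow> bool" where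
  "viscous_inertialess_solution I Lx Ly Ek Lam Ra Rm Pe Q u P B T \<longleftrightarrow>
     smooth_field I u \<and> smooth_field I P \<and> smooth_field I B \<and> smooth_field I T \<and>
     periodic Lx Ly Q \<and>
     (\<forall>t\<in>I. periodic Lx Ly (u t) \<and> periodic Lx Ly (P t) \<and>
             periodic Lx Ly (B t) \<and> periodic Lx Ly (T t)) \<and>
     (\<forall>t\<in>I. \<forall>x\<in>slab.
        cross3 ez (u t x) + gradient (P t) x - Ek *\<^sub>R laplacian (u t) x
          = Lam *\<^sub>R cross3 (curl (B t) x) (B t x) + (Ra * T t x) *\<^sub>R ez \<and>
        divergence (u t) x = 0 \<and>
        ddt I (\<lambda>s. B s x) t - curl (\<lambda>y. cross3 (u t y) (B t y)) x
          = (1 / Rm) *\<^sub>R laplacian (B t) x \<and>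
        divergence (B t) x = 0 \<and>
        ddt I (\<lambda>s. T s x) t + divergence (\<lambda>y. T t y *\<^sub>R u t y) x
          = (1 / Pe) * laplacian (T t) x + Q x / Pe) \<and>
     (\<forall>t\<in>I. \<forall>(S, n) \<in> {(bottom, - ez), (top_lid, ez)}. \<forall>x\<in>S.
        u t x \<bullet> n = 0 \<and> cross3 (curl (u t) x) n = 0 \<and> cross3 (B t x) n = 0)"

definition isothermal ::
  "real set \<Rightarrow> real \<Rightarrow> real \<Rightarrow> (real \<Rightarrow> real^3 \<Rightarrow> real) \<Rightarrow> bool" where
  "isothermal I Tminus Tplus T \<longleftrightarrow>
     (\<forall>t\<in>I. (\<forall>x\<in>bottom. T t x = Tminus) \<and> (\<forall>x\<in>top_lid. T t x = Tplus))"

definition exact_magnetic_flux ::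
  "real set \<Rightarrow> real \<Rightarrow> real \<Rightarrow> (real \<Rightarrow> real^3 \<Rightarrow> real^3) \<Rightarrow> bool" where
  "exact_magnetic_flux I Lx Ly B \<longleftrightarrow>
     (\<forall>t\<in>I. \<forall>(z, n) \<in> {(0, - ez), (1, ez)}.
        integral (cbox (0, 0) (Lx, Ly)) (\<lambda>(x, y). n \<bullet> B t (vector [x, y, z])) = 0)"

definition enstrophy ::
  "real \<Rightarrow> real \<Rightarrow> (real \<Rightarrow> real^3 \<Rightarrow> real^3) \<Rightarrow> real \<Rightarrow> real" where
  "enstrophy Lx Ly B t = 1/2 * integral (cell Lx Ly) (\<lambda>x. (norm (curl (B t) x))\<^sup>2)"


subsection \<open>Constants\<close>

definition lambda1 :: "real \<Rightarrow> real \<Rightarrow> real" where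
  "lambda1 Lx Ly = min pi (min (2 * pi / Lx) (2 * pi / Ly))"

definition C_P :: "real \<Rightarrow> real \<Rightarrow> real" where
  "C_P Lx Ly = 1 / lambda1 Lx Ly"

definition C_3 :: real where
  "C_3 = 2 powr (2/3) / (pi powr (2/3) * sqrt 3)"

definition C_S :: "real \<Rightarrow> real \<Rightarrow> real" where
  "C_S Lx Ly = 2 * sqrt 2 * C_3 * (1 + sqrt (1 + 1 / Lx\<^sup>2 + 1 / Ly\<^sup>2) / lambda1 Lx Ly)"

definition C_m :: "real \<Rightarrow> real \<Rightarrow> real" where
  "C_m Lx Ly = 3 * C_S Lx Ly powr (3/2) * C_P Lx Ly powr (1/2)"

definition eigenv :: "real \<Rightarrow> real \<Rightarrow> int \<Rightarrow> int \<Rightarrow> nat \<Rightarrow> real" where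
  "eigenv Lx Ly m n k =
     (2 * pi * of_int m / Lx)\<^sup>2 + (2 * pi * of_int n / Ly)\<^sup>2 + (real k)\<^sup>2 * pi\<^sup>2"

definition C_b :: "real \<Rightarrow> real \<Rightarrow> real" where
  "C_b Lx Ly = sqrt (1 / (Lx * Ly) *
     (\<Sum>\<^sub>\<infinity>(m, n, k) \<in> UNIV - {(0, 0, 0)}.
        (2 - (if k = 0 then 1 else 0)) / (1 + eigenv Lx Ly m n k + (eigenv Lx Ly m n k)\<^sup>2)))"

definition C_n :: "real \<Rightarrow> real \<Rightarrow> real" where
  "C_n Lx Ly = C_b Lx Ly * (1 + (C_P Lx Ly)\<^sup>2 + (C_P Lx Ly)^4) powr (1/2)
     + C_S Lx Ly powr (3/2) * C_P Lx Ly powr (1/2)"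

end

theory Submission
  imports Defs
begin

text \<open>
  Testing the induction equation with \<open>\<Delta>B\<close> turns enstrophy growth into
  \<open>\<parallel>\<Delta>B\<parallel>\<^sup>2 / Rm \<le> - \<integral> \<Delta>B \<bullet> ((B \<bullet> \<nabla>)u - (u \<bullet> \<nabla>)B)\<close>. The advection terms are bounded by
  \<open>\<surd>K \<parallel>\<Delta>u\<parallel> \<parallel>\<Delta>B\<parallel>\<close>: one factor is estimated by its supremum over horizontal slices, the other
  by its \<open>L\<^sup>2\<close> norm on slices, and only the fundamental theorem of calculus in each variable and the
  sharp Poincare inequality are needed. Hence \<open>1 / Rm \<le> 2 \<surd>K \<parallel>\<Delta>u\<parallel>\<close>.

  For \<open>\<parallel>\<Delta>u\<parallel>\<close>, subtract from \<open>u\<close> the thermal wind, the solution of the inviscid balance driven by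
  buoyancy alone. Its Laplacian is the field appearing in the second term of the claim. Testing
  the momentum equation with the Laplacian of the difference kills the Coriolis force and the
  pressure and leaves \<open>\<parallel>\<Delta>u\<parallel>\<^sup>2 \<le> (\<Lambda>/Ek)\<^sup>2 \<parallel>(B \<bullet> \<nabla>)B\<parallel>\<^sup>2 + Ra\<^sup>2 F\<^sup>2\<close>. Inserting this, Young's inequality
  gives the claim because \<open>16 K \<le> C\<^sub>m\<^sup>2 C\<^sub>P\<^sup>2\<close>; the term with \<open>C\<^sub>n\<close> is only discarded.
\<close>

text \<open>The obstacle is that the constants are prescribed: the product estimate must meet a
  given bound for all periods \<open>Lx\<close>, \<open>Ly\<close>, so every inequality is derived
  with an explicit constant, and the weights in the supremum estimates are set to
  \<open>lambda1\<close>, the inverse of the Poincare constant. Each component of \<open>u\<close>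
  and \<open>B\<close> vanishes on both lids, or its vertical derivative does and its mean is zero.
  This dichotomy removes boundary terms and makes the Poincare inequality available. The zero means
  do not come from the lids: integrating the momentum equation gives them for the horizontal
  velocity, because rotation couples its two components, and exactness of the flux gives the one for
  the vertical field. On isothermal lids the thermal wind satisfies the same Neumann condition as
  the horizontal velocity, so subtracting it preserves the structure. The lower half of the
  two-sided inequality makes the norm of \<open>\<Delta>B\<close> positive, so that its square can
  be cancelled. The factor 16 is what lets the upper half absorb the magnetic part of the velocity
  bound into half of \<open>1 / Rm\<close>.\<close>

subsection \<open>Inequalities in one variable\<close>

text \<open>
  The identity behind all Wirtinger inequalities is
  \<open>k'\<^sup>2 - \<mu>\<^sup>2 k\<^sup>2 = (k' - \<mu> cot k)\<^sup>2 + (\<mu> cot k\<^sup>2)'\<close>. At its poles the cotangent takes the junk value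
  \<open>0\<close>, which is the limit of \<open>cot k\<^sup>2\<close> there because \<open>k\<close> vanishes.
\<close>

lemma wirtinger_cot:
  fixes k k' :: "real \<Rightarrow> real"
  assumes "a \<le> b" "\<mu> > 0"
    and der: "\<And>x. x \<in> {a..b} \<Longrightarrow> (k has_real_derivative k' x) (at x within {a..b})"
    and cont': "continuous_on {a..b} k'"
    and "finite Z"
    and Z: "\<And>x. x \<in> {a..b} \<Longrightarrow> x \<in> Z \<longleftrightarrow> sin (\<mu> * (x - p)) = 0"
    and kZ: "\<And>x. x \<in> {a..b} \<Longrightarrow> x \<in> Z \<Longrightarrow> k x = 0"
    and bdry: "cot (\<mu> * (a - p)) * (k a)\<^sup>2 \<le> cot (\<mu> * (b - p)) * (k b)\<^sup>2"
  shows "\<mu>\<^sup>2 * integral {a..b} (\<lambda>x. (k x)\<^sup>2) \<le> integral {a..b} (\<lambda>x. (k' x)\<^sup>2)"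
proof -
  define s where "s x = sin (\<mu> * (x - p))" for x
  define \<Phi> where "\<Phi> x = \<mu> * cot (\<mu> * (x - p)) * (k x)\<^sup>2" for x
  define \<phi> where "\<phi> x = (k' x)\<^sup>2 - \<mu>\<^sup>2 * (k x)\<^sup>2 - (k' x - \<mu> * cot (\<mu> * (x - p)) * k x)\<^sup>2" for x
  have contk: "continuous_on {a..b} k"
    using der by (meson DERIV_continuous continuous_on_eq_continuous_within)
  have 1: "(\<Phi> has_vector_derivative \<phi> x) (at x)" if x: "x \<in> {a<..<b} - Z" for x
  proof -
    have s: "sin (\<mu> * (x - p)) \<noteq> 0" using Z[of x] x by auto
    have d: "(k has_real_derivative k' x) (at x)"
      using der[of x] x at_within_Icc_at[of a x b] by auto
    have "(\<Phi> has_real_derivative \<phi> x) (at x)"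
      unfolding \<Phi>_def[abs_def] cot_def \<phi>_def
      apply (rule derivative_eq_intros d refl s)+
      using s by (simp add: field_simps power2_eq_square)
    then show ?thesis by (simp add: has_real_derivative_iff_has_vector_derivative)
  qed
  \<comment> \<open>At a pole \<open>k\<close> and \<open>s\<close> vanish together, so
    \<open>k / s\<close> tends to the quotient of their derivatives; \<Phi> is \<open>k\<close>
    times a bounded factor and tends to 0.\<close>
  have lim: "(\<Phi> \<longlongrightarrow> \<Phi> z) (at z within {a..b})" if z: "z \<in> {a..b}" "z \<in> Z" for z
  proof -
    have kz: "k z = 0" and sz: "s z = 0" using kZ Z z by (auto simp: s_def)
    have sder: "(s has_real_derivative \<mu> * cos (\<mu> * (z - p))) (at z within {a..b})"
      unfolding s_def[abs_def] by (rule derivative_eq_intros refl | simp)+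
    have cz: "\<mu> * cos (\<mu> * (z - p)) \<noteq> 0"
      using sz \<open>\<mu> > 0\<close> by (metis s_def mult_eq_0_iff sin_zero_abs_cos_one abs_zero less_irrefl zero_neq_one)
    have A: "((\<lambda>x. (k x - k z) / (x - z)) \<longlongrightarrow> k' z) (at z within {a..b})"
      using der[OF z(1)] by (simp add: has_field_derivative_iff)
    have B: "((\<lambda>x. (s x - s z) / (x - z)) \<longlongrightarrow> \<mu> * cos (\<mu> * (z - p))) (at z within {a..b})"
      using sder by (simp add: has_field_derivative_iff)
    have C: "((\<lambda>x. k x / s x) \<longlongrightarrow> k' z / (\<mu> * cos (\<mu> * (z - p)))) (at z within {a..b})"
      apply (rule Lim_transform_eventually[OF tendsto_divide[OF A B cz]])
      unfolding eventually_at_filter by (rule always_eventually) (simp add: kz sz)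
    have D: "(k \<longlongrightarrow> 0) (at z within {a..b})"
      using contk z kz by (metis continuous_on_def)
    have E: "((\<lambda>x. \<mu> * (cos (\<mu> * (x - p)) * (k x * (k x / s x)))) \<longlongrightarrow>
        \<mu> * (cos (\<mu> * (z - p)) * (0 * (k' z / (\<mu> * cos (\<mu> * (z - p))))))) (at z within {a..b})"
      by (intro tendsto_intros C D)
    have F: "(\<lambda>x. \<mu> * (cos (\<mu> * (x - p)) * (k x * (k x / s x)))) = \<Phi>"
      by (auto simp: \<Phi>_def cot_def s_def power2_eq_square)
    show ?thesis using E unfolding F by (simp add: \<Phi>_def kz)
  qed
  have cont\<Phi>: "continuous_on {a..b} \<Phi>"
    unfolding continuous_on_def
  proof
    fix z assume z: "z \<in> {a..b}"
    show "(\<Phi> \<longlongrightarrow> \<Phi> z) (at z within {a..b})"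
    proof (cases "z \<in> Z")
      case True then show ?thesis using lim z by auto
    next
      case False
      then have "sin (\<mu> * (z - p)) \<noteq> 0" using Z z by auto
      moreover have "(k \<longlongrightarrow> k z) (at z within {a..b})" using contk z by (metis continuous_on_def)
      ultimately show ?thesis unfolding \<Phi>_def cot_def by (intro tendsto_intros) auto
    qed
  qed
  \<comment> \<open>The poles are finite in number and \<Phi> is continuous across them, so the
    fundamental theorem of calculus holds on the whole interval.\<close>
  have I: "(\<phi> has_integral (\<Phi> b - \<Phi> a)) {a..b}"
    by (rule fundamental_theorem_of_calculus_interior_strong[OF \<open>finite Z\<close> \<open>a \<le> b\<close> 1 cont\<Phi>])
  have int1: "(\<lambda>x. (k' x)\<^sup>2) integrable_on {a..b}" and int2: "(\<lambda>x. (k x)\<^sup>2) integrable_on {a..b}"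
    by (intro integrable_continuous_interval continuous_intros cont' contk)+
  have J: "((\<lambda>x. (k' x)\<^sup>2 - \<mu>\<^sup>2 * (k x)\<^sup>2) has_integral
     integral {a..b} (\<lambda>x. (k' x)\<^sup>2) - \<mu>\<^sup>2 * integral {a..b} (\<lambda>x. (k x)\<^sup>2)) {a..b}"
    by (intro has_integral_diff has_integral_mult_right integrable_integral int1 int2)
  have "\<Phi> b - \<Phi> a \<le> integral {a..b} (\<lambda>x. (k' x)\<^sup>2) - \<mu>\<^sup>2 * integral {a..b} (\<lambda>x. (k x)\<^sup>2)"
    by (rule has_integral_le[OF I J]) (simp add: \<phi>_def)
  moreover have "\<Phi> a \<le> \<Phi> b" using bdry \<open>\<mu> > 0\<close> by (simp add: \<Phi>_def mult.assoc)
  ultimately show ?thesis by linarith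
qed

text \<open>On the unit interval the cotangent of \<open>pi * x\<close> has its poles exactly at the
  endpoints, where \<open>k\<close> vanishes.\<close>

lemma wirtinger_dirichlet:
  fixes k k' :: "real \<Rightarrow> real"
  assumes der: "\<And>x. x \<in> {0..1} \<Longrightarrow> (k has_real_derivative k' x) (at x within {0..1})"
    and cont': "continuous_on {0..1} k'" and "k 0 = 0" "k 1 = 0"
  shows "pi\<^sup>2 * integral {0..1} (\<lambda>x. (k x)\<^sup>2) \<le> integral {0..1} (\<lambda>x. (k' x)\<^sup>2)"
proof (rule wirtinger_cot[where Z="{0,1}" and p=0, OF _ _ der cont'])
  fix x :: real assume x: "x \<in> {0..1}"
  show "x \<in> {0,1} \<longleftrightarrow> sin (pi * (x - 0)) = 0"
    using x sin_gt_zero[of "pi*x"] by (cases "x=0 \<or> x=1") (auto simp: less_le)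
qed (use assms in auto)

text \<open>The two sides differ by the square of \<open>V * c\<close> minus the integral,
  \<open>V\<close> being the volume. The cotangent argument controls \<open>h\<close> minus one of
  its values; this replaces that value by the mean.\<close>

lemma variance_shift:
  fixes h :: "'a::euclidean_space \<Rightarrow> real"
  assumes "continuous_on (cbox a b) h"
  shows "measure lborel (cbox a b) * integral (cbox a b) (\<lambda>x. (h x)\<^sup>2)
     \<le> measure lborel (cbox a b) * integral (cbox a b) (\<lambda>x. (h x - c)\<^sup>2) + (integral (cbox a b) h)\<^sup>2"
proof -
  let ?I = "integral (cbox a b)" and ?V = "measure lborel (cbox a b)"
  have i: "h integrable_on cbox a b" "(\<lambda>x. (h x)\<^sup>2) integrable_on cbox a b"
    by (intro integrable_continuous continuous_intros assms)+
  have "((\<lambda>x. (h x)\<^sup>2 - 2 * c * h x + c\<^sup>2) has_integral (?I (\<lambda>x. (h x)\<^sup>2) - 2 * c * ?I h + ?V * c\<^sup>2)) (cbox a b)"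
    using has_integral_const[of "c\<^sup>2" a b]
    by (intro has_integral_diff has_integral_add has_integral_mult_right integrable_integral i) simp
  then have "?I (\<lambda>x. (h x - c)\<^sup>2) = ?I (\<lambda>x. (h x)\<^sup>2) - 2 * c * ?I h + ?V * c\<^sup>2"
    by (intro integral_unique) (simp add: power2_diff algebra_simps)
  then have "?V * ?I (\<lambda>x. (h x - c)\<^sup>2) + (?I h)\<^sup>2 = ?V * ?I (\<lambda>x. (h x)\<^sup>2) + (?V * c - ?I h)\<^sup>2"
    by (simp only: power2_diff) (simp add: algebra_simps power2_eq_square)
  then show ?thesis by simp
qed

lemma integral_square_le:
  fixes h :: "'a::euclidean_space \<Rightarrow> real"
  assumes "continuous_on (cbox a b) h"
  shows "(integral (cbox a b) h)\<^sup>2 \<le> measure lborel (cbox a b) * integral (cbox a b) (\<lambda>x. (h x)\<^sup>2)"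
proof (cases "measure lborel (cbox a b) = 0")
  case True
  then show ?thesis by (simp add: integral_null)
next
  case False
  let ?I = "integral (cbox a b)" and ?V = "measure lborel (cbox a b)"
  define c where "c = ?I h / ?V"
  have i: "h integrable_on cbox a b" "(\<lambda>x. (h x)\<^sup>2) integrable_on cbox a b"
    by (intro integrable_continuous continuous_intros assms)+
  have "((\<lambda>x. (h x)\<^sup>2 - 2 * c * h x + c\<^sup>2) has_integral (?I (\<lambda>x. (h x)\<^sup>2) - 2 * c * ?I h + ?V * c\<^sup>2)) (cbox a b)"
    using has_integral_const[of "c\<^sup>2" a b]
    by (intro has_integral_diff has_integral_add has_integral_mult_right integrable_integral i) simp
  then have "0 \<le> ?I (\<lambda>x. (h x)\<^sup>2) - 2 * c * ?I h + ?V * c\<^sup>2"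
  proof (rule has_integral_nonneg)
    show "0 \<le> (h x)\<^sup>2 - 2 * c * h x + c\<^sup>2" for x
      using zero_le_power2[of "h x - c"] by (simp add: power2_diff algebra_simps)
  qed
  also have "\<dots> = ?I (\<lambda>x. (h x)\<^sup>2) - (?I h)\<^sup>2 / ?V"
    using False by (simp add: c_def field_simps power2_eq_square)
  finally show ?thesis using False measure_nonneg[of lborel "cbox a b"]
    by (simp add: field_simps)
qed

text \<open>The cotangent is centered at 1/2: its only pole in the interval lies there, where
  \<open>h - h (1/2)\<close> vanishes, and it is zero at both ends, so the boundary terms vanish for
  any \<open>h\<close>.\<close>

lemma wirtinger_neumann:
  fixes h h' :: "real \<Rightarrow> real"
  assumes der: "\<And>x. x \<in> {0..1} \<Longrightarrow> (h has_real_derivative h' x) (at x within {0..1})"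
    and cont': "continuous_on {0..1} h'"
  shows "integral {0..1} (\<lambda>x. (h x)\<^sup>2)
    \<le> (1 / pi)\<^sup>2 * integral {0..1} (\<lambda>x. (h' x)\<^sup>2) + (integral {0..1} h)\<^sup>2"
proof -
  have conth: "continuous_on {0..1} h"
    using der by (meson DERIV_continuous continuous_on_eq_continuous_within)
  define k where "k x = h x - h (1/2)" for x
  have "pi\<^sup>2 * integral {0..1} (\<lambda>x. (k x)\<^sup>2) \<le> integral {0..1} (\<lambda>x. (h' x)\<^sup>2)"
  proof (rule wirtinger_cot[where Z="{1/2}" and p="1/2", OF _ _ _ cont'])
    fix x :: real assume x: "x \<in> {0..1}"
    show "(k has_real_derivative h' x) (at x within {0..1})"
      unfolding k_def using der[OF x] by (auto intro!: derivative_eq_intros)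
    show "x \<in> {1/2} \<longleftrightarrow> sin (pi * (x - 1/2)) = 0"
    proof (cases "x = 1/2")
      case False
      have "cos (pi * x) \<noteq> 0"
      proof (cases "x < 1/2")
        case True
        then have "0 < cos (pi * x)" using x pi_gt_zero by (intro cos_gt_zero_pi) (auto simp: less_le_trans[of _ 0])
        then show ?thesis by simp
      next
        case F: False
        then have "0 < sin (pi * (x - 1/2))" using False x by (intro sin_gt_zero) (auto intro!: mult_less_cancel_left_pos[THEN iffD2, of pi _ 1, simplified])
        then show ?thesis by (simp add: sin_diff right_diff_distrib)
      qed
      then show ?thesis using False by (simp add: sin_diff right_diff_distrib)
    next
      case True
      then have "pi * (x - 1/2) = 0" by simp
      then show ?thesis using True by (metis insertI1 sin_zero)
    qed
    show "k x = 0" if "x \<in> {1/2}" using that by (metis k_def singletonD diff_self)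
  qed (auto simp: k_def cot_def)
  then have "integral {0..1} (\<lambda>x. (h x - h (1/2))\<^sup>2) \<le> (1 / pi)\<^sup>2 * integral {0..1} (\<lambda>x. (h' x)\<^sup>2)"
    by (simp add: k_def field_simps)
  then show ?thesis using variance_shift[of 0 1 h "h (1/2)"] conth by simp
qed

text \<open>
  A periodic function takes the same value at two points half a period apart, so after subtracting
  it the cotangent has all its poles at zeros.
\<close>

lemma wirtinger_periodic:
  fixes h h' :: "real \<Rightarrow> real"
  assumes L: "0 < L" and der: "\<And>x. x \<in> {0..L} \<Longrightarrow> (h has_real_derivative h' x) (at x within {0..L})"
    and cont': "continuous_on {0..L} h'" and per: "h 0 = h L"
  shows "integral {0..L} (\<lambda>x. (h x)\<^sup>2)
    \<le> (L / (2 * pi))\<^sup>2 * integral {0..L} (\<lambda>x. (h' x)\<^sup>2) + 1 / L * (integral {0..L} h)\<^sup>2"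
proof -
  have conth: "continuous_on {0..L} h"
    using der by (meson DERIV_continuous continuous_on_eq_continuous_within)
  define \<mu> where "\<mu> = 2 * pi / L"
  have \<mu>: "\<mu> > 0" using L by (simp add: \<mu>_def)
  obtain x0 where x0: "0 \<le> x0" "x0 \<le> L/2" "h x0 = h (x0 + L/2)"
  proof -
    \<comment> \<open>Periodicity gives \<open>g (L/2) = - g 0\<close>, hence a zero of
      \<open>g\<close> in the first half period.\<close>
    define g where "g x = h x - h (x + L/2)" for x
    have cg: "continuous_on {0..L/2} g" unfolding g_def
      using L by (intro continuous_intros continuous_on_subset[OF conth] continuous_on_compose2[OF conth]) auto
    have "g (L/2) = - g 0" using per by (simp add: g_def)
    then consider "g 0 \<le> 0" "0 \<le> g (L/2)" | "g (L/2) \<le> 0" "0 \<le> g 0" by linarith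
    then have "\<exists>x\<ge>0. x \<le> L/2 \<and> g x = 0"
      by cases (use IVT'[OF _ _ _ cg] IVT2'[OF _ _ _ cg] L in auto)
    then show ?thesis using that by (auto simp: g_def)
  qed
  define k where "k x = h x - h x0" for x
  have "\<mu>\<^sup>2 * integral {0..L} (\<lambda>x. (k x)\<^sup>2) \<le> integral {0..L} (\<lambda>x. (h' x)\<^sup>2)"
  proof (rule wirtinger_cot[where Z="{x0-L/2,x0,x0+L/2,x0+L}" and p=x0, OF _ _ _ cont'])
    fix x :: real assume x: "x \<in> {0..L}"
    show "(k has_real_derivative h' x) (at x within {0..L})"
      unfolding k_def using der[OF x] by (auto intro!: derivative_eq_intros)
    \<comment> \<open>Of the four candidate poles the outer two can only be endpoints, for
      \<open>x0 = L/2\<close> and \<open>x0 = 0\<close>; there periodicity supplies the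
      zero.\<close>
    show "k x = 0" if xin: "x \<in> {x0 - L/2, x0, x0 + L/2, x0 + L}"
    proof -
      consider "x = x0" | "x = x0 + L/2" | "x = L" "x0 = 0" | "x = 0" "x0 = L/2"
        using xin x x0(1,2) by fastforce
      then have "h x = h x0"
      proof cases
        case 4 then show ?thesis using x0(3) per by (metis field_sum_of_halves)
      qed (use x0(3) per in auto)
      then show ?thesis by (simp add: k_def)
    qed
    show "x \<in> {x0 - L/2, x0, x0 + L/2, x0 + L} \<longleftrightarrow> sin (\<mu> * (x - x0)) = 0"
    proof
      assume "x \<in> {x0 - L/2, x0, x0 + L/2, x0 + L}"
      then have "x - x0 \<in> {- (L/2), 0, L/2, L}" by auto
      moreover have "\<mu> * - (L/2) = - pi" "\<mu> * (L/2) = pi" "\<mu> * L = 2 * pi" using L by (auto simp: \<mu>_def)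
      ultimately show "sin (\<mu> * (x - x0)) = 0"
        by (elim insertE emptyE) (simp_all only: sin_zero sin_pi sin_minus sin_two_pi mult_zero_right minus_zero)
    next
      assume "sin (\<mu> * (x - x0)) = 0"
      then obtain i :: int where i: "\<mu> * (x - x0) = of_int i * pi" by (auto simp: sin_zero_iff_int2)
      then have "pi * (2 * (x - x0)) = pi * (of_int i * L)" using L by (simp add: \<mu>_def field_simps)
      then have xi: "x - x0 = of_int i * L / 2" using mult_cancel_left[of pi] by auto
      have "- (L/2) \<le> of_int i * L / 2" "of_int i * L / 2 \<le> L" using xi x x0 by auto
      then have "L * -1 \<le> L * of_int i" "L * of_int i \<le> L * 2" by (auto simp: mult.commute)
      then have "of_int i \<ge> (-1::real)" "of_int i \<le> (2::real)"
        unfolding mult_le_cancel_left_pos[OF L] by auto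
      then have "i \<in> {-1,0,1,2}" by auto
      then show "x \<in> {x0 - L/2, x0, x0 + L/2, x0 + L}" using xi by auto
    qed
  next
    \<comment> \<open>The endpoints are a full period apart, so cotangent and \<open>k\<close> take
      equal values and the boundary terms agree.\<close>
    have "\<mu> * (L - x0) = \<mu> * (0 - x0) + 2 * pi" using L by (simp add: \<mu>_def field_simps)
    then show "cot (\<mu> * (0 - x0)) * (k 0)\<^sup>2 \<le> cot (\<mu> * (L - x0)) * (k L)\<^sup>2"
      using per by (simp add: k_def cot_def)
  qed (use L \<mu> in auto)
  then have "integral {0..L} (\<lambda>x. (k x)\<^sup>2) \<le> integral {0..L} (\<lambda>x. (h' x)\<^sup>2) / \<mu>\<^sup>2"
    using \<mu> by (subst pos_le_divide_eq) (simp_all add: mult.commute)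
  then have *: "integral {0..L} (\<lambda>x. (h x - h x0)\<^sup>2) \<le> (L / (2 * pi))\<^sup>2 * integral {0..L} (\<lambda>x. (h' x)\<^sup>2)"
    by (simp add: k_def \<mu>_def power_divide mult.commute)
  have "L * integral {0..L} (\<lambda>x. (h x)\<^sup>2) \<le> L * integral {0..L} (\<lambda>x. (h x - h x0)\<^sup>2) + (integral {0..L} h)\<^sup>2"
    using variance_shift[of 0 L h "h x0"] conth L by simp
  then have "integral {0..L} (\<lambda>x. (h x)\<^sup>2) \<le> integral {0..L} (\<lambda>x. (h x - h x0)\<^sup>2) + 1 / L * (integral {0..L} h)\<^sup>2"
    using L by (simp add: field_simps)
  with * show ?thesis by linarith
qed

lemma abs_mult_le_weighted:
  fixes a b \<epsilon> :: real
  assumes "0 < \<epsilon>"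
  shows "\<bar>a * b\<bar> \<le> \<epsilon> / 2 * a\<^sup>2 + 1 / (2 * \<epsilon>) * b\<^sup>2"
proof -
  have "0 \<le> (\<epsilon> * \<bar>a\<bar> - \<bar>b\<bar>)\<^sup>2" by simp
  then show ?thesis using assms by (simp add: field_simps power2_eq_square abs_mult)
qed

text \<open>The derivative \<open>2 h h'\<close> of the square is split by Young's inequality. The
  subinterval is arbitrary so that increments over several arcs can be added.\<close>

lemma square_increment_le:
  fixes h h' :: "real \<Rightarrow> real"
  assumes der: "\<And>x. x \<in> {0..L} \<Longrightarrow> (h has_real_derivative h' x) (at x within {0..L})"
    and cont': "continuous_on {0..L} h'" and \<epsilon>: "0 < \<epsilon>" and ab: "0 \<le> a" "a \<le> b" "b \<le> L"
  shows "\<bar>(h b)\<^sup>2 - (h a)\<^sup>2\<bar> \<le> 2 * integral {a..b} (\<lambda>x. \<epsilon> / 2 * (h x)\<^sup>2 + 1 / (2 * \<epsilon>) * (h' x)\<^sup>2)"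
proof -
  let ?d = "\<lambda>x. 2 * h x * h' x" and ?w = "\<lambda>x. \<epsilon> / 2 * (h x)\<^sup>2 + 1 / (2 * \<epsilon>) * (h' x)\<^sup>2"
  have sub: "{a..b} \<subseteq> {0..L}" using ab by auto
  have c: "continuous_on {a..b} h" "continuous_on {a..b} h'"
    using continuous_on_subset[OF DERIV_continuous_on[OF der] sub] continuous_on_subset[OF cont' sub] by auto
  have d: "((\<lambda>x. (h x)\<^sup>2) has_vector_derivative ?d x) (at x within {0..L})" if "x \<in> {0..L}" for x
    using der[OF that] by (auto simp: has_real_derivative_iff_has_vector_derivative[symmetric] intro!: derivative_eq_intros)
  have "(?d has_integral ((h b)\<^sup>2 - (h a)\<^sup>2)) {a..b}"
    by (rule fundamental_theorem_of_calculus) (use ab in \<open>auto intro!: has_vector_derivative_within_subset[OF d]\<close>)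
  then have "\<bar>(h b)\<^sup>2 - (h a)\<^sup>2\<bar> = \<bar>integral {a..b} ?d\<bar>" by (simp add: integral_unique)
  also have "\<dots> \<le> integral {a..b} (\<lambda>x. 2 * ?w x)"
  proof (rule integral_norm_bound_integral[where 'a=real, unfolded real_norm_def])
    show "?d integrable_on {a..b}" "(\<lambda>x. 2 * ?w x) integrable_on {a..b}"
      by (intro integrable_continuous_interval continuous_intros c; use \<epsilon> in simp)+
    show "\<bar>?d x\<bar> \<le> 2 * ?w x" for x
      using abs_mult_le_weighted[OF \<epsilon>, of "h x" "h' x"] by (simp add: abs_mult)
  qed
  finally show ?thesis by (simp only: integral_mult_right)
qed

lemma square_attains_below_mean:
  fixes h :: "real \<Rightarrow> real"
  assumes L: "0 < L" and c: "continuous_on {0..L} h"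
  obtains a where "a \<in> {0..L}" "(h a)\<^sup>2 \<le> integral {0..L} (\<lambda>x. 1 / L * (h x)\<^sup>2)"
proof -
  have "\<exists>x\<in>{0..L}. \<forall>y\<in>{0..L}. (h x)\<^sup>2 \<le> (h y)\<^sup>2"
    using L by (intro continuous_attains_inf) (auto intro!: continuous_intros c)
  then obtain a where a: "a \<in> {0..L}" and min: "\<And>x. x \<in> {0..L} \<Longrightarrow> (h a)\<^sup>2 \<le> (h x)\<^sup>2"
    by blast
  have "L * (h a)\<^sup>2 \<le> integral {0..L} (\<lambda>x. (h x)\<^sup>2)"
    using integral_le[of "\<lambda>_. (h a)\<^sup>2" "{0..L}" "\<lambda>x. (h x)\<^sup>2"] min L
    by (auto intro!: integrable_continuous_interval continuous_intros c)
  then show thesis using L a that by (simp add: field_simps)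
qed

text \<open>An interval offers a single path from \<open>x0\<close> to a point where the square is
  at most its mean; the derivative therefore enters with twice the weight it has in the periodic
  case.\<close>

lemma sup_square_general:
  fixes h h' :: "real \<Rightarrow> real"
  assumes der: "\<And>x. x \<in> {0..1} \<Longrightarrow> (h has_real_derivative h' x) (at x within {0..1})"
    and cont': "continuous_on {0..1} h'" and \<eta>: "0 < \<eta>" and x0: "x0 \<in> {0..1}"
  shows "(h x0)\<^sup>2 \<le> integral {0..1} (\<lambda>x. (1 + \<eta>) * (h x)\<^sup>2 + 1 / \<eta> * (h' x)\<^sup>2)"
proof -
  let ?w = "\<lambda>x. \<eta> / 2 * (h x)\<^sup>2 + 1 / (2 * \<eta>) * (h' x)\<^sup>2"
  note c = DERIV_continuous_on[OF der]
  obtain a where a: "a \<in> {0..1}" "(h a)\<^sup>2 \<le> integral {0..1} (\<lambda>x. 1 / 1 * (h x)\<^sup>2)"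
    using square_attains_below_mean[OF zero_less_one c] by blast
  have w: "?w integrable_on {p..q}" if "{p..q} \<subseteq> {0..1}" for p q
    using continuous_on_subset[OF c that] continuous_on_subset[OF cont' that] \<eta>
    by (auto intro!: integrable_continuous_interval continuous_intros)
  have "\<bar>(h q)\<^sup>2 - (h p)\<^sup>2\<bar> \<le> 2 * integral {0..1} ?w" if "0 \<le> p" "p \<le> q" "q \<le> 1" for p q
  proof -
    have "integral {p..q} ?w \<le> integral {0..1} ?w"
      by (rule integral_subset_le) (use that w \<eta> in auto)
    then show ?thesis using square_increment_le[OF der cont' \<eta> that] by linarith
  qed
  from this[of x0 a] this[of a x0] have "(h x0)\<^sup>2 \<le> (h a)\<^sup>2 + 2 * integral {0..1} ?w"
    using x0 a(1) by (cases "x0 \<le> a") auto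
  also have "\<dots> \<le> integral {0..1} (\<lambda>x. (h x)\<^sup>2) + integral {0..1} (\<lambda>x. 2 * ?w x)"
    using a(2) by (simp only: integral_mult_right)
  also have "\<dots> = integral {0..1} (\<lambda>x. (h x)\<^sup>2 + 2 * ?w x)"
    by (intro integral_add[symmetric] integrable_continuous_interval continuous_intros c cont')
  finally show ?thesis by (simp add: algebra_simps)
qed

lemma sup_square_periodic:
  fixes h h' :: "real \<Rightarrow> real"
  assumes L: "0 < L" and der: "\<And>x. x \<in> {0..L} \<Longrightarrow> (h has_real_derivative h' x) (at x within {0..L})"
    and cont': "continuous_on {0..L} h'" and per: "h 0 = h L" and \<epsilon>: "0 < \<epsilon>" and x0: "x0 \<in> {0..L}"
  shows "(h x0)\<^sup>2 \<le> integral {0..L} (\<lambda>x. (1 / L + \<epsilon> / 2) * (h x)\<^sup>2 + 1 / (2 * \<epsilon>) * (h' x)\<^sup>2)"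
proof -
  let ?w = "\<lambda>x. \<epsilon> / 2 * (h x)\<^sup>2 + 1 / (2 * \<epsilon>) * (h' x)\<^sup>2"
  note c = DERIV_continuous_on[OF der]
  obtain a where a: "a \<in> {0..L}" "(h a)\<^sup>2 \<le> integral {0..L} (\<lambda>x. 1 / L * (h x)\<^sup>2)"
    using square_attains_below_mean[OF L c] by blast
  have w: "?w integrable_on {p..q}" if "{p..q} \<subseteq> {0..L}" for p q
    using continuous_on_subset[OF c that] continuous_on_subset[OF cont' that] \<epsilon>
    by (auto intro!: integrable_continuous_interval continuous_intros)
  note step = square_increment_le[OF der cont' \<epsilon>]
  \<comment> \<open>Two points of a circle are joined by two arcs; averaging over both halves the bound.\<close>
  have "\<bar>(h q)\<^sup>2 - (h p)\<^sup>2\<bar> \<le> integral {0..L} ?w" if pq: "0 \<le> p" "p \<le> q" "q \<le> L" for p q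
  proof -
    have "integral {0..L} ?w = integral {0..p} ?w + integral {p..q} ?w + integral {q..L} ?w"
      using Henstock_Kurzweil_Integration.integral_combine[of 0 p L ?w]
        Henstock_Kurzweil_Integration.integral_combine[of p q L ?w] w pq by auto
    moreover have "(h 0)\<^sup>2 = (h L)\<^sup>2" using per by simp
    ultimately show ?thesis using step[of 0 p] step[of p q] step[of q L] pq by linarith
  qed
  from this[of x0 a] this[of a x0] have "(h x0)\<^sup>2 \<le> (h a)\<^sup>2 + integral {0..L} ?w"
    using x0 a(1) by (cases "x0 \<le> a") auto
  also have "\<dots> \<le> integral {0..L} (\<lambda>x. 1 / L * (h x)\<^sup>2) + integral {0..L} ?w"
    using a(2) by simp
  also have "\<dots> = integral {0..L} (\<lambda>x. 1 / L * (h x)\<^sup>2 + ?w x)"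
    by (intro integral_add[symmetric] integrable_continuous_interval continuous_intros c cont')
  finally show ?thesis by (simp add: algebra_simps)
qed

subsection \<open>Calculus of smooth functions\<close>

text \<open>The last condition makes derivatives within \<open>S\<close> unique.\<close>

definition boxlike :: "'a::euclidean_space set \<Rightarrow> bool" where
  "boxlike S \<longleftrightarrow> convex S \<and> interior S \<noteq> {} \<and>
     (\<forall>x\<in>S. \<forall>i\<in>Basis. \<forall>e>0. \<exists>d. 0 < \<bar>d\<bar> \<and> \<bar>d\<bar> < e \<and> x + d *\<^sub>R i \<in> S)"

lemma frechet_derivative_eqI:
  assumes "boxlike S" "x \<in> S" "(f has_derivative f') (at x within S)"
  shows "frechet_derivative f (at x within S) = f'"
proof (rule frechet_derivative_unique_within)
  show "(f has_derivative frechet_derivative f (at x within S)) (at x within S)"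
    using assms(3) by (meson differentiableI frechet_derivative_works)
qed (use assms in \<open>auto simp: boxlike_def\<close>)

lemma frechet_derivative_within_cong:
  assumes "\<And>y. y \<in> S \<Longrightarrow> f y = g y" "x \<in> S"
  shows "frechet_derivative f (at x within S) = frechet_derivative g (at x within S)"
proof -
  have "(f has_derivative D) (at x within S) \<longleftrightarrow> (g has_derivative D) (at x within S)" for D
    using has_derivative_transform[OF assms(2), of g f] has_derivative_transform[OF assms(2), of f g] assms(1)
    by auto
  then show ?thesis by (simp add: frechet_derivative_def)
qed

lemma Ck_on_cong:
  assumes "\<And>y. y \<in> S \<Longrightarrow> f y = g y"
  shows "Ck_on k f S \<longleftrightarrow> Ck_on k g S"
  using assms
proof (induction k arbitrary: f g)
  case 0
  then show ?case using continuous_on_cong[of S S f g] by simp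
next
  case (Suc k)
  have "f differentiable_on S \<longleftrightarrow> g differentiable_on S"
    using Suc.prems unfolding differentiable_on_def differentiable_def
    by (metis has_derivative_transform)
  moreover have "Ck_on k (\<lambda>x. frechet_derivative f (at x within S) e) S \<longleftrightarrow>
     Ck_on k (\<lambda>x. frechet_derivative g (at x within S) e) S" for e
    by (rule Suc.IH) (metis Suc.prems frechet_derivative_within_cong)
  ultimately show ?case by simp
qed

lemma Ck_on_Suc_imp: "Ck_on (Suc k) f S \<Longrightarrow> Ck_on k f S"
proof (induction k arbitrary: f)
  case 0
  then show ?case by (simp add: differentiable_imp_continuous_on)
next
  case (Suc k)
  then show ?case by (metis Ck_on.simps(2))
qed

text \<open>Lets the inductions use whatever derivative the calculus rules produce; on a boxlike set
  it has to be the \<open>frechet_derivative\<close>.\<close>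

lemma Ck_on_SucI:
  assumes "boxlike S" "\<And>x. x \<in> S \<Longrightarrow> (f has_derivative f' x) (at x within S)"
    and "\<And>e. e \<in> Basis \<Longrightarrow> Ck_on k (\<lambda>x. f' x e) S"
  shows "Ck_on (Suc k) f S"
proof -
  have "frechet_derivative f (at x within S) = f' x" if "x \<in> S" for x
    using assms that by (intro frechet_derivative_eqI) auto
  then have "Ck_on k (\<lambda>x. frechet_derivative f (at x within S) e) S" if "e \<in> Basis" for e
    using Ck_on_cong[of S "\<lambda>x. frechet_derivative f (at x within S) e" "\<lambda>x. f' x e" k] assms(3) that by simp
  moreover have "f differentiable_on S"
    using assms(2) by (auto simp: differentiable_on_def differentiable_def)
  ultimately show ?thesis by simp
qed

lemma Ck_on_SucD:
  assumes "Ck_on (Suc k) f S" "x \<in> S"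
  shows "(f has_derivative frechet_derivative f (at x within S)) (at x within S)"
  using assms by (auto simp: differentiable_on_def frechet_derivative_works)

lemma Ck_on_const: "boxlike S \<Longrightarrow> Ck_on k (\<lambda>x. c) S"
proof (induction k arbitrary: c)
  case (Suc k)
  show ?case by (rule Ck_on_SucI[where f' = "\<lambda>x h. 0"]) (use Suc in auto)
qed simp

lemma Ck_on_linear:
  assumes "bounded_linear L" "boxlike S"
  shows "Ck_on k f S \<Longrightarrow> Ck_on k (\<lambda>x. L (f x)) S"
proof (induction k arbitrary: f)
  case 0
  then show ?case using assms bounded_linear.continuous_on by auto
next
  case (Suc k)
  show ?case
    by (rule Ck_on_SucI[OF assms(2) bounded_linear.has_derivative[OF assms(1) Ck_on_SucD[OF Suc.prems]]])
      (use Suc in auto)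
qed

lemma Ck_on_add:
  assumes "boxlike S"
  shows "Ck_on k f S \<Longrightarrow> Ck_on k g S \<Longrightarrow> Ck_on k (\<lambda>x. f x + g x) S"
proof (induction k arbitrary: f g)
  case 0
  then show ?case by (auto intro: continuous_intros)
next
  case (Suc k)
  show ?case
    by (rule Ck_on_SucI[OF assms has_derivative_add[OF Ck_on_SucD[OF Suc.prems(1)] Ck_on_SucD[OF Suc.prems(2)]]])
      (use Suc in auto)
qed

lemma Ck_on_mult:
  fixes f g :: "'a::euclidean_space \<Rightarrow> real"
  assumes "boxlike S"
  shows "Ck_on k f S \<Longrightarrow> Ck_on k g S \<Longrightarrow> Ck_on k (\<lambda>x. f x * g x) S"
proof (induction k arbitrary: f g)
  case 0
  then show ?case by (auto intro: continuous_intros)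
next
  case (Suc k)
  have D: "Ck_on k f S" "Ck_on k g S"
    "\<And>e. e \<in> Basis \<Longrightarrow> Ck_on k (\<lambda>x. frechet_derivative f (at x within S) e) S"
    "\<And>e. e \<in> Basis \<Longrightarrow> Ck_on k (\<lambda>x. frechet_derivative g (at x within S) e) S"
    using Ck_on_Suc_imp[OF Suc.prems(1)] Ck_on_Suc_imp[OF Suc.prems(2)] Suc.prems by auto
  show ?case
    by (rule Ck_on_SucI[OF assms has_derivative_mult[OF Ck_on_SucD[OF Suc.prems(1)] Ck_on_SucD[OF Suc.prems(2)]]])
      (assumption | rule Ck_on_add[OF assms] Suc.IH D)+
qed

lemma smooth_on_has_derivative:
  "smooth_on f S \<Longrightarrow> x \<in> S \<Longrightarrow> (f has_derivative frechet_derivative f (at x within S)) (at x within S)"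
  using Ck_on_SucD smooth_on_def by blast

lemma smooth_on_derivative:
  "smooth_on f S \<Longrightarrow> e \<in> Basis \<Longrightarrow> smooth_on (\<lambda>x. frechet_derivative f (at x within S) e) S"
  unfolding smooth_on_def by (metis Ck_on.simps(2))

lemma smooth_on_continuous: "smooth_on f S \<Longrightarrow> continuous_on S f"
  unfolding smooth_on_def using Ck_on.simps(1) by blast

text \<open>The second difference is symmetric in \<open>e\<close> and \<open>e'\<close>, while two
  mean value theorems express it by the mixed derivative in one order. Exchanging the two directions
  gives the other order.\<close>

lemma mixed_difference:
  fixes f :: "'a::euclidean_space \<Rightarrow> real"
  assumes f: "smooth_on f S" and e: "e \<in> Basis" "e' \<in> Basis" and h: "0 < h"
    and sub: "cball x (2 * h) \<subseteq> interior S"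
  obtains y where "dist x y \<le> 2 * h"
    "f (x + h *\<^sub>R e + h *\<^sub>R e') - f (x + h *\<^sub>R e) - f (x + h *\<^sub>R e') + f x =
      h * h * frechet_derivative (\<lambda>z. frechet_derivative f (at z within S) e) (at y within S) e'"
proof -
  let ?D = "\<lambda>z. frechet_derivative f (at z within S) e"
  have in_ball: "x + s *\<^sub>R e + t *\<^sub>R e' \<in> interior S \<and> dist x (x + s *\<^sub>R e + t *\<^sub>R e') \<le> 2 * h"
    if "0 \<le> s" "s \<le> h" "0 \<le> t" "t \<le> h" for s t
  proof -
    have "norm (s *\<^sub>R e + t *\<^sub>R e') \<le> norm (s *\<^sub>R e) + norm (t *\<^sub>R e')" by (rule norm_triangle_ineq)
    also have "\<dots> \<le> 2 * h" using that e by simp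
    finally have "dist x (x + s *\<^sub>R e + t *\<^sub>R e') \<le> 2 * h"
      by (metis add.assoc dist_add_cancel dist_0_norm add.right_neutral)
    then show ?thesis using sub by (auto simp: subset_iff)
  qed
  have line: "((\<lambda>s. g (p + s *\<^sub>R v)) has_real_derivative frechet_derivative g (at (p + s *\<^sub>R v) within S) v) (at s)"
    if "smooth_on g S" "p + s *\<^sub>R v \<in> interior S" for g :: "'a \<Rightarrow> real" and p v s
  proof -
    have "(g has_derivative frechet_derivative g (at (p + s *\<^sub>R v) within S)) (at (p + s *\<^sub>R v))"
      using smooth_on_has_derivative[OF that(1)] that(2) by (metis at_within_interior interior_subset subsetD)
    then have "((\<lambda>s. g (p + s *\<^sub>R v)) has_derivative (\<lambda>r. frechet_derivative g (at (p + s *\<^sub>R v) within S) (r *\<^sub>R v))) (at s)"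
      by (rule has_derivative_compose[rotated]) (auto intro!: derivative_eq_intros)
    moreover have "linear (frechet_derivative g (at (p + s *\<^sub>R v) within S))"
      using smooth_on_has_derivative[OF that(1)] that(2) by (meson has_derivative_linear interior_subset subsetD)
    ultimately show ?thesis
      by (simp add: has_field_derivative_def linear_scale mult.commute[of _ "frechet_derivative _ _ _"])
  qed
  have "\<exists>s>0. s < h \<and> (\<lambda>s. f (x + h *\<^sub>R e' + s *\<^sub>R e) - f (x + s *\<^sub>R e)) h - (\<lambda>s. f (x + h *\<^sub>R e' + s *\<^sub>R e) - f (x + s *\<^sub>R e)) 0
     = (h - 0) * (?D (x + h *\<^sub>R e' + s *\<^sub>R e) - ?D (x + s *\<^sub>R e))"
    by (rule MVT2[OF h]) (intro DERIV_diff line[OF f]; use in_ball[of _ h] in_ball[of _ 0] h in \<open>auto simp: algebra_simps\<close>)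
  then obtain s where s: "0 < s" "s < h" and
    1: "f (x + h *\<^sub>R e' + h *\<^sub>R e) - f (x + h *\<^sub>R e) - (f (x + h *\<^sub>R e') - f x) = h * (?D (x + s *\<^sub>R e + h *\<^sub>R e') - ?D (x + s *\<^sub>R e))"
    by (auto simp: algebra_simps)
  have "\<exists>t>0. t < h \<and> ?D (x + s *\<^sub>R e + h *\<^sub>R e') - ?D (x + s *\<^sub>R e + 0 *\<^sub>R e')
     = (h - 0) * (frechet_derivative ?D (at (x + s *\<^sub>R e + t *\<^sub>R e') within S) e')"
    by (rule MVT2[OF h]) (intro line smooth_on_derivative f e; use in_ball[of s] s in auto)
  then obtain t where t: "0 < t" "t < h" and
    2: "?D (x + s *\<^sub>R e + h *\<^sub>R e') - ?D (x + s *\<^sub>R e) = h * frechet_derivative ?D (at (x + s *\<^sub>R e + t *\<^sub>R e') within S) e'"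
    by auto
  show thesis
    by (rule that[of "x + s *\<^sub>R e + t *\<^sub>R e'"]) (use in_ball[of s t] s t 1 2 in \<open>auto simp: algebra_simps\<close>)
qed

lemma mixed_derivatives_commute_interior:
  fixes f :: "'a::euclidean_space \<Rightarrow> real"
  assumes f: "smooth_on f S" and e: "e \<in> Basis" "e' \<in> Basis" and x: "x \<in> interior S"
  shows "frechet_derivative (\<lambda>z. frechet_derivative f (at z within S) e) (at x within S) e' =
    frechet_derivative (\<lambda>z. frechet_derivative f (at z within S) e') (at x within S) e"
    (is "?a x = ?b x")
proof (rule ccontr)
  assume ne: "?a x \<noteq> ?b x"
  define \<epsilon> where "\<epsilon> = \<bar>?a x - ?b x\<bar> / 2"
  have \<epsilon>: "\<epsilon> > 0" using ne by (simp add: \<epsilon>_def)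
  have ca: "isCont ?a x" "isCont ?b x"
    using smooth_on_continuous[OF smooth_on_derivative[OF smooth_on_derivative[OF f e(1)] e(2)]]
      smooth_on_continuous[OF smooth_on_derivative[OF smooth_on_derivative[OF f e(2)] e(1)]] x
    by (auto intro: continuous_on_interior)
  obtain d1 where d1: "d1 > 0" "\<And>y. dist y x < d1 \<Longrightarrow> dist (?a y) (?a x) < \<epsilon>"
    using ca(1) \<epsilon> unfolding continuous_at_eps_delta by (auto simp: dist_norm) 
  obtain d2 where d2: "d2 > 0" "\<And>y. dist y x < d2 \<Longrightarrow> dist (?b y) (?b x) < \<epsilon>"
    using ca(2) \<epsilon> unfolding continuous_at_eps_delta by (auto simp: dist_norm) 
  obtain r where r: "r > 0" "cball x r \<subseteq> interior S"
    using x open_contains_cball open_interior by blast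
  define h where "h = min r (min d1 d2) / 3"
  have h: "0 < h" "2 * h < d1" "2 * h < d2" "cball x (2 * h) \<subseteq> interior S"
    using d1(1) d2(1) r by (auto simp: h_def)
  obtain y where y: "dist x y \<le> 2 * h" "f (x + h *\<^sub>R e + h *\<^sub>R e') - f (x + h *\<^sub>R e) - f (x + h *\<^sub>R e') + f x = h * h * ?a y"
    using mixed_difference[OF f e h(1,4)] by blast
  obtain z where z: "dist x z \<le> 2 * h" "f (x + h *\<^sub>R e' + h *\<^sub>R e) - f (x + h *\<^sub>R e') - f (x + h *\<^sub>R e) + f x = h * h * ?b z"
    using mixed_difference[OF f e(2,1) h(1,4)] by blast
  have "h * h * ?a y = h * h * ?b z" using y(2) z(2) by (simp add: algebra_simps)
  then have "?a y = ?b z" using h(1) by simp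
  moreover have "dist (?a y) (?a x) < \<epsilon>" "dist (?b z) (?b x) < \<epsilon>"
    using y(1) z(1) h d1(2)[of y] d2(2)[of z] by (auto simp: dist_commute)
  ultimately have "dist (?a x) (?b x) < \<epsilon> + \<epsilon>"
    using dist_triangle2[of "?a x" "?b x" "?a y"] by (simp add: dist_commute)
  then show False by (simp add: \<epsilon>_def dist_real_def)
qed

text \<open>A convex set with interior points lies in the closure of its interior, and the mixed
  derivatives are continuous up to the boundary, so the identity passes to boundary points.\<close>

lemma mixed_derivatives_commute:
  fixes f :: "'a::euclidean_space \<Rightarrow> real"
  assumes f: "smooth_on f S" and S: "boxlike S" and e: "e \<in> Basis" "e' \<in> Basis" and x: "x \<in> S"
  shows "frechet_derivative (\<lambda>z. frechet_derivative f (at z within S) e) (at x within S) e' =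
    frechet_derivative (\<lambda>z. frechet_derivative f (at z within S) e') (at x within S) e"
    (is "?a x = ?b x")
proof -
  have "x \<in> closure (interior S)"
    using S x closure_subset unfolding boxlike_def by (metis convex_closure_interior subsetD)
  then obtain X where X: "\<And>n. X n \<in> interior S" "X \<longlonglongrightarrow> x"
    unfolding closure_sequential by blast
  have "continuous_on S (\<lambda>y. ?a y - ?b y)"
    by (intro continuous_intros smooth_on_continuous smooth_on_derivative f e)
  then have "(\<lambda>n. ?a (X n) - ?b (X n)) \<longlonglongrightarrow> ?a x - ?b x"
    by (rule continuous_on_tendsto_compose[OF _ X(2) x])
      (use X(1) interior_subset in \<open>blast intro: always_eventually\<close>)
  moreover have "?a (X n) - ?b (X n) = 0" for n
    using mixed_derivatives_commute_interior[OF f e X(1)] by simp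
  ultimately show ?thesis by (simp add: LIMSEQ_const_iff)
qed

lemma boxlike_slab: "boxlike slab"
  unfolding boxlike_def
proof (intro conjI ballI allI impI)
  show "convex slab"
    unfolding slab_def convex_def by (auto intro: convex_bound_le)
  have "open {x::real^3. 0 < x$3 \<and> x$3 < 1}"
    by (intro open_Collect_conj open_Collect_less continuous_intros)
  then have "{x::real^3. 0 < x$3 \<and> x$3 < 1} \<subseteq> interior slab"
    by (intro interior_maximal) (auto simp: slab_def)
  moreover have "(\<chi> i. 1/2) \<in> {x::real^3. 0 < x$3 \<and> x$3 < 1}" by simp
  ultimately show "interior slab \<noteq> {}" by blast
next
  fix x :: "real^3" and i :: "real^3" and e :: real
  assume x: "x \<in> slab" and i: "i \<in> Basis" and e: "0 < e"
  obtain j where j: "i = axis j 1" using i by (auto simp: Basis_vec_def)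
  define d where "d = (if x$3 < 1/2 then min (e/2) (1/2) else - min (e/2) (1/2))"
  show "\<exists>d. 0 < \<bar>d\<bar> \<and> \<bar>d\<bar> < e \<and> x + d *\<^sub>R i \<in> slab"
    by (rule exI[of _ d]) (use x e in \<open>auto simp: d_def j slab_def axis_def\<close>)
qed

lemma boxlike_interval:
  fixes I :: "real set"
  assumes "is_interval I" "interior I \<noteq> {}"
  shows "boxlike I"
  unfolding boxlike_def
proof (intro conjI ballI allI impI)
  fix x i e :: real
  assume x: "x \<in> I" and i: "i \<in> Basis" and e: "0 < e"
  have "I \<noteq> {x}" using assms(2) interior_singleton by metis
  then obtain y where y: "y \<in> I" "y \<noteq> x" using x by blast
  define d where "d = (if x < y then min (e/2) (y - x) else - min (e/2) (x - y))"
  have "x + d \<in> I"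
  proof (cases "x < y")
    case True
    then show ?thesis using e by (intro mem_is_interval_1_I[OF assms(1) x y(1)]) (auto simp: d_def)
  next
    case False
    then show ?thesis using e y(2) by (intro mem_is_interval_1_I[OF assms(1) y(1) x]) (auto simp: d_def)
  qed
  then show "\<exists>d. 0 < \<bar>d\<bar> \<and> \<bar>d\<bar> < e \<and> x + d *\<^sub>R i \<in> I"
    using i y e by (intro exI[of _ d]) (auto simp: d_def)
qed (use assms is_interval_convex in auto)

lemma boxlike_Times:
  assumes "boxlike A" "boxlike B"
  shows "boxlike (A \<times> B)"
  unfolding boxlike_def
proof (intro conjI ballI allI impI)
  fix p i :: "'a \<times> 'b" and e :: real
  assume p: "p \<in> A \<times> B" and i: "i \<in> Basis" and e: "0 < e"
  consider u where "u \<in> Basis" "i = (u, 0)" | u where "u \<in> Basis" "i = (0, u)"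
    using i by (auto simp: Basis_prod_def)
  then show "\<exists>d. 0 < \<bar>d\<bar> \<and> \<bar>d\<bar> < e \<and> p + d *\<^sub>R i \<in> A \<times> B"
  proof cases
    case 1
    have "fst p \<in> A" using p by auto
    then obtain d where "0 < \<bar>d\<bar>" "\<bar>d\<bar> < e" "fst p + d *\<^sub>R u \<in> A"
      using assms(1) 1(1) e unfolding boxlike_def by blast
    then show ?thesis using 1 p by (intro exI[of _ d]) (auto simp: plus_prod_def)
  next
    case 2
    have "snd p \<in> B" using p by auto
    then obtain d where "0 < \<bar>d\<bar>" "\<bar>d\<bar> < e" "snd p + d *\<^sub>R u \<in> B"
      using assms(2) 2(1) e unfolding boxlike_def by blast
    then show ?thesis using 2 p by (intro exI[of _ d]) (auto simp: plus_prod_def)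
  qed
qed (use assms in \<open>auto simp: boxlike_def convex_Times interior_Times\<close>)

subsection \<open>Partial derivatives on the slab\<close>

abbreviation smooth :: "(real^3 \<Rightarrow> real) \<Rightarrow> bool" where
  "smooth f \<equiv> smooth_on f slab"

lemma axis_Basis [simp]: "axis i (1::real) \<in> (Basis :: (real^'n) set)"
  by (simp add: axis_in_Basis_iff)

lemma pd_eqI: "(f has_derivative f') (at x within slab) \<Longrightarrow> x \<in> slab \<Longrightarrow> pd i f x = f' (axis i 1)"
  by (simp add: pd_def frechet_derivative_eqI[OF boxlike_slab])

lemma pd_cong: "(\<And>y. y \<in> slab \<Longrightarrow> f y = g y) \<Longrightarrow> x \<in> slab \<Longrightarrow> pd i f x = pd i g x"
  by (simp add: pd_def frechet_derivative_within_cong[of slab f g])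

lemma smooth_pd: "smooth_on f slab \<Longrightarrow> smooth_on (pd i f) slab"
  unfolding pd_def[abs_def] by (rule smooth_on_derivative) auto

lemma smooth_const: "smooth (\<lambda>x. c)"
  by (simp add: smooth_on_def Ck_on_const boxlike_slab)

lemma smooth_add: "smooth f \<Longrightarrow> smooth g \<Longrightarrow> smooth (\<lambda>x. f x + g x)"
  by (simp add: smooth_on_def Ck_on_add boxlike_slab)

lemma smooth_mult: "smooth f \<Longrightarrow> smooth g \<Longrightarrow> smooth (\<lambda>x. f x * g x)"
  by (simp add: smooth_on_def Ck_on_mult boxlike_slab)

lemma smooth_minus: "smooth f \<Longrightarrow> smooth (\<lambda>x. - f x)"
  using smooth_mult[OF smooth_const[of "-1"]] by simp

lemma smooth_diff: "smooth f \<Longrightarrow> smooth g \<Longrightarrow> smooth (\<lambda>x. f x - g x)"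
  using smooth_add[OF _ smooth_minus] by simp

lemma smooth_power2: "smooth f \<Longrightarrow> smooth (\<lambda>x. (f x)\<^sup>2)"
  by (simp add: power2_eq_square smooth_mult)

lemma smooth_sum: "(\<And>i. i \<in> A \<Longrightarrow> smooth (f i)) \<Longrightarrow> smooth (\<lambda>x. \<Sum>i\<in>A. f i x)"
  by (induction A rule: infinite_finite_induct) (auto intro: smooth_const smooth_add)

lemma smooth_component: "smooth_on F slab \<Longrightarrow> smooth (\<lambda>x. F x $ i)" for F :: "real^3 \<Rightarrow> real^3"
  unfolding smooth_on_def by (simp add: Ck_on_linear[OF bounded_linear_vec_nth boxlike_slab])

lemmas smooth_intros = smooth_const smooth_add smooth_mult smooth_minus smooth_diff smooth_power2 smooth_sum smooth_pd

lemma smooth_has_derivative: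
  assumes "smooth f" "x \<in> slab"
  shows "(f has_derivative (\<lambda>h. \<Sum>i\<in>UNIV. h $ i * pd i f x)) (at x within slab)"
proof -
  let ?D = "frechet_derivative f (at x within slab)"
  have D: "(f has_derivative ?D) (at x within slab)" using smooth_on_has_derivative assms by blast
  then have lin: "linear ?D" by (rule has_derivative_linear)
  have "?D h = (\<Sum>i\<in>UNIV. h $ i * pd i f x)" for h
  proof -
    have "?D h = ?D (\<Sum>i\<in>UNIV. h $ i *\<^sub>R axis i 1)"
      by (metis (no_types, lifting) basis_expansion scalar_mult_eq_scaleR sum.cong)
    also have "\<dots> = (\<Sum>i\<in>UNIV. h $ i * pd i f x)"
      by (simp add: linear_sum[OF lin] linear_scale[OF lin] pd_def)
    finally show ?thesis .
  qed
  then have "?D = (\<lambda>h. \<Sum>i\<in>UNIV. h $ i * pd i f x)" by auto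
  then show ?thesis using D by simp
qed

lemma pd_const [simp]: "x \<in> slab \<Longrightarrow> pd i (\<lambda>x. c) x = 0"
  by (rule pd_eqI) auto

lemma pd_add: "smooth f \<Longrightarrow> smooth g \<Longrightarrow> x \<in> slab \<Longrightarrow> pd i (\<lambda>x. f x + g x) x = pd i f x + pd i g x"
  unfolding pd_def[of i f] pd_def[of i g] by (rule pd_eqI[OF has_derivative_add]) (auto intro: smooth_on_has_derivative)

lemma pd_diff: "smooth f \<Longrightarrow> smooth g \<Longrightarrow> x \<in> slab \<Longrightarrow> pd i (\<lambda>x. f x - g x) x = pd i f x - pd i g x"
  unfolding pd_def[of i f] pd_def[of i g] by (rule pd_eqI[OF has_derivative_diff]) (auto intro: smooth_on_has_derivative)

lemma pd_minus: "smooth f \<Longrightarrow> x \<in> slab \<Longrightarrow> pd i (\<lambda>x. - f x) x = - pd i f x"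
  unfolding pd_def[of i f] by (rule pd_eqI[OF has_derivative_minus]) (auto intro: smooth_on_has_derivative)

lemma pd_mult: "smooth f \<Longrightarrow> smooth g \<Longrightarrow> x \<in> slab \<Longrightarrow> pd i (\<lambda>x. f x * g x) x = f x * pd i g x + pd i f x * g x"
  unfolding pd_def[of i f] pd_def[of i g] by (rule pd_eqI[OF has_derivative_mult]) (auto intro: smooth_on_has_derivative)

lemma pd_cmult: "smooth f \<Longrightarrow> x \<in> slab \<Longrightarrow> pd i (\<lambda>x. c * f x) x = c * pd i f x"
  by (simp add: pd_mult smooth_const)

lemma pd_sum: "(\<And>j. j \<in> A \<Longrightarrow> smooth (f j)) \<Longrightarrow> x \<in> slab \<Longrightarrow> pd i (\<lambda>x. \<Sum>j\<in>A. f j x) x = (\<Sum>j\<in>A. pd i (f j) x)"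
  by (induction A rule: infinite_finite_induct) (auto simp: pd_add smooth_sum)

lemma pd_commute: "smooth f \<Longrightarrow> x \<in> slab \<Longrightarrow> pd i (pd j f) x = pd j (pd i f) x"
  unfolding pd_def[abs_def] by (rule mixed_derivatives_commute[OF _ boxlike_slab]) auto

lemma pd_component:
  fixes F :: "real^3 \<Rightarrow> real^3"
  assumes "smooth_on F slab" "x \<in> slab"
  shows "pd i F x $ j = pd i (\<lambda>y. F y $ j) x"
proof -
  have "((\<lambda>y. F y $ j) has_derivative (\<lambda>h. frechet_derivative F (at x within slab) h $ j)) (at x within slab)"
    by (rule bounded_linear.has_derivative[OF bounded_linear_vec_nth smooth_on_has_derivative[OF assms]])
  then show ?thesis using assms(2) by (simp add: pd_eqI) (simp add: pd_def)
qed

lemma has_derivative_compose_within: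
  assumes "(g has_derivative g') (at (f x) within T)" "(f has_derivative f') (at x within S)" "f ` S \<subseteq> T"
  shows "((\<lambda>x. g (f x)) has_derivative (\<lambda>h. g' (f' h))) (at x within S)"
  by (rule has_derivative_in_compose[OF assms(2) has_derivative_subset[OF assms(1,3)]])

lemma smooth_line_derivative:
  assumes "smooth f" "p + s *\<^sub>R axis i 1 \<in> slab" "\<And>r. r \<in> A \<Longrightarrow> p + r *\<^sub>R axis i 1 \<in> slab"
  shows "((\<lambda>r. f (p + r *\<^sub>R axis i 1)) has_real_derivative pd i f (p + s *\<^sub>R axis i 1)) (at s within A)"
proof -
  let ?D = "frechet_derivative f (at (p + s *\<^sub>R axis i 1) within slab)"
  have D: "(f has_derivative ?D) (at (p + s *\<^sub>R axis i 1) within slab)"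
    by (rule smooth_on_has_derivative[OF assms(1,2)])
  have "((\<lambda>r. f (p + r *\<^sub>R axis i 1)) has_derivative (\<lambda>r. ?D (r *\<^sub>R axis i 1))) (at s within A)"
    by (rule has_derivative_compose_within[where g=f and f="\<lambda>r. p + r *\<^sub>R axis i 1" and x=s, OF D]) (use assms in \<open>auto intro!: derivative_eq_intros\<close>)
  then show ?thesis
    using linear_scale[OF has_derivative_linear[OF D]]
    by (simp add: has_field_derivative_def pd_def mult.commute[of _ "frechet_derivative _ _ _"])
qed

lemma pd_horizontal_zero:
  assumes f: "smooth f" and c: "\<And>x. x $ 3 = z \<Longrightarrow> f x = c" and z: "0 \<le> z" "z \<le> 1"
    and x: "x $ 3 = z" and i: "i \<noteq> 3"
  shows "pd i f x = 0"
proof -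
  have "((\<lambda>r. f (x + r *\<^sub>R axis i 1)) has_real_derivative pd i f (x + 0 *\<^sub>R axis i 1)) (at 0 within UNIV)"
    by (rule smooth_line_derivative[OF f]) (use x z i in \<open>auto simp: slab_def axis_def\<close>)
  moreover have "f (x + r *\<^sub>R axis i 1) = c" for r
    by (rule c) (use x i in \<open>simp add: axis_def\<close>)
  ultimately have "((\<lambda>r. c) has_real_derivative pd i f x) (at 0)" by simp
  then show ?thesis using DERIV_unique[OF _ DERIV_const] by blast
qed

abbreviation adv :: "(3 \<Rightarrow> real^3 \<Rightarrow> real) \<Rightarrow> (real^3 \<Rightarrow> real) \<Rightarrow> real^3 \<Rightarrow> real" where
  "adv v f x \<equiv> \<Sum>i\<in>UNIV. v i x * pd i f x"

subsection \<open>Slices of space-time fields\<close>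

lemma has_derivative_slice:
  assumes "(F has_derivative F') (at (t, x) within I \<times> S)" "t \<in> I"
  shows "((\<lambda>x. F (t, x)) has_derivative (\<lambda>h. F' (0, h))) (at x within S)"
  by (rule has_derivative_compose_within[where g=F and f="\<lambda>x. (t, x)", OF assms(1)])
    (use assms in \<open>auto intro!: derivative_eq_intros\<close>)

lemma Ck_on_slice:
  fixes F :: "real \<times> (real^3) \<Rightarrow> 'b::real_normed_vector"
  assumes "t \<in> I"
  shows "Ck_on k F (I \<times> slab) \<Longrightarrow> Ck_on k (\<lambda>x. F (t, x)) slab"
proof (induction k arbitrary: F)
  case 0
  then have "continuous_on (I \<times> slab) F" by simp
  moreover have "continuous_on slab (Pair t)" by (intro continuous_intros)
  ultimately have "continuous_on slab (\<lambda>x. F (t, x))"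
    by (rule continuous_on_compose2) (use assms in auto)
  then show ?case by simp
next
  case (Suc k)
  show ?case
  proof (rule Ck_on_SucI[OF boxlike_slab])
    fix x assume "x \<in> slab"
    then show "((\<lambda>x. F (t, x)) has_derivative (\<lambda>h. frechet_derivative F (at (t, x) within I \<times> slab) (0, h))) (at x within slab)"
      using has_derivative_slice[OF Ck_on_SucD[OF Suc.prems]] assms by blast
  next
    fix e :: "real^3" assume "e \<in> Basis"
    then have "(0, e) \<in> (Basis :: (real \<times> (real^3)) set)" by (auto simp: Basis_prod_def)
    then have "Ck_on k (\<lambda>p. frechet_derivative F (at p within I \<times> slab) (0, e)) (I \<times> slab)"
      using Suc.prems by simp
    from Suc.IH[OF this] show "Ck_on k (\<lambda>x. frechet_derivative F (at (t, x) within I \<times> slab) (0, e)) slab" .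
  qed
qed

lemma smooth_on_slice:
  fixes F :: "real \<times> (real^3) \<Rightarrow> 'b::real_normed_vector"
  shows "smooth_on F (I \<times> slab) \<Longrightarrow> t \<in> I \<Longrightarrow> smooth_on (\<lambda>x. F (t, x)) slab"
  by (simp add: smooth_on_def Ck_on_slice)

lemma pd_slice:
  fixes F :: "real \<times> (real^3) \<Rightarrow> 'b::real_normed_vector"
  assumes "smooth_on F (I \<times> slab)" "t \<in> I" "x \<in> slab"
  shows "pd i (\<lambda>x. F (t, x)) x = frechet_derivative F (at (t, x) within I \<times> slab) (0, axis i 1)"
  using has_derivative_slice[OF smooth_on_has_derivative[OF assms(1)]] assms by (intro pd_eqI) auto

lemma time_derivative:
  fixes F :: "real \<times> (real^3) \<Rightarrow> 'b::real_normed_vector"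
  assumes "smooth_on F (I \<times> slab)" "t \<in> I" "x \<in> slab"
  shows "((\<lambda>s. F (s, x)) has_vector_derivative frechet_derivative F (at (t, x) within I \<times> slab) (1, 0)) (at t within I)"
proof -
  let ?D = "frechet_derivative F (at (t, x) within I \<times> slab)"
  have D: "(F has_derivative ?D) (at (t, x) within I \<times> slab)"
    by (rule smooth_on_has_derivative) (use assms in auto)
  have "((\<lambda>s. F (s, x)) has_derivative (\<lambda>h. ?D (h, 0))) (at t within I)"
    by (rule has_derivative_compose_within[where g=F and f="\<lambda>s. (s, x)", OF D])
      (use assms in \<open>auto intro: has_derivative_Pair has_derivative_ident has_derivative_const\<close>)
  moreover have "?D (h, 0) = h *\<^sub>R ?D (1, 0)" for h
    using linear_scale[OF has_derivative_linear[OF D], of h "(1, 0)"] by simp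
  then have "(\<lambda>h. ?D (h, 0)) = (\<lambda>h. h *\<^sub>R ?D (1, 0))" by (rule ext)
  ultimately show ?thesis by (simp only: has_vector_derivative_def)
qed

subsection \<open>Integration over the cell\<close>

text \<open>Pairing the horizontal coordinates first lets Fubini separate horizontal slices from
  vertical columns.\<close>

definition pt :: "real \<times> real \<Rightarrow> real \<Rightarrow> real^3" where
  "pt p z = vector [fst p, snd p, z]"

lemma ex_3: "(\<exists>i::3. P i) \<longleftrightarrow> P 1 \<or> P 2 \<or> P 3"
  using forall_3[of "\<lambda>i. \<not> P i"] by blast

lemma prod_3: "prod f (UNIV::3 set) = f 1 * f 2 * f 3"
  unfolding UNIV_3 by (simp add: ac_simps)

lemma pt_nth [simp]: "pt p z $ 1 = fst p" "pt p z $ 2 = snd p" "pt p z $ 3 = z"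
  by (simp_all add: pt_def)

lemma pt_alt: "pt p z = fst p *\<^sub>R axis 1 1 + snd p *\<^sub>R axis 2 1 + z *\<^sub>R axis 3 1"
  by (simp add: vec_eq_iff forall_3 axis_def)

lemma pt_in_slab [simp]: "pt p z \<in> slab \<longleftrightarrow> 0 \<le> z \<and> z \<le> 1"
  by (simp add: slab_def)

lemma pt_line:
  "pt (x, y) z = pt (0, y) z + x *\<^sub>R axis 1 1"
  "pt (x, y) z = pt (x, 0) z + y *\<^sub>R axis 2 1"
  "pt p z = pt p 0 + z *\<^sub>R axis 3 1"
  by (simp_all add: pt_alt)

lemma continuous_on_pt [continuous_intros]:
  "continuous_on A f \<Longrightarrow> continuous_on A g \<Longrightarrow> continuous_on A (\<lambda>x. pt (f x) (g x))"
  unfolding pt_alt by (intro continuous_intros)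

lemma smooth_continuous_pt:
  assumes "smooth f" "continuous_on A p" "continuous_on A z" "\<And>q. q \<in> A \<Longrightarrow> 0 \<le> z q \<and> z q \<le> 1"
  shows "continuous_on A (\<lambda>q. f (pt (p q) (z q)))"
  by (rule continuous_on_compose2[OF smooth_on_continuous[OF assms(1)] continuous_on_pt[OF assms(2,3)]])
    (use assms(4) in auto)

lemma smooth_deriv1:
  assumes "smooth f" "0 \<le> z" "z \<le> 1"
  shows "((\<lambda>x. f (pt (x, y) z)) has_real_derivative pd 1 f (pt (x, y) z)) (at x within A)"
  using smooth_line_derivative[OF assms(1), of "pt (0, y) z" x 1 A] assms(2,3)
  by (simp add: pt_line(1)[symmetric])

lemma smooth_deriv2:
  assumes "smooth f" "0 \<le> z" "z \<le> 1"
  shows "((\<lambda>y. f (pt (x, y) z)) has_real_derivative pd 2 f (pt (x, y) z)) (at y within A)"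
  using smooth_line_derivative[OF assms(1), of "pt (x, 0) z" y 2 A] assms(2,3)
  by (simp add: pt_line(2)[symmetric])

lemma smooth_deriv3:
  assumes "smooth f" "0 \<le> z" "z \<le> 1"
  shows "((\<lambda>z. f (pt p z)) has_real_derivative pd 3 f (pt p z)) (at z within {0..1})"
  using smooth_line_derivative[OF assms(1), of "pt p 0" z 3 "{0..1}"] assms(2,3)
  by (simp add: pt_line(3)[of p, symmetric])

lemma pd_shift:
  assumes f: "smooth f" and x: "x \<in> slab" and a: "a $ 3 = 0" and per: "\<And>y. y \<in> slab \<Longrightarrow> f (y + a) = f y"
  shows "pd i f (x + a) = pd i f x"
proof -
  have xa: "x + a \<in> slab" using x a by (simp add: slab_def)
  have "((\<lambda>y. f (y + a)) has_derivative (\<lambda>h. frechet_derivative f (at (x + a) within slab) h)) (at x within slab)"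
    by (rule has_derivative_compose_within[where g=f and f="\<lambda>y. y + a", OF smooth_on_has_derivative[OF f xa]])
      (use a in \<open>auto intro!: derivative_eq_intros simp: slab_def\<close>)
  then have "pd i (\<lambda>y. f (y + a)) x = pd i f (x + a)"
    using pd_eqI x by (simp add: pd_def[of i f])
  moreover have "pd i (\<lambda>y. f (y + a)) x = pd i f x"
    by (rule pd_cong) (use per x in auto)
  ultimately show ?thesis by simp
qed

locale periodic_cell =
  fixes Lx Ly :: real
  assumes Lx: "0 < Lx" and Ly: "0 < Ly"
begin

abbreviation base :: "(real \<times> real) set" where "base \<equiv> cbox (0, 0) (Lx, Ly)"
abbreviation cint :: "(real^3 \<Rightarrow> real) \<Rightarrow> real" where "cint \<equiv> integral (cell Lx Ly)"

abbreviation csq :: "(real^3 \<Rightarrow> real) \<Rightarrow> real" where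
  "csq f \<equiv> cint (\<lambda>x. (f x)\<^sup>2)"

definition per_smooth :: "(real^3 \<Rightarrow> real) \<Rightarrow> bool" where
  "per_smooth f \<longleftrightarrow> smooth f \<and> periodic Lx Ly f"

lemma per_smooth_smooth: "per_smooth f \<Longrightarrow> smooth f" by (simp add: per_smooth_def)

lemma per_smooth_const: "per_smooth (\<lambda>x. c)" by (simp add: per_smooth_def periodic_def smooth_const)
lemma per_smooth_add: "per_smooth f \<Longrightarrow> per_smooth g \<Longrightarrow> per_smooth (\<lambda>x. f x + g x)" by (simp add: per_smooth_def periodic_def smooth_add)
lemma per_smooth_mult: "per_smooth f \<Longrightarrow> per_smooth g \<Longrightarrow> per_smooth (\<lambda>x. f x * g x)" by (simp add: per_smooth_def periodic_def smooth_mult)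
lemma per_smooth_diff: "per_smooth f \<Longrightarrow> per_smooth g \<Longrightarrow> per_smooth (\<lambda>x. f x - g x)" by (simp add: per_smooth_def periodic_def smooth_diff)
lemma per_smooth_minus: "per_smooth f \<Longrightarrow> per_smooth (\<lambda>x. - f x)" by (simp add: per_smooth_def periodic_def smooth_minus)
lemma per_smooth_power2: "per_smooth f \<Longrightarrow> per_smooth (\<lambda>x. (f x)\<^sup>2)" by (simp add: per_smooth_def periodic_def smooth_power2)
lemma per_smooth_sum: "(\<And>i. i \<in> A \<Longrightarrow> per_smooth (f i)) \<Longrightarrow> per_smooth (\<lambda>x. \<Sum>i\<in>A. f i x)"
  by (simp add: per_smooth_def periodic_def smooth_sum)

lemma per_smooth_pd: "per_smooth f \<Longrightarrow> per_smooth (pd i f)"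
  unfolding per_smooth_def periodic_def
  by (auto simp: smooth_pd axis_def intro!: pd_shift)

lemmas per_smooth_intros = per_smooth_const per_smooth_add per_smooth_mult per_smooth_diff per_smooth_minus per_smooth_power2 per_smooth_sum per_smooth_pd

lemma per_smooth_per_x: "per_smooth f \<Longrightarrow> 0 \<le> z \<Longrightarrow> z \<le> 1 \<Longrightarrow> f (pt (Lx, y) z) = f (pt (0, y) z)"
proof -
  assume f: "per_smooth f" and z: "0 \<le> z" "z \<le> 1"
  have "pt (Lx, y) z = pt (0, y) z + axis 1 Lx" by (simp add: vec_eq_iff forall_3 axis_def)
  then show ?thesis using f z by (simp add: per_smooth_def periodic_def)
qed

lemma per_smooth_per_y: "per_smooth f \<Longrightarrow> 0 \<le> z \<Longrightarrow> z \<le> 1 \<Longrightarrow> f (pt (x, Ly) z) = f (pt (x, 0) z)"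
proof -
  assume f: "per_smooth f" and z: "0 \<le> z" "z \<le> 1"
  have "pt (x, Ly) z = pt (x, 0) z + axis 2 Ly" by (simp add: vec_eq_iff forall_3 axis_def)
  then show ?thesis using f z by (simp add: per_smooth_def periodic_def)
qed

lemma cell_cbox: "cell Lx Ly = cbox 0 (vector [Lx, Ly, 1])"
  by (auto simp: cell_def mem_box_cart forall_3)

lemma cell_subset_slab: "cell Lx Ly \<subseteq> slab"
  by (auto simp: cell_def slab_def)

lemma smooth_cell: "smooth f \<Longrightarrow> continuous_on (cell Lx Ly) f"
  using smooth_on_continuous cell_subset_slab continuous_on_subset by blast

lemma smooth_integrable: "smooth f \<Longrightarrow> f integrable_on cell Lx Ly"
  using smooth_cell integrable_continuous by (metis cell_cbox)

lemma pt_image_cbox: "(\<lambda>q. pt (fst q) (snd q)) ` cbox u v = cbox (pt (fst u) (snd u)) (pt (fst v) (snd v))"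
proof -
  have "x \<in> (\<lambda>q. pt (fst q) (snd q)) ` cbox u v" if "x \<in> cbox (pt (fst u) (snd u)) (pt (fst v) (snd v))" for x
    by (rule image_eqI[of _ _ "((x$1, x$2), x$3)"])
      (use that in \<open>auto simp: mem_box_cart forall_3 vec_eq_iff cbox_Pair_eq[of "fst u" "snd u" "fst v" "snd v", simplified] cbox_Pair_eq[of "fst (fst u)" "snd (fst u)" "fst (fst v)" "snd (fst v)", simplified]\<close>)
  moreover have "pt (fst q) (snd q) \<in> cbox (pt (fst u) (snd u)) (pt (fst v) (snd v))" if "q \<in> cbox u v" for q
    using that by (auto simp: mem_box_cart forall_3 cbox_Pair_eq[of "fst u" "snd u" "fst v" "snd v", simplified] cbox_Pair_eq[of "fst (fst u)" "snd (fst u)" "fst (fst v)" "snd (fst v)", simplified])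
  ultimately show ?thesis by blast
qed

lemma coords_image_cbox: "(\<lambda>x::real^3. ((x$1, x$2), x$3)) ` cbox u v = cbox ((u$1, u$2), u$3) ((v$1, v$2), v$3)"
proof -
  have "q \<in> (\<lambda>x::real^3. ((x$1, x$2), x$3)) ` cbox u v" if "q \<in> cbox ((u$1, u$2), u$3) ((v$1, v$2), v$3)" for q
    by (rule image_eqI[of _ _ "pt (fst q) (snd q)"])
      (use that in \<open>auto simp: mem_box_cart forall_3 cbox_Pair_eq\<close>)
  then show ?thesis by (auto simp: mem_box_cart forall_3 cbox_Pair_eq)
qed

text \<open>The coordinate map and its inverse send boxes to boxes of the same volume, so the
  integral is transported to a product box, where Fubini applies.\<close>

lemma integral_cell_prod:
  fixes f :: "real^3 \<Rightarrow> real"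
  assumes "continuous_on (cell Lx Ly) f"
  shows "integral (cell Lx Ly) f = integral (cbox ((0, 0), 0) ((Lx, Ly), 1)) (\<lambda>(p, z). f (pt p z))"
proof -
  let ?g = "\<lambda>q. pt (fst q) (snd q)" and ?h = "\<lambda>x::real^3. ((x$1, x$2), x$3)"
  have "((\<lambda>q. f (?g q)) has_integral (1 / 1) *\<^sub>R integral (cell Lx Ly) f) (?h ` cbox 0 (vector [Lx, Ly, 1]))"
  proof (rule has_integral_twiddle[where h="?h" and r=1])
    show "continuous (at q) ?g" for q
      using continuous_on_pt[OF continuous_on_fst[OF continuous_on_id] continuous_on_snd[OF continuous_on_id], of UNIV]
      by (cases q) (auto simp: continuous_on_eq_continuous_at)
    show "\<exists>w z. ?g ` cbox u v = cbox w z" for u v using pt_image_cbox by blast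
    show "\<exists>w z. ?h ` cbox u v = cbox w z" for u v using coords_image_cbox by blast
    show "measure lborel (?g ` cbox u v) = 1 * measure lborel (cbox u v)" for u v
    proof -
      obtain u1 u2 u3 v1 v2 v3 where uv: "u = ((u1, u2), u3)" "v = ((v1, v2), v3)" by (metis prod.collapse)
      show ?thesis
        unfolding pt_image_cbox unfolding uv content_Pair
        by (auto simp: content_cbox_if_cart prod_3 interval_eq_empty_cart ex_3 content_real_if not_le)
    qed
    show "(f has_integral integral (cell Lx Ly) f) (cbox 0 (vector [Lx, Ly, 1]))"
      using assms unfolding cell_cbox by (intro integrable_integral integrable_continuous)
  qed (auto simp: vec_eq_iff forall_3)
  then show ?thesis
    by (simp add: coords_image_cbox integral_unique split_def)
qed

lemma pt_cell: "p \<in> base \<Longrightarrow> 0 \<le> z \<Longrightarrow> z \<le> 1 \<Longrightarrow> pt p z \<in> cell Lx Ly"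
  by (auto simp: cell_def cbox_Pair_eq)

lemma continuous_pt_prod:
  assumes "continuous_on (cell Lx Ly) f"
  shows "continuous_on (cbox ((0, 0), 0) ((Lx, Ly), 1)) (\<lambda>(p, z). f (pt p z))"
  unfolding split_def
  by (rule continuous_on_compose2[OF assms]) (auto intro!: continuous_intros pt_cell simp: cbox_Pair_eq)

lemma fubini_zinner:
  fixes f :: "real^3 \<Rightarrow> real"
  assumes "continuous_on (cell Lx Ly) f"
  shows "integral (cell Lx Ly) f = integral base (\<lambda>p. integral {0..1} (\<lambda>z. f (pt p z)))"
  using integral_prod_continuous[OF continuous_pt_prod[OF assms]] integral_cell_prod[OF assms] by simp

lemma fubini_zouter:
  fixes f :: "real^3 \<Rightarrow> real"
  assumes "continuous_on (cell Lx Ly) f"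
  shows "integral (cell Lx Ly) f = integral {0..1} (\<lambda>z. integral base (\<lambda>p. f (pt p z)))"
  using integral_swap_continuous[OF continuous_pt_prod[OF assms]] fubini_zinner[OF assms] by simp

lemma fubini_base:
  fixes F :: "real \<times> real \<Rightarrow> real"
  assumes "continuous_on base F"
  shows "integral base F = integral {0..Lx} (\<lambda>x. integral {0..Ly} (\<lambda>y. F (x, y)))"
    and "integral base F = integral {0..Ly} (\<lambda>y. integral {0..Lx} (\<lambda>x. F (x, y)))"
proof -
  show 1: "integral base F = integral {0..Lx} (\<lambda>x. integral {0..Ly} (\<lambda>y. F (x, y)))"
    using integral_prod_continuous[OF assms] by simp
  show "integral base F = integral {0..Ly} (\<lambda>y. integral {0..Lx} (\<lambda>x. F (x, y)))"
    using integral_swap_continuous[of 0 0 Lx Ly "\<lambda>x y. F (x, y)"] assms 1 by simp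
qed

lemma cint_cong: "(\<And>x. x \<in> slab \<Longrightarrow> f x = g x) \<Longrightarrow> cint f = cint g"
  using cell_subset_slab by (intro integral_cong) auto

lemma cint_add: "smooth f \<Longrightarrow> smooth g \<Longrightarrow> cint (\<lambda>x. f x + g x) = cint f + cint g"
  by (intro integral_add smooth_integrable)

lemma cint_diff: "smooth f \<Longrightarrow> smooth g \<Longrightarrow> cint (\<lambda>x. f x - g x) = cint f - cint g"
  by (intro integral_diff smooth_integrable)

lemma cint_cmult: "cint (\<lambda>x. c * f x) = c * cint f"
  by simp

lemma cint_sum: "finite A \<Longrightarrow> (\<And>i. i \<in> A \<Longrightarrow> smooth (f i)) \<Longrightarrow> cint (\<lambda>x. \<Sum>i\<in>A. f i x) = (\<Sum>i\<in>A. cint (f i))"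
  by (intro integral_sum smooth_integrable)

lemma cint_mono: "smooth f \<Longrightarrow> smooth g \<Longrightarrow> (\<And>x. x \<in> slab \<Longrightarrow> f x \<le> g x) \<Longrightarrow> cint f \<le> cint g"
  using cell_subset_slab by (intro integral_le smooth_integrable) auto

lemma cint_nonneg: "smooth f \<Longrightarrow> (\<And>x. x \<in> slab \<Longrightarrow> 0 \<le> f x) \<Longrightarrow> 0 \<le> cint f"
  using cell_subset_slab by (intro integral_nonneg smooth_integrable) auto

lemma cint_pd3:
  assumes f: "smooth f"
  shows "cint (pd 3 f) = integral base (\<lambda>p. f (pt p 1) - f (pt p 0))"
proof -
  have "integral {0..1} (\<lambda>z. pd 3 f (pt p z)) = f (pt p 1) - f (pt p 0)" for p
    by (intro integral_unique fundamental_theorem_of_calculus)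
      (auto simp: has_real_derivative_iff_has_vector_derivative[symmetric] intro!: smooth_deriv3 f)
  then show ?thesis by (simp add: fubini_zinner[OF smooth_cell[OF smooth_pd[OF f]]])
qed

lemma smooth_cont_base: "smooth f \<Longrightarrow> 0 \<le> z \<Longrightarrow> z \<le> 1 \<Longrightarrow> continuous_on A (\<lambda>p. f (pt p z))"
  by (intro smooth_continuous_pt continuous_intros) auto

lemma cint_pd1:
  assumes f: "per_smooth f"
  shows "cint (pd 1 f) = 0"
proof -
  have sf: "smooth f" using f per_smooth_smooth by simp
  have "integral base (\<lambda>p. pd 1 f (pt p z)) = 0" if z: "0 \<le> z" "z \<le> 1" for z
  proof -
    have "integral {0..Lx} (\<lambda>x. pd 1 f (pt (x, y) z)) = f (pt (Lx, y) z) - f (pt (0, y) z)" for y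
      using Lx by (intro integral_unique fundamental_theorem_of_calculus)
       (auto simp: has_real_derivative_iff_has_vector_derivative[symmetric] intro!: smooth_deriv1 sf z)
    then show ?thesis using per_smooth_per_x[OF f z] fubini_base(2)[OF smooth_cont_base[OF smooth_pd[OF sf] z]] by simp
  qed
  then have "integral {0..1} (\<lambda>z. integral base (\<lambda>p. pd 1 f (pt p z))) = integral {0..1} (\<lambda>z::real. 0)"
    by (intro integral_cong) auto
  then show ?thesis by (simp add: fubini_zouter[OF smooth_cell[OF smooth_pd[OF sf]]])
qed

lemma cint_pd2:
  assumes f: "per_smooth f"
  shows "cint (pd 2 f) = 0"
proof -
  have sf: "smooth f" using f per_smooth_smooth by simp
  have "integral base (\<lambda>p. pd 2 f (pt p z)) = 0" if z: "0 \<le> z" "z \<le> 1" for z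
  proof -
    have "integral {0..Ly} (\<lambda>y. pd 2 f (pt (x, y) z)) = f (pt (x, Ly) z) - f (pt (x, 0) z)" for x
      using Ly by (intro integral_unique fundamental_theorem_of_calculus)
       (auto simp: has_real_derivative_iff_has_vector_derivative[symmetric] intro!: smooth_deriv2 sf z)
    then show ?thesis using per_smooth_per_y[OF f z] fubini_base(1)[OF smooth_cont_base[OF smooth_pd[OF sf] z]] by simp
  qed
  then have "integral {0..1} (\<lambda>z. integral base (\<lambda>p. pd 2 f (pt p z))) = integral {0..1} (\<lambda>z::real. 0)"
    by (intro integral_cong) auto
  then show ?thesis by (simp add: fubini_zouter[OF smooth_cell[OF smooth_pd[OF sf]]])
qed

abbreviation lids :: "(real^3) set" where "lids \<equiv> bottom \<union> top_lid"

lemma cint_pd_zero: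
  assumes f: "per_smooth f" and lid: "i = 3 \<Longrightarrow> (\<And>x. x \<in> lids \<Longrightarrow> f x = 0)"
  shows "cint (pd i f) = 0"
proof -
  consider "i = 1" | "i = 2" | "i = 3" using exhaust_3 by blast
  then show ?thesis
  proof cases
    case 3
    have "f (pt p 1) - f (pt p 0) = 0" for p
      using lid[OF 3, of "pt p 1"] lid[OF 3, of "pt p 0"] by (simp add: bottom_def top_lid_def)
    then show ?thesis using cint_pd3[OF per_smooth_smooth[OF f]] 3 by simp
  qed (use cint_pd1 cint_pd2 f in auto)
qed

text \<open>Lateral faces cancel by periodicity, so only the lids can contribute. The condition is
  on the product because either factor may be the one that vanishes there.\<close>

lemma ibp:
  assumes f: "per_smooth f" and g: "per_smooth g" and lid: "i = 3 \<Longrightarrow> (\<And>x. x \<in> lids \<Longrightarrow> f x * g x = 0)"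
  shows "cint (\<lambda>x. pd i f x * g x) = - cint (\<lambda>x. f x * pd i g x)"
proof -
  have "cint (pd i (\<lambda>x. f x * g x)) = 0"
    by (rule cint_pd_zero) (use f g lid in \<open>auto intro: per_smooth_mult\<close>)
  also have "cint (pd i (\<lambda>x. f x * g x)) = cint (\<lambda>x. f x * pd i g x + pd i f x * g x)"
    by (rule cint_cong) (use f g pd_mult per_smooth_smooth in auto)
  also have "\<dots> = cint (\<lambda>x. f x * pd i g x) + cint (\<lambda>x. pd i f x * g x)"
    by (intro cint_add smooth_intros per_smooth_smooth f g)
  finally show ?thesis by simp
qed

section \<open>Poincare inequalities on slices and on the cell\<close>

abbreviation lam :: real where "lam \<equiv> lambda1 Lx Ly"
abbreviation CP :: real where "CP \<equiv> C_P Lx Ly"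

lemma lam_pos: "0 < lam" using Lx Ly by (simp add: lambda1_def)
lemma CP_pos: "0 < CP" using lam_pos by (simp add: C_P_def)

text \<open>The left sides are the Wirtinger constants of a column and of the two horizontal
  periods.\<close>

lemma CP_ge: "1 / pi \<le> CP" "Lx / (2 * pi) \<le> CP" "Ly / (2 * pi) \<le> CP"
proof -
  have "lam \<le> pi" "lam \<le> 2 * pi / Lx" "lam \<le> 2 * pi / Ly" by (auto simp: lambda1_def)
  then show "1 / pi \<le> CP" "Lx / (2 * pi) \<le> CP" "Ly / (2 * pi) \<le> CP"
    using lam_pos Lx Ly by (simp_all add: C_P_def field_simps)
qed

lemma cont_int_x:
  assumes "smooth f" "0 \<le> z" "z \<le> 1"
  shows "continuous_on A (\<lambda>y. integral {0..Lx} (\<lambda>x. f (pt (x, y) z)))"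
proof -
  have "continuous_on A (\<lambda>y. integral (cbox 0 Lx) (\<lambda>x. f (pt (x, y) z)))"
    by (rule integral_continuous_on_param)
      (use assms in \<open>auto simp: split_def intro!: smooth_continuous_pt continuous_intros\<close>)
  then show ?thesis by simp
qed

lemma cont_int_y:
  assumes "smooth f" "0 \<le> z" "z \<le> 1"
  shows "continuous_on A (\<lambda>x. integral {0..Ly} (\<lambda>y. f (pt (x, y) z)))"
proof -
  have "continuous_on A (\<lambda>x. integral (cbox 0 Ly) (\<lambda>y. f (pt (x, y) z)))"
    by (rule integral_continuous_on_param)
      (use assms in \<open>auto simp: split_def intro!: smooth_continuous_pt continuous_intros\<close>)
  then show ?thesis by simp
qed

lemma cont_int_base:
  assumes "smooth f"
  shows "continuous_on {0..1} (\<lambda>z. integral base (\<lambda>p. f (pt p z)))"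
proof -
  have "continuous_on {0..1} (\<lambda>z. integral base (\<lambda>p. f (pt p z)))"
    by (rule integral_continuous_on_param)
      (use assms in \<open>auto simp: split_def intro!: smooth_continuous_pt continuous_intros\<close>)
  then show ?thesis by simp
qed

lemma cont_int_z:
  assumes "smooth f"
  shows "continuous_on A (\<lambda>p. integral {0..1} (\<lambda>z. f (pt p z)))"
proof -
  have "continuous_on A (\<lambda>p. integral (cbox 0 1) (\<lambda>z. f (pt p z)))"
    by (rule integral_continuous_on_param)
      (use assms in \<open>auto simp: split_def intro!: smooth_continuous_pt continuous_intros\<close>)
  then show ?thesis by simp
qed

lemma cont_x: "smooth f \<Longrightarrow> 0 \<le> z \<Longrightarrow> z \<le> 1 \<Longrightarrow> continuous_on A (\<lambda>x. f (pt (x, y) z))"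
  by (intro smooth_continuous_pt continuous_intros) auto
lemma cont_y: "smooth f \<Longrightarrow> 0 \<le> z \<Longrightarrow> z \<le> 1 \<Longrightarrow> continuous_on A (\<lambda>y. f (pt (x, y) z))"
  by (intro smooth_continuous_pt continuous_intros) auto
lemma cont_z: "smooth f \<Longrightarrow> continuous_on {0..1} (\<lambda>z. f (pt p z))"
  by (intro smooth_continuous_pt continuous_intros) auto

lemma poincare_dirichlet:
  assumes f: "smooth f" and lid: "\<And>x. x \<in> lids \<Longrightarrow> f x = 0"
  shows "csq f \<le> CP\<^sup>2 * csq (pd 3 f)"
proof -
  have 1: "integral {0..1} (\<lambda>z. (f (pt p z))\<^sup>2) \<le> CP\<^sup>2 * integral {0..1} (\<lambda>z. (pd 3 f (pt p z))\<^sup>2)" for p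
  proof -
    have "pi\<^sup>2 * integral {0..1} (\<lambda>z. (f (pt p z))\<^sup>2) \<le> integral {0..1} (\<lambda>z. (pd 3 f (pt p z))\<^sup>2)"
      using lid[of "pt p 0"] lid[of "pt p 1"]
      by (intro wirtinger_dirichlet smooth_deriv3 f cont_z smooth_pd) (auto simp: bottom_def top_lid_def)
    then have "integral {0..1} (\<lambda>z. (f (pt p z))\<^sup>2) \<le> (1 / pi)\<^sup>2 * integral {0..1} (\<lambda>z. (pd 3 f (pt p z))\<^sup>2)"
      by (simp add: field_simps)
    also have "\<dots> \<le> CP\<^sup>2 * integral {0..1} (\<lambda>z. (pd 3 f (pt p z))\<^sup>2)"
      using CP_ge(1) by (intro mult_right_mono power_mono integral_nonneg integrable_continuous_interval
        continuous_intros cont_z smooth_pd f) auto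
    finally show ?thesis .
  qed
  have s: "smooth (\<lambda>x. (f x)\<^sup>2)" "smooth (\<lambda>x. (pd 3 f x)\<^sup>2)" by (intro smooth_intros f)+
  have "csq f = integral base (\<lambda>p. integral {0..1} (\<lambda>z. (f (pt p z))\<^sup>2))"
    by (rule fubini_zinner[OF smooth_cell[OF s(1)]])
  also have "\<dots> \<le> integral base (\<lambda>p. CP\<^sup>2 * integral {0..1} (\<lambda>z. (pd 3 f (pt p z))\<^sup>2))"
    by (intro integral_le integrable_continuous continuous_intros cont_int_z[OF s(1)] cont_int_z[OF s(2)] 1)
  also have "\<dots> = CP\<^sup>2 * csq (pd 3 f)"
    by (simp add: fubini_zinner[OF smooth_cell[OF s(2)]])
  finally show ?thesis .
qed

text \<open>Wirtinger in x on each line leaves the line integral \<open>g y\<close> as remainder;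
  Wirtinger in y is then applied to \<open>g\<close>, and Cauchy-Schwarz bounds the square of
  \<open>g'\<close> by the integral of the square of \<open>pd 2 f\<close>.\<close>

lemma poincare_base:
  assumes f: "per_smooth f" and z: "0 \<le> z" "z \<le> 1"
  shows "integral base (\<lambda>p. (f (pt p z))\<^sup>2)
    \<le> CP\<^sup>2 * (integral base (\<lambda>p. (pd 1 f (pt p z))\<^sup>2) + integral base (\<lambda>p. (pd 2 f (pt p z))\<^sup>2))
      + 1 / (Lx * Ly) * (integral base (\<lambda>p. f (pt p z)))\<^sup>2"
proof -
  have sf: "smooth f" using f per_smooth_smooth by simp
  have s: "smooth (\<lambda>x. (f x)\<^sup>2)" "smooth (\<lambda>x. (pd 1 f x)\<^sup>2)" "smooth (\<lambda>x. (pd 2 f x)\<^sup>2)" "smooth (pd 1 f)" "smooth (pd 2 f)"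
    by (intro smooth_intros sf)+
  define g where "g y = integral {0..Lx} (\<lambda>x. f (pt (x, y) z))" for y
  define g' where "g' y = integral {0..Lx} (\<lambda>x. pd 2 f (pt (x, y) z))" for y
  have dg: "(g has_real_derivative g' y) (at y within {0..Ly})" if "y \<in> {0..Ly}" for y
    unfolding g_def[abs_def] g'_def cbox_interval[symmetric]
    by (rule leibniz_rule_field_derivative[where U="cbox 0 Ly"])
      (use smooth_deriv2[OF sf z] that in \<open>auto simp: split_def intro!: smooth_continuous_pt continuous_intros integrable_continuous_interval sf z s\<close>)
  have cg: "continuous_on {0..Ly} g" "continuous_on {0..Ly} g'"
    unfolding g_def[abs_def] g'_def[abs_def] by (intro cont_int_x z sf s)+
  have "integral {0..Ly} (\<lambda>y. (g y)\<^sup>2) \<le> (Ly / (2 * pi))\<^sup>2 * integral {0..Ly} (\<lambda>y. (g' y)\<^sup>2) + 1 / Ly * (integral {0..Ly} g)\<^sup>2"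
    by (rule wirtinger_periodic[OF Ly dg cg(2)]) (use per_smooth_per_y[OF f z] in \<open>auto simp: g_def\<close>)
  also have "\<dots> \<le> CP\<^sup>2 * integral {0..Ly} (\<lambda>y. (g' y)\<^sup>2) + 1 / Ly * (integral {0..Ly} g)\<^sup>2"
    using CP_ge(3) Ly by (intro add_mono mult_right_mono power_mono integral_nonneg integrable_continuous_interval
        continuous_intros cg) auto
  also have "integral {0..Ly} (\<lambda>y. (g' y)\<^sup>2) \<le> integral {0..Ly} (\<lambda>y. Lx * integral {0..Lx} (\<lambda>x. (pd 2 f (pt (x, y) z))\<^sup>2))"
    using integral_square_le[of 0 Lx "\<lambda>x. pd 2 f (pt (x, _) z)"] Lx cont_x[OF s(5) z]
    by (intro integral_le integrable_continuous_interval continuous_intros cg cont_int_x[OF s(3) z]) (auto simp: g'_def)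
  also have "\<dots> = Lx * integral base (\<lambda>p. (pd 2 f (pt p z))\<^sup>2)"
    by (simp add: fubini_base(2)[OF smooth_cont_base[OF s(3) z]])
  also have "integral {0..Ly} g = integral base (\<lambda>p. f (pt p z))"
    by (simp add: g_def[abs_def] fubini_base(2)[OF smooth_cont_base[OF sf z]])
  finally have 1: "integral {0..Ly} (\<lambda>y. (g y)\<^sup>2) \<le> CP\<^sup>2 * (Lx * integral base (\<lambda>p. (pd 2 f (pt p z))\<^sup>2)) + 1 / Ly * (integral base (\<lambda>p. f (pt p z)))\<^sup>2"
    by (simp add: mult_left_mono)
  have 2: "integral {0..Lx} (\<lambda>x. (f (pt (x, y) z))\<^sup>2) \<le> CP\<^sup>2 * integral {0..Lx} (\<lambda>x. (pd 1 f (pt (x, y) z))\<^sup>2) + 1 / Lx * (g y)\<^sup>2" for y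
  proof -
    have "integral {0..Lx} (\<lambda>x. (f (pt (x, y) z))\<^sup>2) \<le> (Lx / (2 * pi))\<^sup>2 * integral {0..Lx} (\<lambda>x. (pd 1 f (pt (x, y) z))\<^sup>2) + 1 / Lx * (g y)\<^sup>2"
      unfolding g_def by (rule wirtinger_periodic[OF Lx smooth_deriv1[OF sf z] cont_x[OF s(4) z]]) (use per_smooth_per_x[OF f z] in auto)
    also have "\<dots> \<le> CP\<^sup>2 * integral {0..Lx} (\<lambda>x. (pd 1 f (pt (x, y) z))\<^sup>2) + 1 / Lx * (g y)\<^sup>2"
      using CP_ge(2) Lx by (intro add_mono mult_right_mono power_mono integral_nonneg integrable_continuous_interval
        continuous_intros cont_x[OF s(4) z]) auto
    finally show ?thesis .
  qed
  have "integral base (\<lambda>p. (f (pt p z))\<^sup>2) = integral {0..Ly} (\<lambda>y. integral {0..Lx} (\<lambda>x. (f (pt (x, y) z))\<^sup>2))"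
    by (rule fubini_base(2)[OF smooth_cont_base[OF s(1) z]])
  also have "\<dots> \<le> integral {0..Ly} (\<lambda>y. CP\<^sup>2 * integral {0..Lx} (\<lambda>x. (pd 1 f (pt (x, y) z))\<^sup>2) + 1 / Lx * (g y)\<^sup>2)"
    by (intro integral_le integrable_continuous_interval continuous_intros cg cont_int_x[OF s(1) z] cont_int_x[OF s(2) z] 2)
  also have "\<dots> = integral {0..Ly} (\<lambda>y. CP\<^sup>2 * integral {0..Lx} (\<lambda>x. (pd 1 f (pt (x, y) z))\<^sup>2)) + integral {0..Ly} (\<lambda>y. 1 / Lx * (g y)\<^sup>2)"
    by (intro integral_add integrable_continuous_interval continuous_intros cg cont_int_x[OF s(2) z])
  also have "\<dots> = CP\<^sup>2 * integral base (\<lambda>p. (pd 1 f (pt p z))\<^sup>2) + 1 / Lx * integral {0..Ly} (\<lambda>y. (g y)\<^sup>2)"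
    by (simp only: integral_mult_right fubini_base(2)[OF smooth_cont_base[OF s(2) z]])
  also have "1 / Lx * integral {0..Ly} (\<lambda>y. (g y)\<^sup>2) \<le> 1 / Lx * (CP\<^sup>2 * (Lx * integral base (\<lambda>p. (pd 2 f (pt p z))\<^sup>2)) + 1 / Ly * (integral base (\<lambda>p. f (pt p z)))\<^sup>2)"
    using Lx 1 by (intro mult_left_mono) auto
  finally show ?thesis using Lx by (simp add: distrib_left)
qed

text \<open>The same scheme one dimension up: the remainder of the slicewise inequality is the slice
  integral \<open>k z\<close>, whose own mean vanishes, so the Neumann inequality in z applies to
  it.\<close>

lemma poincare_mean:
  assumes f: "per_smooth f" and mean: "cint f = 0"
  shows "csq f \<le> CP\<^sup>2 * (csq (pd 1 f) + csq (pd 2 f) + csq (pd 3 f))"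
proof -
  have sf: "smooth f" using f per_smooth_smooth by simp
  have s: "smooth (\<lambda>x. (f x)\<^sup>2)" "smooth (\<lambda>x. (pd 1 f x)\<^sup>2)" "smooth (\<lambda>x. (pd 2 f x)\<^sup>2)" "smooth (\<lambda>x. (pd 3 f x)\<^sup>2)" "smooth (pd 3 f)"
    by (intro smooth_intros sf)+
  define k where "k z = integral base (\<lambda>p. f (pt p z))" for z
  define k' where "k' z = integral base (\<lambda>p. pd 3 f (pt p z))" for z
  have V: "measure lborel base = Lx * Ly" using Lx Ly by (simp add: content_Pair)
  have dk: "(k has_real_derivative k' z) (at z within {0..1})" if "z \<in> {0..1}" for z
    unfolding k_def[abs_def] k'_def
    by (rule leibniz_rule_field_derivative[where U="{0..1}"])
      (use smooth_deriv3[OF sf] that in \<open>auto simp: split_def intro!: smooth_continuous_pt continuous_intros integrable_continuous sf s\<close>)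
  have ck: "continuous_on {0..1} k" "continuous_on {0..1} k'"
    unfolding k_def[abs_def] k'_def[abs_def] by (intro cont_int_base sf s)+
  have "integral {0..1} k = 0"
    using mean fubini_zouter[OF smooth_cell[OF sf]] by (simp add: k_def[abs_def])
  then have "integral {0..1} (\<lambda>z. (k z)\<^sup>2) \<le> (1 / pi)\<^sup>2 * integral {0..1} (\<lambda>z. (k' z)\<^sup>2)"
    using wirtinger_neumann[OF dk ck(2)] by simp
  also have "\<dots> \<le> CP\<^sup>2 * integral {0..1} (\<lambda>z. (k' z)\<^sup>2)"
    using CP_ge(1) by (intro mult_right_mono power_mono integral_nonneg integrable_continuous_interval
        continuous_intros ck) auto
  also have "\<dots> \<le> CP\<^sup>2 * integral {0..1} (\<lambda>z. (Lx * Ly) * integral base (\<lambda>p. (pd 3 f (pt p z))\<^sup>2))"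
    by (intro mult_left_mono integral_le integrable_continuous_interval continuous_intros ck cont_int_base[OF s(4)])
      (use integral_square_le[OF smooth_cont_base[OF s(5)], of _ "(0, 0)" "(Lx, Ly)"] V in \<open>simp_all add: k'_def\<close>)
  also have "\<dots> = CP\<^sup>2 * ((Lx * Ly) * csq (pd 3 f))"
    by (simp add: fubini_zouter[OF smooth_cell[OF s(4)]])
  finally have 1: "integral {0..1} (\<lambda>z. (k z)\<^sup>2) \<le> CP\<^sup>2 * ((Lx * Ly) * csq (pd 3 f))" .
  have "csq f = integral {0..1} (\<lambda>z. integral base (\<lambda>p. (f (pt p z))\<^sup>2))"
    by (rule fubini_zouter[OF smooth_cell[OF s(1)]])
  also have "\<dots> \<le> integral {0..1} (\<lambda>z. CP\<^sup>2 * (integral base (\<lambda>p. (pd 1 f (pt p z))\<^sup>2) + integral base (\<lambda>p. (pd 2 f (pt p z))\<^sup>2))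
      + 1 / (Lx * Ly) * (k z)\<^sup>2)"
    unfolding k_def
    by (intro integral_le integrable_continuous_interval continuous_intros cont_int_base[OF s(1)] cont_int_base[OF s(2)] cont_int_base[OF s(3)] cont_int_base[OF sf])
      (use poincare_base[OF f] in auto)
  also have "\<dots> = integral {0..1} (\<lambda>z. CP\<^sup>2 * (integral base (\<lambda>p. (pd 1 f (pt p z))\<^sup>2) + integral base (\<lambda>p. (pd 2 f (pt p z))\<^sup>2)))
      + integral {0..1} (\<lambda>z. 1 / (Lx * Ly) * (k z)\<^sup>2)"
    by (intro integral_add integrable_continuous_interval continuous_intros cont_int_base[OF s(2)] cont_int_base[OF s(3)] ck)
  also have "integral {0..1} (\<lambda>z. CP\<^sup>2 * (integral base (\<lambda>p. (pd 1 f (pt p z))\<^sup>2) + integral base (\<lambda>p. (pd 2 f (pt p z))\<^sup>2)))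
    = CP\<^sup>2 * (csq (pd 1 f) + csq (pd 2 f))"
    unfolding integral_mult_right fubini_zouter[OF smooth_cell[OF s(2)]] fubini_zouter[OF smooth_cell[OF s(3)]]
    by (subst integral_add) (intro integrable_continuous_interval cont_int_base[OF s(2)] cont_int_base[OF s(3)] refl)+
  also have "integral {0..1} (\<lambda>z. 1 / (Lx * Ly) * (k z)\<^sup>2) = 1 / (Lx * Ly) * integral {0..1} (\<lambda>z. (k z)\<^sup>2)"
    by (rule integral_mult_right)
  also have "1 / (Lx * Ly) * integral {0..1} (\<lambda>z. (k z)\<^sup>2) \<le> 1 / (Lx * Ly) * (CP\<^sup>2 * ((Lx * Ly) * csq (pd 3 f)))"
    using Lx Ly by (intro mult_left_mono 1) auto
  finally show ?thesis using Lx Ly by (simp add: distrib_left)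
qed

section \<open>Suprema over horizontal slices and over columns\<close>

definition coeff_x where "coeff_x = 1 / Lx + lam / 2"
definition coeff_y where "coeff_y = 1 / Ly + lam / 2"
definition coeff_d where "coeff_d = 1 / (2 * lam)"

lemma coeff_pos: "0 < coeff_x" "0 < coeff_y" "0 < coeff_d"
  using Lx Ly lam_pos by (auto simp: coeff_x_def coeff_y_def coeff_d_def intro!: add_pos_pos)

text \<open>The integrand left by \<open>sup_square_periodic\<close> with weight \<open>lam\<close>
  in x and then in y; the mixed derivative arises because the second application also concerns
  \<open>pd 1 f\<close>. The \<open>coeff\<close> constants are the weights of that lemma.\<close>

definition slice_form :: "(real^3 \<Rightarrow> real) \<Rightarrow> real^3 \<Rightarrow> real" where
  "slice_form f x = coeff_x * (coeff_y * (f x)\<^sup>2 + coeff_d * (pd 2 f x)\<^sup>2) + coeff_d * (coeff_y * (pd 1 f x)\<^sup>2 + coeff_d * (pd 2 (pd 1 f) x)\<^sup>2)"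

text \<open>The integrand of \<open>sup_square_general\<close> with \<open>lam\<close> as the weight
  \<eta>.\<close>

definition column_form :: "(real^3 \<Rightarrow> real) \<Rightarrow> real^3 \<Rightarrow> real" where
  "column_form g x = (1 + lam) * (g x)\<^sup>2 + 1 / lam * (pd 3 g x)\<^sup>2"

lemma smooth_slice_form: "smooth f \<Longrightarrow> smooth (slice_form f)"
  unfolding slice_form_def[abs_def] by (intro smooth_intros)

lemma smooth_column_form: "smooth f \<Longrightarrow> smooth (column_form f)"
  unfolding column_form_def[abs_def] by (intro smooth_intros)

lemma sup_horizontal:
  assumes f: "per_smooth f" and z: "0 \<le> z" "z \<le> 1" and p: "p \<in> base"
  shows "(f (pt p z))\<^sup>2 \<le> integral base (\<lambda>p. slice_form f (pt p z))"
proof -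
  obtain x0 y0 where p0: "p = (x0, y0)" "x0 \<in> {0..Lx}" "y0 \<in> {0..Ly}" using p by (cases p) (auto simp: cbox_Pair_eq)
  have sf: "smooth f" using f per_smooth_smooth by simp
  have y: "(g (pt (x, y0) z))\<^sup>2 \<le> integral {0..Ly} (\<lambda>y. coeff_y * (g (pt (x, y) z))\<^sup>2 + coeff_d * (pd 2 g (pt (x, y) z))\<^sup>2)"
    if g: "per_smooth g" for g x
    unfolding coeff_y_def coeff_d_def
    by (rule sup_square_periodic[OF Ly smooth_deriv2[OF per_smooth_smooth[OF g] z] cont_y[OF smooth_pd[OF per_smooth_smooth[OF g]] z] _ lam_pos p0(3)])
      (use per_smooth_per_y[OF g z] in auto)
  have sx: "smooth (\<lambda>x. coeff_x * (f x)\<^sup>2 + coeff_d * (pd 1 f x)\<^sup>2)" by (intro smooth_intros sf)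
  have "(f (pt p z))\<^sup>2 \<le> integral {0..Lx} (\<lambda>x. coeff_x * (f (pt (x, y0) z))\<^sup>2 + coeff_d * (pd 1 f (pt (x, y0) z))\<^sup>2)"
    unfolding coeff_x_def coeff_d_def p0(1)
    by (rule sup_square_periodic[OF Lx smooth_deriv1[OF sf z] cont_x[OF smooth_pd[OF sf] z] _ lam_pos p0(2)])
      (use per_smooth_per_x[OF f z] in auto)
  also have "\<dots> \<le> integral {0..Lx} (\<lambda>x. integral {0..Ly} (\<lambda>y. slice_form f (pt (x, y) z)))"
  proof (intro integral_le integrable_continuous_interval cont_int_y smooth_slice_form sf z)
    show "continuous_on {0..Lx} (\<lambda>x. coeff_x * (f (pt (x, y0) z))\<^sup>2 + coeff_d * (pd 1 f (pt (x, y0) z))\<^sup>2)"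
      using cont_x[OF sx z] by simp
    fix x
    have "integral {0..Ly} (\<lambda>y. slice_form f (pt (x, y) z)) =
      coeff_x * integral {0..Ly} (\<lambda>y. coeff_y * (f (pt (x, y) z))\<^sup>2 + coeff_d * (pd 2 f (pt (x, y) z))\<^sup>2) +
      coeff_d * integral {0..Ly} (\<lambda>y. coeff_y * (pd 1 f (pt (x, y) z))\<^sup>2 + coeff_d * (pd 2 (pd 1 f) (pt (x, y) z))\<^sup>2)"
      unfolding slice_form_def integral_mult_right[symmetric]
      by (intro integral_add integrable_continuous_interval continuous_intros cont_y smooth_pd sf z)
    then show "coeff_x * (f (pt (x, y0) z))\<^sup>2 + coeff_d * (pd 1 f (pt (x, y0) z))\<^sup>2 \<le> integral {0..Ly} (\<lambda>y. slice_form f (pt (x, y) z))"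
      using mult_left_mono[OF y[OF f, of x], of coeff_x] mult_left_mono[OF y[OF per_smooth_pd[OF f, of 1], of x], of coeff_d] coeff_pos by linarith
  qed
  also have "\<dots> = integral base (\<lambda>p. slice_form f (pt p z))"
    by (rule fubini_base(1)[OF smooth_cont_base[OF smooth_slice_form[OF sf] z], symmetric])
  finally show ?thesis .
qed

text \<open>On each column the value at height \<open>z\<close> is bounded by an integral over the
  column, and this bound does not depend on \<open>z\<close>; it remains to integrate over
  \<open>base\<close>.\<close>

lemma slice_column:
  assumes g: "smooth g" and z: "0 \<le> z" "z \<le> 1"
  shows "integral base (\<lambda>p. (g (pt p z))\<^sup>2) \<le> cint (column_form g)"
proof -
  have s: "smooth (\<lambda>x. (g x)\<^sup>2)" by (intro smooth_intros g)
  have "integral base (\<lambda>p. (g (pt p z))\<^sup>2) \<le> integral base (\<lambda>p. integral {0..1} (\<lambda>z. column_form g (pt p z)))"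
    unfolding column_form_def
    by (intro integral_le integrable_continuous smooth_cont_base[OF s z] cont_int_z smooth_intros g
      sup_square_general[OF smooth_deriv3[OF g] cont_z[OF smooth_pd[OF g]] lam_pos]) (use z in auto)
  also have "\<dots> = cint (column_form g)"
    by (rule fubini_zinner[OF smooth_cell[OF smooth_column_form[OF g]], symmetric])
  finally show ?thesis .
qed

text \<open>Estimating \<open>f\<close> by its supremum over horizontal slices and \<open>g\<close> by its slicewise \<open>L\<^sup>2\<close> norm needs
  only derivatives of \<open>f\<close> of order two and of \<open>g\<close> of order one.\<close>

lemma product_estimate:
  assumes f: "per_smooth f" and g: "smooth g"
  shows "cint (\<lambda>x. (f x)\<^sup>2 * (g x)\<^sup>2) \<le> cint (slice_form f) * cint (column_form g)"
proof -
  have sf: "smooth f" using f per_smooth_smooth by simp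
  have s: "smooth (\<lambda>x. (f x)\<^sup>2 * (g x)\<^sup>2)" "smooth (\<lambda>x. (g x)\<^sup>2)" "smooth (slice_form f)"
    by (intro smooth_intros sf g smooth_slice_form)+
  let ?A = "\<lambda>z. integral base (\<lambda>p. slice_form f (pt p z))"
  have "cint (\<lambda>x. (f x)\<^sup>2 * (g x)\<^sup>2) = integral {0..1} (\<lambda>z. integral base (\<lambda>p. (f (pt p z))\<^sup>2 * (g (pt p z))\<^sup>2))"
    by (rule fubini_zouter[OF smooth_cell[OF s(1)]])
  also have "\<dots> \<le> integral {0..1} (\<lambda>z. ?A z * cint (column_form g))"
  proof (intro integral_le integrable_continuous_interval continuous_intros cont_int_base[OF s(1)] cont_int_base[OF s(3)])
    fix z :: real assume "z \<in> {0..1}"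
    then have z: "0 \<le> z" "z \<le> 1" by auto
    have A: "0 \<le> ?A z"
      using sup_horizontal[OF f z, of "(0,0)"] Lx Ly by (simp add: order_trans[OF zero_le_power2])
    have "integral base (\<lambda>p. (f (pt p z))\<^sup>2 * (g (pt p z))\<^sup>2) \<le> integral base (\<lambda>p. ?A z * (g (pt p z))\<^sup>2)"
      by (intro integral_le integrable_continuous continuous_intros smooth_cont_base[OF s(1) z] smooth_cont_base[OF s(2) z]
          mult_right_mono sup_horizontal[OF f z]) auto
    also have "\<dots> = ?A z * integral base (\<lambda>p. (g (pt p z))\<^sup>2)" by simp
    also have "\<dots> \<le> ?A z * cint (column_form g)" by (intro mult_left_mono slice_column g z A)
    finally show "integral base (\<lambda>p. (f (pt p z))\<^sup>2 * (g (pt p z))\<^sup>2) \<le> ?A z * cint (column_form g)" .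
  qed
  also have "\<dots> = cint (slice_form f) * cint (column_form g)"
    by (simp add: fubini_zouter[OF smooth_cell[OF s(3)]])
  finally show ?thesis .
qed

end

subsection \<open>Vertical primitives\<close>

definition vprimitive :: "(real^3 \<Rightarrow> real) \<Rightarrow> real^3 \<Rightarrow> real" where
  "vprimitive f x = integral {0..x$3} (\<lambda>s. f (pt (x$1, x$2) s))"

lemma unit_scaled: "x \<in> slab \<Longrightarrow> 0 \<le> r \<Longrightarrow> r \<le> 1 \<Longrightarrow> 0 \<le> r * x$3 \<and> r * x$3 \<le> (1::real)"
  by (auto simp: slab_def intro: mult_le_one)

text \<open>Rescaling to a fixed interval moves the dependence on the upper limit into the
  integrand, so that differentiation under the integral sign applies in all three coordinates at
  once.\<close>

lemma vprimitive_unit: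
  assumes f: "smooth f" and x: "x \<in> slab"
  shows "vprimitive f x = x$3 * integral {0..1} (\<lambda>r. f (pt (x$1, x$2) (r * x$3)))"
proof -
  have "((\<lambda>r. x$3 *\<^sub>R f (pt (x$1, x$2) (r * x$3))) has_integral
      integral {0 * x$3..1 * x$3} (\<lambda>s. f (pt (x$1, x$2) s))) {0..1}"
    by (rule has_integral_substitution[where c=0 and d=1])
      (use x unit_scaled[OF x] in \<open>auto simp: slab_def intro!: smooth_continuous_pt f continuous_intros derivative_eq_intros\<close>)
  from integral_unique[OF this] show ?thesis by (simp add: vprimitive_def)
qed

text \<open>Leibniz rule for the rescaled integral \<open>G\<close>. The horizontal parts scale back
  to primitives of \<open>pd 1 f\<close> and \<open>pd 2 f\<close>; the vertical part collapses to
  \<open>f\<close> by an integration by parts in the scaling variable. The argument includes both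
  lids, where the derivative is one-sided.\<close>

lemma vprimitive_has_derivative:
  assumes f: "smooth f" and x: "x \<in> slab"
  shows "(vprimitive f has_derivative (\<lambda>h. h$1 * vprimitive (pd 1 f) x + h$2 * vprimitive (pd 2 f) x + h$3 * f x)) (at x within slab)"
proof -
  define e where "e y r = pt (y$1, y$2) (r * y$3)" for y :: "real^3" and r :: real
  define B where "B i = blinfun_inner_left (axis i 1 :: real^3)" for i :: 3
  have B: "blinfun_apply (B i) h = h $ i" for i h by (simp add: B_def inner_axis)
  \<comment> \<open>The derivative of the rescaled integrand as a bounded linear map, the form in
    which \<open>leibniz_rule\<close> takes it. The factor \<open>r\<close> stems from the height
    \<open>r * y$3\<close>.\<close>
  define F where "F y r = pd 1 f (e y r) *\<^sub>R B 1 + pd 2 f (e y r) *\<^sub>R B 2 + (r * pd 3 f (e y r)) *\<^sub>R B 3" for y r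
  have es: "e y r \<in> slab" if "y \<in> slab" "r \<in> {0..1}" for y r
    using unit_scaled[OF that(1)] that(2) by (simp add: e_def)
  have ce: "continuous_on (slab \<times> {0..1}) (\<lambda>q. g (e (fst q) (snd q)))" if "smooth g" for g
    unfolding e_def by (intro smooth_continuous_pt that continuous_intros) (auto simp: unit_scaled)
  have cr: "continuous_on {0..1} (\<lambda>r. g (e x r))" if "smooth g" for g
    unfolding e_def by (intro smooth_continuous_pt that continuous_intros) (rule unit_scaled[OF x]; simp)
  note s = smooth_pd[OF f]
  have der: "((\<lambda>y. f (e y r)) has_derivative blinfun_apply (F y r)) (at y within slab)"
    if y: "y \<in> slab" and r: "r \<in> {0..1}" for y r
  proof -
    have "((\<lambda>y. e y r) has_derivative (\<lambda>h. e h r)) (at y within slab)"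
      unfolding e_def pt_alt
      by (auto intro!: derivative_eq_intros bounded_linear_imp_has_derivative[OF bounded_linear_vec_nth])
    from has_derivative_compose_within[where g=f, OF smooth_has_derivative[OF f es[OF y r]] this]
    have "((\<lambda>y. f (e y r)) has_derivative (\<lambda>h. \<Sum>i\<in>UNIV. e h r $ i * pd i f (e y r))) (at y within slab)"
      using es r by auto
    moreover have "(\<lambda>h. \<Sum>i\<in>UNIV. e h r $ i * pd i f (e y r)) = blinfun_apply (F y r)"
      by (rule ext) (simp add: F_def sum_3 B blinfun.add_left blinfun.scaleR_left e_def algebra_simps)
    ultimately show ?thesis by simp
  qed
  define G where "G y = integral (cbox 0 1) (\<lambda>r. f (e y r))" for y
  have dG0: "(G has_derivative blinfun_apply (integral (cbox 0 1) (F x))) (at x within slab)"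
    unfolding G_def[abs_def]
  proof (rule leibniz_rule[OF _ _ _ x])
    show "continuous_on (slab \<times> cbox 0 1) (\<lambda>(y, r). F y r)"
      unfolding F_def split_def cbox_interval by (intro continuous_intros ce s)
    show "(\<lambda>r. f (e y r)) integrable_on cbox 0 1" if y: "y \<in> slab" for y
      unfolding e_def by (intro integrable_continuous smooth_continuous_pt f continuous_intros)
        (rule unit_scaled[OF y]; simp)
    show "convex slab" using boxlike_slab by (simp add: boxlike_def)
  qed (use der in auto)
  have dG1: "blinfun_apply (integral (cbox 0 1) (F x)) h =
      h$1 * integral {0..1} (\<lambda>r. pd 1 f (e x r)) + h$2 * integral {0..1} (\<lambda>r. pd 2 f (e x r))
      + h$3 * integral {0..1} (\<lambda>r. r * pd 3 f (e x r))" for h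
  proof -
    have "F x integrable_on cbox 0 1"
      unfolding F_def cbox_interval by (intro integrable_continuous_interval continuous_intros cr s)
    then have "blinfun_apply (integral (cbox 0 1) (F x)) h = integral (cbox 0 1) (\<lambda>r. blinfun_apply (F x r) h)"
      by (rule blinfun_apply_integral)
    also have "\<dots> = integral {0..1} (\<lambda>r. h$1 * pd 1 f (e x r) + h$2 * pd 2 f (e x r) + h$3 * (r * pd 3 f (e x r)))"
      by (simp add: F_def B blinfun.add_left blinfun.scaleR_left mult_ac)
    also have "\<dots> = integral {0..1} (\<lambda>r. h$1 * pd 1 f (e x r)) + integral {0..1} (\<lambda>r. h$2 * pd 2 f (e x r)) + integral {0..1} (\<lambda>r. h$3 * (r * pd 3 f (e x r)))"
      by (rule trans[OF integral_add arg_cong2[where f="(+)", OF integral_add refl]])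
        (intro integrable_continuous_interval continuous_intros cr s)+
    finally show ?thesis by simp
  qed
  have dG: "(G has_derivative (\<lambda>h. h$1 * integral {0..1} (\<lambda>r. pd 1 f (e x r)) + h$2 * integral {0..1} (\<lambda>r. pd 2 f (e x r))
      + h$3 * integral {0..1} (\<lambda>r. r * pd 3 f (e x r)))) (at x within slab)"
    by (rule has_derivative_eq_rhs[OF dG0]) (rule ext, rule dG1)
  have d3: "((\<lambda>y::real^3. y$3) has_derivative (\<lambda>h. h$3)) (at x within slab)"
    by (rule bounded_linear_imp_has_derivative[OF bounded_linear_vec_nth])
  \<comment> \<open>The integrand on the left is the derivative of \<open>r * f (e x r)\<close>,
    which is \<open>f x\<close> at \<open>r = 1\<close> and 0 at \<open>r = 0\<close>.\<close>
  have byparts: "x$3 * integral {0..1} (\<lambda>r. r * pd 3 f (e x r)) + G x = f x"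
  proof -
    have "((\<lambda>r. x$3 * (r * pd 3 f (e x r)) + f (e x r)) has_integral (1 * f (e x 1) - 0 * f (e x 0))) {0..1}"
    proof (rule fundamental_theorem_of_calculus)
      fix r :: real assume r: "r \<in> {0..1}"
      have "((\<lambda>r. e x r) has_derivative (\<lambda>h. (h * x$3) *\<^sub>R axis 3 1)) (at r within {0..1})"
        unfolding e_def pt_alt by (auto intro!: derivative_eq_intros)
      moreover have "e x ` {0..1} \<subseteq> slab" using es[OF x] by blast
      ultimately have "((\<lambda>r. f (e x r)) has_derivative (\<lambda>h. \<Sum>i\<in>UNIV. ((h * x$3) *\<^sub>R axis 3 1) $ i * pd i f (e x r))) (at r within {0..1})"
        by (rule has_derivative_compose_within[where g=f and f="e x" and x=r, OF smooth_has_derivative[OF f es[OF x r]]])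
      then have "((\<lambda>r. f (e x r)) has_real_derivative (x$3 * pd 3 f (e x r))) (at r within {0..1})"
        unfolding has_field_derivative_def by (rule has_derivative_eq_rhs) (auto simp: sum_3 axis_def mult_ac)
      then have "((\<lambda>r. r * f (e x r)) has_real_derivative (x$3 * (r * pd 3 f (e x r)) + f (e x r))) (at r within {0..1})"
        by (auto intro!: derivative_eq_intros)
      then show "((\<lambda>r. r * f (e x r)) has_vector_derivative (x$3 * (r * pd 3 f (e x r)) + f (e x r))) (at r within {0..1})"
        by (simp add: has_real_derivative_iff_has_vector_derivative)
    qed simp
    moreover have "e x 1 = x" by (simp add: e_def vec_eq_iff forall_3)
    ultimately have "integral {0..1} (\<lambda>r. x$3 * (r * pd 3 f (e x r)) + f (e x r)) = f x" by (simp add: integral_unique)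
    moreover have "integral {0..1} (\<lambda>r. x$3 * (r * pd 3 f (e x r)) + f (e x r)) =
       integral {0..1} (\<lambda>r. x$3 * (r * pd 3 f (e x r))) + integral {0..1} (\<lambda>r. f (e x r))"
      by (intro integral_add integrable_continuous_interval continuous_intros cr s f)
    ultimately show ?thesis by (simp add: G_def)
  qed
  have "((\<lambda>y. y$3 * G y) has_derivative (\<lambda>h. h$1 * vprimitive (pd 1 f) x + h$2 * vprimitive (pd 2 f) x + h$3 * f x)) (at x within slab)"
    by (rule has_derivative_eq_rhs[OF has_derivative_mult[OF d3 dG]])
      (rule ext, simp add: vprimitive_unit[OF s x] e_def[symmetric] byparts[symmetric] algebra_simps)
  then show ?thesis
    by (rule has_derivative_transform[OF x, rotated]) (simp add: vprimitive_unit[OF f] G_def e_def)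
qed

text \<open>Horizontal derivatives of a primitive are again primitives of smooth functions and the
  vertical one is \<open>f\<close>, so the induction closes when \<open>f\<close> is left
  arbitrary.\<close>

lemma Ck_on_vprimitive: "smooth f \<Longrightarrow> Ck_on k (vprimitive f) slab"
proof (induction k arbitrary: f)
  case 0
  then show ?case
    by (auto simp: continuous_on_eq_continuous_within intro: has_derivative_continuous[OF vprimitive_has_derivative[OF 0]])
next
  case (Suc k)
  show ?case
  proof (rule Ck_on_SucI[OF boxlike_slab vprimitive_has_derivative[OF Suc.prems]])
    fix h :: "real^3" assume "h \<in> Basis"
    then obtain j where j: "h = axis j 1" by (auto simp: Basis_vec_def)
    have "Ck_on k f slab" using Suc.prems by (simp add: smooth_on_def)
    then show "Ck_on k (\<lambda>x. h$1 * vprimitive (pd 1 f) x + h$2 * vprimitive (pd 2 f) x + h$3 * f x) slab"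
      using Suc.IH[OF smooth_pd[OF Suc.prems]] by (intro Ck_on_add Ck_on_mult Ck_on_const boxlike_slab)
  qed
qed

lemma smooth_vprimitive: "smooth f \<Longrightarrow> smooth (vprimitive f)"
  by (simp add: smooth_on_def Ck_on_vprimitive)

lemma pd_vprimitive:
  assumes "smooth f" "x \<in> slab"
  shows "pd 1 (vprimitive f) x = vprimitive (pd 1 f) x" "pd 2 (vprimitive f) x = vprimitive (pd 2 f) x" "pd 3 (vprimitive f) x = f x"
  using pd_eqI[OF vprimitive_has_derivative[OF assms] assms(2)] by (simp_all add: axis_def)

lemma vprim_component:
  assumes F: "continuous_on slab F" and x: "x \<in> slab"
  shows "vprim F x $ i = vprimitive (\<lambda>y. F y $ i) x"
proof -
  have "(\<lambda>s. F (pt (x$1, x$2) s)) integrable_on {0..x$3}"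
    by (intro integrable_continuous_interval continuous_on_compose2[OF F] continuous_intros)
      (use x in \<open>auto simp: slab_def\<close>)
  then show ?thesis
    by (simp add: vprim_def vprimitive_def pt_def integral_component_eq_cart)
qed

lemma vprimitive_cong: "(\<And>y. y \<in> slab \<Longrightarrow> f y = g y) \<Longrightarrow> x \<in> slab \<Longrightarrow> vprimitive f x = vprimitive g x"
  unfolding vprimitive_def by (rule integral_cong) (auto simp: slab_def)

lemma laplacian_3: "laplacian f x = pd 1 (pd 1 f) x + pd 2 (pd 2 f) x + pd 3 (pd 3 f) x"
  by (simp add: laplacian_def sum_3)

lemma smooth_laplacian: "smooth f \<Longrightarrow> smooth (laplacian f)"
  unfolding laplacian_3[abs_def] by (intro smooth_intros)

context periodic_cell begin

lemma per_smooth_vprimitive: "per_smooth f \<Longrightarrow> per_smooth (vprimitive f)"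
proof -
  assume f: "per_smooth f"
  have "f (pt (a + Lx, b) s) = f (pt (a, b) s)" "f (pt (a, b + Ly) s) = f (pt (a, b) s)" if "0 \<le> s" "s \<le> 1" for a b s
  proof -
    have "pt (a + Lx, b) s = pt (a, b) s + axis 1 Lx" "pt (a, b + Ly) s = pt (a, b) s + axis 2 Ly"
      by (simp_all add: vec_eq_iff forall_3 axis_def)
    then show "f (pt (a + Lx, b) s) = f (pt (a, b) s)" "f (pt (a, b + Ly) s) = f (pt (a, b) s)"
      using f that by (simp_all add: per_smooth_def periodic_def)
  qed
  then have "periodic Lx Ly (vprimitive f)"
    by (auto simp: periodic_def vprimitive_def axis_def slab_def intro!: integral_cong)
  then show "per_smooth (vprimitive f)" using f by (simp add: per_smooth_def smooth_vprimitive)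
qed

lemma per_smooth_laplacian: "per_smooth f \<Longrightarrow> per_smooth (laplacian f)"
  unfolding laplacian_3[abs_def] by (intro per_smooth_intros)

subsection \<open>Fields with lid conditions\<close>

lemma green:
  assumes f: "per_smooth f" and g: "per_smooth g" and lid: "\<And>x. x \<in> lids \<Longrightarrow> f x * pd 3 g x = 0"
  shows "cint (\<lambda>x. f x * laplacian g x) =
    - (cint (\<lambda>x. pd 1 f x * pd 1 g x) + cint (\<lambda>x. pd 2 f x * pd 2 g x) + cint (\<lambda>x. pd 3 f x * pd 3 g x))"
proof -
  have 1: "cint (\<lambda>x. f x * pd i (pd i g) x) = - cint (\<lambda>x. pd i f x * pd i g x)" for i
    using ibp[OF f per_smooth_pd[OF g], of i i] lid by force
  have "cint (\<lambda>x. f x * laplacian g x) = cint (\<lambda>x. f x * pd 1 (pd 1 g) x + f x * pd 2 (pd 2 g) x + f x * pd 3 (pd 3 g) x)"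
    by (simp add: laplacian_3 distrib_left)
  also have "\<dots> = cint (\<lambda>x. f x * pd 1 (pd 1 g) x) + cint (\<lambda>x. f x * pd 2 (pd 2 g) x) + cint (\<lambda>x. f x * pd 3 (pd 3 g) x)"
    by (simp add: cint_add smooth_intros per_smooth_smooth f g)
  finally show ?thesis by (simp add: 1)
qed

definition lid_zero :: "(real^3 \<Rightarrow> real) \<Rightarrow> bool" where
  "lid_zero f \<longleftrightarrow> (\<forall>x\<in>lids. f x = 0)"

lemma lid_zero_pd:
  assumes "smooth f" "lid_zero f" "i \<noteq> 3"
  shows "lid_zero (pd i f)"
  unfolding lid_zero_def
proof
  fix x assume "x \<in> lids"
  then obtain z where z: "x $ 3 = z" "z = 0 \<or> z = 1" by (auto simp: bottom_def top_lid_def)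
  show "pd i f x = 0"
    by (rule pd_horizontal_zero[OF assms(1), of z 0]) (use assms z in \<open>auto simp: lid_zero_def bottom_def top_lid_def\<close>)
qed

definition lid_condition :: "(real^3 \<Rightarrow> real) \<Rightarrow> bool" where
  "lid_condition f \<longleftrightarrow> lid_zero f \<or> lid_zero (pd 3 f)"

text \<open>The two situations in which the Poincare inequality and the Hessian identity both hold.
  In the application \<open>b 1\<close>, \<open>b 2\<close> and the third velocity component are of
  Dirichlet type, the other three components of Neumann type with zero mean.\<close>

definition compatible :: "(real^3 \<Rightarrow> real) \<Rightarrow> bool" where
  "compatible f \<longleftrightarrow> per_smooth f \<and> (lid_zero f \<or> lid_zero (pd 3 f) \<and> cint f = 0)"

lemma compatible_per_smooth: "compatible f \<Longrightarrow> per_smooth f" and compatible_lid_condition: "compatible f \<Longrightarrow> lid_condition f"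
  by (auto simp: compatible_def lid_condition_def)

text \<open>Two integrations by parts, in direction \<open>i\<close> and then in \<open>j\<close>.
  Only the first can be vertical; its boundary term is \<open>pd 3 f\<close> times a second
  derivative along the lid, and either lid condition makes one of these factors vanish.\<close>

lemma hessian_cross:
  assumes f: "per_smooth f" and b: "lid_condition f" and ij: "i \<noteq> j" "j \<noteq> 3"
  shows "cint (\<lambda>x. pd i (pd i f) x * pd j (pd j f) x) = csq (pd j (pd i f))"
proof -
  have sf: "smooth f" using f per_smooth_smooth by simp
  have lid: "x \<in> lids \<Longrightarrow> pd 3 f x * pd j (pd j f) x = 0" for x
    using b lid_zero_pd[OF smooth_pd[OF sf] lid_zero_pd[OF sf _ ij(2)] ij(2)] by (auto simp: lid_condition_def lid_zero_def)
  have "cint (\<lambda>x. pd i (pd i f) x * pd j (pd j f) x) = - cint (\<lambda>x. pd i f x * pd i (pd j (pd j f)) x)"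
    by (rule ibp) (use lid in \<open>auto intro!: per_smooth_intros f\<close>)
  also have "cint (\<lambda>x. pd i f x * pd i (pd j (pd j f)) x) = cint (\<lambda>x. pd i f x * pd j (pd j (pd i f)) x)"
  proof (rule cint_cong)
    fix x assume x: "x \<in> slab"
    have "pd i (pd j (pd j f)) x = pd j (pd i (pd j f)) x" by (rule pd_commute[OF smooth_pd[OF sf] x])
    also have "\<dots> = pd j (pd j (pd i f)) x" by (rule pd_cong[OF pd_commute[OF sf] x])
    finally show "pd i f x * pd i (pd j (pd j f)) x = pd i f x * pd j (pd j (pd i f)) x" by simp
  qed
  also have "\<dots> = - cint (\<lambda>x. pd j (pd i f) x * pd j (pd i f) x)"
    using ibp[OF per_smooth_pd[OF f] per_smooth_pd[OF per_smooth_pd[OF f]], of j i j i] ij by simp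
  finally show ?thesis by (simp add: power2_eq_square)
qed

lemma hessian_identity:
  assumes f: "per_smooth f" and b: "lid_condition f"
  shows "(\<Sum>i\<in>UNIV. \<Sum>j\<in>UNIV. csq (pd i (pd j f))) = csq (laplacian f)"
proof -
  have sf: "smooth f" using f per_smooth_smooth by simp
  let ?c = "\<lambda>i j. cint (\<lambda>x. pd i (pd i f) x * pd j (pd j f) x)"
  have "csq (laplacian f) = cint (\<lambda>x. (pd 1 (pd 1 f) x)\<^sup>2 + (pd 2 (pd 2 f) x)\<^sup>2 + (pd 3 (pd 3 f) x)\<^sup>2
     + 2 * (pd 2 (pd 2 f) x * pd 1 (pd 1 f) x) + 2 * (pd 3 (pd 3 f) x * pd 1 (pd 1 f) x) + 2 * (pd 3 (pd 3 f) x * pd 2 (pd 2 f) x))"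
    by (rule cint_cong) (simp add: laplacian_3 power2_eq_square algebra_simps)
  also have "\<dots> = csq (pd 1 (pd 1 f)) + csq (pd 2 (pd 2 f)) + csq (pd 3 (pd 3 f))
     + 2 * ?c 2 1 + 2 * ?c 3 1 + 2 * ?c 3 2"
    by (simp add: cint_add smooth_intros sf)
  also have "?c 2 1 = csq (pd 1 (pd 2 f))" "?c 3 1 = csq (pd 1 (pd 3 f))" "?c 3 2 = csq (pd 2 (pd 3 f))"
    by (rule hessian_cross[OF f b]; simp)+
  moreover have "csq (pd 2 (pd 1 f)) = csq (pd 1 (pd 2 f))"
     "csq (pd 3 (pd 1 f)) = csq (pd 1 (pd 3 f))"
     "csq (pd 3 (pd 2 f)) = csq (pd 2 (pd 3 f))"
    by (rule cint_cong; simp add: pd_commute[OF sf])+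
  ultimately show ?thesis by (simp add: sum_3)
qed

text \<open>Green's formula turns the gradient norm into the integral of
  \<open>- f * laplacian f\<close>. Young with weight \<open>CP^2\<close> and the Poincare
  inequality return half of the gradient norm, which is absorbed on the left.\<close>

lemma compatible_gradient:
  assumes f: "compatible f"
  shows "(\<Sum>i\<in>UNIV. csq (pd i f)) \<le> CP\<^sup>2 * csq (laplacian f)"
    and "csq f \<le> CP^4 * csq (laplacian f)"
proof -
  have p: "per_smooth f" and sf: "smooth f" using f compatible_per_smooth per_smooth_smooth by auto
  let ?N = "csq f" and ?G = "\<Sum>i\<in>UNIV. csq (pd i f)" and ?H = "csq (laplacian f)"
  have nn: "0 \<le> csq (pd i f)" for i by (intro cint_nonneg smooth_intros sf) auto
  have N: "?N \<le> CP\<^sup>2 * ?G"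
  proof (cases "lid_zero f")
    case True
    then have "?N \<le> CP\<^sup>2 * csq (pd 3 f)"
      by (intro poincare_dirichlet sf) (auto simp: lid_zero_def)
    also have "\<dots> \<le> CP\<^sup>2 * ?G"
      using nn by (intro mult_left_mono) (auto simp: sum_3)
    finally show ?thesis .
  next
    case False
    then show ?thesis using f poincare_mean[OF p] by (simp add: compatible_def sum_3)
  qed
  have "cint (\<lambda>x. f x * laplacian f x) = - ?G"
    using green[OF p p] compatible_lid_condition[OF f] by (auto simp: lid_condition_def lid_zero_def sum_3 power2_eq_square)
  then have "?G = cint (\<lambda>x. - (f x * laplacian f x))" by simp
  also have "\<dots> \<le> cint (\<lambda>x. 1 / (2 * CP\<^sup>2) * (f x)\<^sup>2 + CP\<^sup>2 / 2 * (laplacian f x)\<^sup>2)"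
  proof (rule cint_mono)
    fix x
    show "- (f x * laplacian f x) \<le> 1 / (2 * CP\<^sup>2) * (f x)\<^sup>2 + CP\<^sup>2 / 2 * (laplacian f x)\<^sup>2"
      using abs_mult_le_weighted[of "CP\<^sup>2" "laplacian f x" "f x"] CP_pos by (simp add: mult.commute abs_le_iff)
  qed (intro smooth_intros smooth_laplacian sf)+
  also have "\<dots> = 1 / (2 * CP\<^sup>2) * ?N + CP\<^sup>2 / 2 * ?H"
    by (subst cint_add; (intro smooth_intros smooth_laplacian sf)?) (simp only: cint_cmult)
  also have "\<dots> \<le> 1 / (2 * CP\<^sup>2) * (CP\<^sup>2 * ?G) + CP\<^sup>2 / 2 * ?H"
    using N by (intro add_right_mono mult_left_mono) auto
  also have "\<dots> = ?G / 2 + CP\<^sup>2 * ?H / 2" using CP_pos by simp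
  finally show G: "?G \<le> CP\<^sup>2 * ?H" by linarith
  have "?N \<le> CP\<^sup>2 * (CP\<^sup>2 * ?H)" using N mult_left_mono[OF G, of "CP\<^sup>2"] by simp
  then show "?N \<le> CP^4 * ?H" by (simp add: power4_eq_xxxx power2_eq_square mult.assoc)
qed

definition slice_const :: real where "slice_const = coeff_x * coeff_y * CP^4 + coeff_d * max coeff_x coeff_y * CP\<^sup>2 + coeff_d\<^sup>2 / 2"
definition column_const :: real where "column_const = (1 + lam) * CP\<^sup>2 + 1 / lam"

lemma slice_const_pos: "0 < slice_const" and column_const_pos: "0 < column_const"
  using coeff_pos CP_pos lam_pos by (auto simp: slice_const_def column_const_def intro!: add_pos_pos mult_pos_pos add_pos_nonneg)

lemma slice_form_bound:
  assumes f: "compatible f"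
  shows "cint (slice_form f) \<le> slice_const * csq (laplacian f)"
proof -
  have p: "per_smooth f" and sf: "smooth f" using f compatible_per_smooth per_smooth_smooth by auto
  let ?H = "csq (laplacian f)" and ?d = "\<lambda>i. csq (pd i f)"
  have nn: "0 \<le> ?d i" "0 \<le> csq (pd i (pd j f))" for i j by (intro cint_nonneg smooth_intros sf; simp)+
  have "cint (slice_form f) = cint (\<lambda>x. coeff_x * coeff_y * (f x)\<^sup>2 + coeff_d * (coeff_x * (pd 2 f x)\<^sup>2) + coeff_d * (coeff_y * (pd 1 f x)\<^sup>2) + coeff_d\<^sup>2 * (pd 2 (pd 1 f) x)\<^sup>2)"
    by (rule cint_cong) (simp add: slice_form_def algebra_simps power2_eq_square)
  also have "\<dots> = coeff_x * coeff_y * csq f + coeff_d * (coeff_x * ?d 2) + coeff_d * (coeff_y * ?d 1) + coeff_d\<^sup>2 * csq (pd 2 (pd 1 f))"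
    by (simp add: cint_add smooth_intros sf)
  also have "coeff_x * coeff_y * csq f \<le> coeff_x * coeff_y * (CP^4 * ?H)"
    using coeff_pos by (intro mult_left_mono compatible_gradient f) auto
  \<comment> \<open>The mixed derivative occurs twice in the Hessian sum, so one copy accounts for
    at most half of it.\<close>
  also have "coeff_d\<^sup>2 * csq (pd 2 (pd 1 f)) \<le> coeff_d\<^sup>2 * (?H / 2)"
  proof (rule mult_left_mono)
    have "csq (pd 2 (pd 1 f)) = csq (pd 1 (pd 2 f))"
      by (rule cint_cong) (simp add: pd_commute[OF sf])
    moreover have "csq (pd 1 (pd 2 f)) + csq (pd 2 (pd 1 f)) \<le> ?H"
      unfolding hessian_identity[OF p compatible_lid_condition[OF f], symmetric] sum_3
      using nn(2)[of 1 1] nn(2)[of 1 3] nn(2)[of 2 2] nn(2)[of 2 3] nn(2)[of 3 1] nn(2)[of 3 2] nn(2)[of 3 3] by linarith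
    ultimately show "csq (pd 2 (pd 1 f)) \<le> ?H / 2" by linarith
  qed simp
  finally have 1: "cint (slice_form f) \<le> coeff_x * coeff_y * (CP^4 * ?H) + coeff_d * (coeff_x * ?d 2) + coeff_d * (coeff_y * ?d 1) + coeff_d\<^sup>2 * (?H / 2)"
    by simp
  have "coeff_x * ?d 2 + coeff_y * ?d 1 \<le> max coeff_x coeff_y * ?d 2 + max coeff_x coeff_y * ?d 1"
    by (intro add_mono mult_right_mono nn) auto
  also have "\<dots> \<le> max coeff_x coeff_y * (?d 1 + ?d 2 + ?d 3)"
    using nn coeff_pos by (simp add: distrib_left)
  also have "\<dots> \<le> max coeff_x coeff_y * (CP\<^sup>2 * ?H)"
    using compatible_gradient(1)[OF f] coeff_pos by (intro mult_left_mono) (auto simp: sum_3)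
  finally have "coeff_d * (coeff_x * ?d 2 + coeff_y * ?d 1) \<le> coeff_d * (max coeff_x coeff_y * (CP\<^sup>2 * ?H))"
    using coeff_pos by (intro mult_left_mono) auto
  with 1 show ?thesis by (simp add: slice_const_def algebra_simps)
qed

text \<open>The sum over \<open>j\<close> is estimated as a whole: the second derivatives in it form
  a single row of the Hessian, so the Laplacian norm is paid once and not three times.\<close>

lemma column_form_bound:
  assumes g: "compatible g"
  shows "(\<Sum>j\<in>UNIV. cint (column_form (pd j g))) \<le> column_const * csq (laplacian g)"
proof -
  have p: "per_smooth g" and sg: "smooth g" using g compatible_per_smooth per_smooth_smooth by auto
  let ?H = "csq (laplacian g)"
  have nn: "0 \<le> csq (pd i (pd j g))" for i j by (intro cint_nonneg smooth_intros sg; simp)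
  have "cint (column_form (pd j g)) = (1 + lam) * csq (pd j g) + 1 / lam * csq (pd 3 (pd j g))" for j
    unfolding column_form_def[abs_def] by (subst cint_add; (intro smooth_intros sg)?) (simp only: cint_cmult)
  then have "(\<Sum>j\<in>UNIV. cint (column_form (pd j g))) =
     (1 + lam) * (\<Sum>j\<in>UNIV. csq (pd j g)) + 1 / lam * (\<Sum>j\<in>UNIV. csq (pd 3 (pd j g)))"
    by (simp add: sum.distrib sum_distrib_left sum_divide_distrib)
  also have "\<dots> \<le> (1 + lam) * (CP\<^sup>2 * ?H) + 1 / lam * ?H"
  proof (intro add_mono mult_left_mono compatible_gradient g)
    show "(\<Sum>j\<in>UNIV. csq (pd 3 (pd j g))) \<le> ?H"
      unfolding hessian_identity[OF p compatible_lid_condition[OF g], symmetric]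
      by (rule member_le_sum[where f="\<lambda>i. \<Sum>j\<in>UNIV. csq (pd i (pd j g))"]) (auto intro: sum_nonneg nn)
  qed (use lam_pos in auto)
  finally show ?thesis by (simp add: column_const_def algebra_simps)
qed

text \<open>Cauchy-Schwarz over the component index decouples the factors pointwise; the product
  estimate then applies to every pair, and the double sum factors again.\<close>

lemma advection_estimate:
  fixes f g :: "3 \<Rightarrow> real^3 \<Rightarrow> real"
  assumes f: "\<And>i. compatible (f i)" and g: "\<And>i. compatible (g i)"
  shows "cint (\<lambda>x. \<Sum>k\<in>UNIV. (adv f (g k) x)\<^sup>2)
    \<le> slice_const * column_const * ((\<Sum>i\<in>UNIV. csq (laplacian (f i))) * (\<Sum>k\<in>UNIV. csq (laplacian (g k))))"
proof -
  have s: "\<And>i. smooth (f i)" "\<And>i. smooth (g i)" using f g compatible_per_smooth per_smooth_smooth by auto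
  have "cint (\<lambda>x. \<Sum>k\<in>UNIV. (adv f (g k) x)\<^sup>2)
    \<le> cint (\<lambda>x. \<Sum>k\<in>UNIV. \<Sum>i\<in>UNIV. \<Sum>j\<in>UNIV. (f i x)\<^sup>2 * (pd j (g k) x)\<^sup>2)"
  proof (intro cint_mono sum_mono)
    fix x k
    have "(adv f (g k) x)\<^sup>2 \<le> (\<Sum>i\<in>UNIV. (f i x)\<^sup>2) * (\<Sum>j\<in>UNIV. (pd j (g k) x)\<^sup>2)"
      by (rule Cauchy_Schwarz_ineq_sum)
    then show "(adv f (g k) x)\<^sup>2 \<le> (\<Sum>i\<in>UNIV. \<Sum>j\<in>UNIV. (f i x)\<^sup>2 * (pd j (g k) x)\<^sup>2)"
      by (simp add: sum_product)
  qed (intro smooth_intros s)+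
  also have "\<dots> = (\<Sum>k\<in>UNIV. \<Sum>i\<in>UNIV. \<Sum>j\<in>UNIV. cint (\<lambda>x. (f i x)\<^sup>2 * (pd j (g k) x)\<^sup>2))"
    by (simp add: cint_sum smooth_intros s)
  also have "\<dots> \<le> (\<Sum>k\<in>UNIV. \<Sum>i\<in>UNIV. \<Sum>j\<in>UNIV. cint (slice_form (f i)) * cint (column_form (pd j (g k))))"
    by (intro sum_mono product_estimate compatible_per_smooth f smooth_pd s)
  also have "\<dots> = (\<Sum>i\<in>UNIV. cint (slice_form (f i))) * (\<Sum>k\<in>UNIV. \<Sum>j\<in>UNIV. cint (column_form (pd j (g k))))"
    by (subst sum.swap) (simp add: sum_product sum_distrib_left sum_distrib_right)
  also have "\<dots> \<le> (\<Sum>i\<in>UNIV. slice_const * csq (laplacian (f i))) * (\<Sum>k\<in>UNIV. column_const * csq (laplacian (g k)))"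
  proof (intro mult_mono sum_mono slice_form_bound column_form_bound f g sum_nonneg)
    show "0 \<le> slice_const * csq (laplacian (f i))" for i
      using slice_const_pos by (intro mult_nonneg_nonneg cint_nonneg smooth_intros smooth_laplacian s) auto
    show "0 \<le> cint (column_form (pd j (g k)))" for j k
      using lam_pos by (intro cint_nonneg smooth_column_form smooth_intros s) (simp add: column_form_def)
  qed
  finally show ?thesis by (simp add: sum_distrib_left[symmetric] mult_ac)
qed

end

section \<open>Vector identities and rules for the Laplacian on the slab\<close>

lemma curl_nth:
  "curl F x $ 1 = pd 2 (\<lambda>y. F y $ 3) x - pd 3 (\<lambda>y. F y $ 2) x"
  "curl F x $ 2 = pd 3 (\<lambda>y. F y $ 1) x - pd 1 (\<lambda>y. F y $ 3) x"
  "curl F x $ 3 = pd 1 (\<lambda>y. F y $ 2) x - pd 2 (\<lambda>y. F y $ 1) x"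
  by (simp_all add: curl_def)

lemma smooth_curl: "(\<And>i. smooth (\<lambda>y. F y $ i)) \<Longrightarrow> smooth (\<lambda>x. curl F x $ k)"
  using exhaust_3[of k] by (auto simp: curl_nth intro!: smooth_intros)

text \<open>The gradient of the divergence drops out; \<open>d\<close> states its vanishing
  component by component.\<close>

lemma curl_curl:
  assumes V: "\<And>i. smooth (\<lambda>y. V y $ i)" and div: "\<And>y. y \<in> slab \<Longrightarrow> divergence V y = 0" and x: "x \<in> slab"
  shows "curl (curl V) x $ k = - laplacian (\<lambda>y. V y $ k) x"
proof -
  have d: "pd k (pd 1 (\<lambda>y. V y $ 1)) x + pd k (pd 2 (\<lambda>y. V y $ 2)) x + pd k (pd 3 (\<lambda>y. V y $ 3)) x = 0" for k
  proof -
    have "pd k (\<lambda>y. pd 1 (\<lambda>y. V y $ 1) y + pd 2 (\<lambda>y. V y $ 2) y + pd 3 (\<lambda>y. V y $ 3) y) x = pd k (\<lambda>y. 0) x"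
      by (rule pd_cong[OF _ x]) (use div in \<open>simp add: divergence_def sum_3\<close>)
    then show ?thesis using x by (simp add: pd_add smooth_intros V)
  qed
  note c = pd_commute[OF V x]
  consider "k = 1" | "k = 2" | "k = 3" using exhaust_3 by blast
  then show ?thesis
    by cases (use d[of 1] d[of 2] d[of 3] x in \<open>simp_all add: curl_nth pd_diff smooth_intros V laplacian_3
      c[of 2 1] c[of 3 1] c[of 3 2]\<close>)
qed

text \<open>Of the four terms in the curl of a cross product, the two containing a divergence
  vanish.\<close>

lemma curl_cross:
  assumes u: "\<And>i. smooth (\<lambda>y. U y $ i)" "divergence U x = 0" and b: "\<And>i. smooth (\<lambda>y. V y $ i)" "divergence V x = 0"
    and x: "x \<in> slab"
  shows "curl (\<lambda>y. cross3 (U y) (V y)) x $ k =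
    (\<Sum>i\<in>UNIV. V x $ i * pd i (\<lambda>y. U y $ k) x) - (\<Sum>i\<in>UNIV. U x $ i * pd i (\<lambda>y. V y $ k) x)"
proof -
  have d: "pd 3 (\<lambda>y. U y $ 3) x = - pd 1 (\<lambda>y. U y $ 1) x - pd 2 (\<lambda>y. U y $ 2) x"
    "pd 3 (\<lambda>y. V y $ 3) x = - pd 1 (\<lambda>y. V y $ 1) x - pd 2 (\<lambda>y. V y $ 2) x"
    using u(2) b(2) by (simp_all add: divergence_def sum_3)
  consider "k = 1" | "k = 2" | "k = 3" using exhaust_3 by blast
  then show ?thesis
    by cases (use x in \<open>simp_all add: curl_nth cross3_simps cross_components pd_diff pd_mult smooth_intros u(1) b(1) sum_3 d algebra_simps\<close>)
qed

text \<open>The Lorentz force as magnetic tension minus the gradient of the magnetic pressure, half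
  the squared length of \<open>V\<close>. The latter will be merged with the fluid pressure.\<close>

lemma curl_cross_self:
  "cross3 (curl V x) (V x) $ k =
    (\<Sum>i\<in>UNIV. V x $ i * pd i (\<lambda>y. V y $ k) x) - (\<Sum>i\<in>UNIV. V x $ i * pd k (\<lambda>y. V y $ i) x)"
proof -
  consider "k = 1" | "k = 2" | "k = 3" using exhaust_3 by blast
  then show ?thesis
    by cases (simp_all add: curl_nth cross_components sum_3 algebra_simps)
qed

lemma laplacian_cong: "(\<And>y. y \<in> slab \<Longrightarrow> f y = g y) \<Longrightarrow> x \<in> slab \<Longrightarrow> laplacian f x = laplacian g x"
  unfolding laplacian_3 by (intro arg_cong2[where f="(+)"] pd_cong) auto

lemma laplacian_zero: "x \<in> slab \<Longrightarrow> laplacian (\<lambda>y. 0::real) x = 0"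
proof -
  assume x: "x \<in> slab"
  have "pd i (pd i (\<lambda>y. 0::real)) x = pd i (\<lambda>y. 0::real) x" for i
    by (rule pd_cong[OF _ x]) simp
  then show ?thesis using x by (simp add: laplacian_3)
qed

lemma laplacian_add: "smooth f \<Longrightarrow> smooth g \<Longrightarrow> x \<in> slab \<Longrightarrow> laplacian (\<lambda>y. f y + g y) x = laplacian f x + laplacian g x"
proof -
  assume *: "smooth f" "smooth g" "x \<in> slab"
  have "pd i (pd i (\<lambda>y. f y + g y)) x = pd i (pd i f) x + pd i (pd i g) x" for i
    using pd_cong[of "pd i (\<lambda>y. f y + g y)" "\<lambda>y. pd i f y + pd i g y" x i] * by (simp add: pd_add smooth_intros)
  then show ?thesis by (simp add: laplacian_3)
qed

lemma laplacian_cmult: "smooth f \<Longrightarrow> x \<in> slab \<Longrightarrow> laplacian (\<lambda>y. c * f y) x = c * laplacian f x"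
proof -
  assume *: "smooth f" "x \<in> slab"
  have "pd i (pd i (\<lambda>y. c * f y)) x = c * pd i (pd i f) x" for i
    using pd_cong[of "pd i (\<lambda>y. c * f y)" "\<lambda>y. c * pd i f y" x i] * by (simp add: pd_cmult smooth_intros)
  then show ?thesis by (simp add: laplacian_3 distrib_left)
qed

lemma laplacian_diff: "smooth f \<Longrightarrow> smooth g \<Longrightarrow> x \<in> slab \<Longrightarrow> laplacian (\<lambda>y. f y - g y) x = laplacian f x - laplacian g x"
  using laplacian_add[of f "\<lambda>y. (-1) * g y" x] laplacian_cmult[of g x "-1"] by (simp add: smooth_minus)

lemma pd_laplacian: "smooth f \<Longrightarrow> x \<in> slab \<Longrightarrow> pd k (laplacian f) x = laplacian (pd k f) x"
proof -
  assume *: "smooth f" "x \<in> slab"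
  have "pd k (pd i (pd i f)) x = pd i (pd i (pd k f)) x" for i
  proof -
    have "pd k (pd i (pd i f)) x = pd i (pd k (pd i f)) x" by (rule pd_commute[OF smooth_pd[OF *(1)] *(2)])
    also have "\<dots> = pd i (pd i (pd k f)) x" by (rule pd_cong[OF pd_commute[OF *(1)] *(2)])
    finally show ?thesis .
  qed
  then show ?thesis
    unfolding laplacian_3[abs_def] using * by (simp add: pd_add smooth_intros)
qed

section \<open>Vanishing means and the bound on the velocity\<close>

context periodic_cell begin

text \<open>Here \<open>w\<close> is the Coriolis term, up to sign the other horizontal velocity
  component. Integrated over the cell, pressure gradient and viscous term give only boundary values
  that vanish; the tension is the divergence of \<open>b i * b j\<close>, whose lid flux vanishes
  with \<open>b j\<close>, and the magnetic pressure gradient is horizontal. Only \<open>w\<close>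
  is left.\<close>

lemma mean_horizontal_velocity:
  fixes b :: "3 \<Rightarrow> real^3 \<Rightarrow> real"
  assumes u: "per_smooth u" "per_smooth w" and b: "\<And>i. per_smooth (b i)" and p: "per_smooth p"
    and j: "j \<noteq> 3"
    and mom: "\<And>x. x \<in> slab \<Longrightarrow> w x + pd j p x - Ek * laplacian u x
      = Lam * (adv b (b j) x - (\<Sum>i\<in>UNIV. b i x * pd j (b i) x))"
    and divb: "\<And>x. x \<in> slab \<Longrightarrow> (\<Sum>i\<in>UNIV. pd i (b i) x) = 0"
    and lid: "lid_zero (pd 3 u)" "lid_zero (b j)"
  shows "cint w = 0"
proof -
  have s: "smooth u" "smooth w" "\<And>i. smooth (b i)" "smooth p" using u b p per_smooth_smooth by auto
  have 1: "cint (pd j p) = 0" by (rule cint_pd_zero) (use p j in auto)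
  have 2: "cint (laplacian u) = 0"
  proof -
    have "cint (laplacian u) = cint (pd 1 (pd 1 u)) + cint (pd 2 (pd 2 u)) + cint (pd 3 (pd 3 u))"
      unfolding laplacian_3[abs_def] by (simp add: cint_add smooth_intros s)
    moreover have "cint (pd i (pd i u)) = 0" for i
      by (rule cint_pd_zero) (use lid in \<open>auto intro!: per_smooth_intros u simp: lid_zero_def\<close>)
    ultimately show ?thesis by simp
  qed
  have 3: "cint (\<lambda>x. \<Sum>i\<in>UNIV. b i x * pd i (b j) x) = 0"
  proof -
    have "cint (\<lambda>x. \<Sum>i\<in>UNIV. b i x * pd i (b j) x) = (\<Sum>i\<in>UNIV. cint (\<lambda>x. b i x * pd i (b j) x))"
      by (simp add: cint_sum smooth_intros s)
    also have "\<dots> = (\<Sum>i\<in>UNIV. - cint (\<lambda>x. pd i (b i) x * b j x))"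
      using ibp[OF b b] lid(2) by (intro sum.cong) (auto simp: lid_zero_def)
    also have "\<dots> = - cint (\<lambda>x. (\<Sum>i\<in>UNIV. pd i (b i) x) * b j x)"
      by (simp add: cint_sum smooth_intros s sum_negf sum_distrib_right)
    also have "\<dots> = - cint (\<lambda>x. 0)" by (simp only: cint_cong[of "\<lambda>x. (\<Sum>i\<in>UNIV. pd i (b i) x) * b j x" "\<lambda>x. 0"] divb mult_zero_left)
    finally show ?thesis by simp
  qed
  have 4: "cint (\<lambda>x. \<Sum>i\<in>UNIV. b i x * pd j (b i) x) = 0"
  proof -
    have "cint (\<lambda>x. b i x * pd j (b i) x) = 0" for i
      using ibp[OF b[of i] b[of i], of j] j by (simp add: mult.commute)
    then show ?thesis by (simp add: cint_sum smooth_intros s)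
  qed
  have "cint (\<lambda>x. w x + pd j p x - Ek * laplacian u x) =
    cint (\<lambda>x. Lam * (adv b (b j) x - (\<Sum>i\<in>UNIV. b i x * pd j (b i) x)))"
    by (rule cint_cong) (rule mom)
  then show ?thesis
    using 1 2 3 4 by (simp add: cint_add cint_diff smooth_intros smooth_laplacian s)
qed

text \<open>For a divergence-free field \<open>b 3\<close> is the divergence of the height times
  \<open>b\<close>. The height is 0 at the bottom and 1 at the top, so its integral is the flux
  through the upper lid.\<close>

lemma mean_vertical_field:
  fixes b :: "3 \<Rightarrow> real^3 \<Rightarrow> real"
  assumes b: "\<And>i. per_smooth (b i)"
    and divb: "\<And>x. x \<in> slab \<Longrightarrow> (\<Sum>i\<in>UNIV. pd i (b i) x) = 0"
    and flux: "integral base (\<lambda>p. b 3 (pt p 1)) = 0"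
  shows "cint (b 3) = 0"
proof -
  have s: "\<And>i. smooth (b i)" using b per_smooth_smooth by auto
  \<comment> \<open>The height coordinate, written as a primitive so that smoothness and periodicity
    are inherited.\<close>
  define w where "w = vprimitive (\<lambda>x. 1)"
  have w: "w x = x $ 3" if "x \<in> slab" for x using that by (simp add: w_def vprimitive_def slab_def)
  have pw: "per_smooth w" unfolding w_def by (intro per_smooth_vprimitive per_smooth_const)
  have sw: "smooth w" using pw per_smooth_smooth by simp
  have dw: "pd 1 w x = 0" "pd 2 w x = 0" "pd 3 w x = 1" if "x \<in> slab" for x
    using that vprimitive_cong[of "pd 1 (\<lambda>x. 1)" "\<lambda>x. 0" x] vprimitive_cong[of "pd 2 (\<lambda>x. 1)" "\<lambda>x. 0" x]
    by (simp_all add: w_def pd_vprimitive smooth_const) (simp_all add: vprimitive_def)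
  have "cint (pd 3 (\<lambda>x. w x * b 3 x)) = integral base (\<lambda>p. w (pt p 1) * b 3 (pt p 1) - w (pt p 0) * b 3 (pt p 0))"
    by (rule cint_pd3) (intro smooth_intros sw s)
  also have "\<dots> = 0" using flux by (simp add: w)
  finally have 3: "cint (pd 3 (\<lambda>x. w x * b 3 x)) = 0" .
  have 1: "cint (pd 1 (\<lambda>x. w x * b 1 x)) = 0" by (intro cint_pd1 per_smooth_intros pw b)
  have 2: "cint (pd 2 (\<lambda>x. w x * b 2 x)) = 0" by (intro cint_pd2 per_smooth_intros pw b)
  have "cint (b 3) = cint (\<lambda>x. pd 1 (\<lambda>x. w x * b 1 x) x + pd 2 (\<lambda>x. w x * b 2 x) x + pd 3 (\<lambda>x. w x * b 3 x) x)"
  proof (rule cint_cong)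
    fix x assume x: "x \<in> slab"
    have "w x * (pd 1 (b 1) x + pd 2 (b 2) x + pd 3 (b 3) x) = 0" using divb[OF x] by (simp add: sum_3)
    then show "b 3 x = pd 1 (\<lambda>x. w x * b 1 x) x + pd 2 (\<lambda>x. w x * b 2 x) x + pd 3 (\<lambda>x. w x * b 3 x) x"
      using x by (simp add: pd_mult sw s dw distrib_left)
  qed
  also have "\<dots> = 0" by (simp add: cint_add smooth_intros sw s 1 2 3)
  finally show ?thesis .
qed

text \<open>The thermal wind \<open>- Ra \<nabla> \<times> (\<tau> e\<^sub>z)\<close>, \<open>\<tau>\<close> the vertical primitive of \<open>T\<close>, balances the
  buoyancy up to a gradient and satisfies the lid conditions; what remains of the velocity is
  orthogonal to the Coriolis force and to gradients when tested with its Laplacian.\<close>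

lemma velocity_bound:
  fixes u b :: "3 \<Rightarrow> real^3 \<Rightarrow> real" and Ek Lam Ra :: real
  assumes u: "\<And>i. per_smooth (u i)" and b: "\<And>i. per_smooth (b i)" and p: "per_smooth p" and T: "per_smooth T" and Ek: "0 < Ek"
    and mom1: "\<And>x. x \<in> slab \<Longrightarrow> - u 2 x + pd 1 p x - Ek * laplacian (u 1) x
      = Lam * (adv b (b 1) x - (\<Sum>i\<in>UNIV. b i x * pd 1 (b i) x))"
    and mom2: "\<And>x. x \<in> slab \<Longrightarrow> u 1 x + pd 2 p x - Ek * laplacian (u 2) x
      = Lam * (adv b (b 2) x - (\<Sum>i\<in>UNIV. b i x * pd 2 (b i) x))"
    and mom3: "\<And>x. x \<in> slab \<Longrightarrow> pd 3 p x - Ek * laplacian (u 3) x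
      = Lam * (adv b (b 3) x - (\<Sum>i\<in>UNIV. b i x * pd 3 (b i) x)) + Ra * T x"
    and divu: "\<And>x. x \<in> slab \<Longrightarrow> (\<Sum>i\<in>UNIV. pd i (u i) x) = 0"
    and lid: "lid_zero (u 3)" "lid_zero (pd 3 (u 1))" "lid_zero (pd 3 (u 2))"
    and lidT: "lid_zero (pd 1 T)" "lid_zero (pd 2 T)"
  shows "(\<Sum>k\<in>UNIV. csq (laplacian (u k)))
    \<le> (Lam / Ek)\<^sup>2 * cint (\<lambda>x. \<Sum>k\<in>UNIV. (adv b (b k) x)\<^sup>2)
      + Ra\<^sup>2 * cint (\<lambda>x. (laplacian (pd 2 (vprimitive T)) x)\<^sup>2 + (laplacian (pd 1 (vprimitive T)) x)\<^sup>2)"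
proof -
  define \<tau> where "\<tau> = vprimitive T"
  \<comment> \<open>Modified pressure: it includes the magnetic pressure and the potential
    \<open>Ra * \<tau>\<close> of the buoyancy, whose horizontal gradient is balanced by the
    Coriolis force of the thermal wind.\<close>
  define q where "q x = p x + Lam / 2 * (\<Sum>i\<in>UNIV. (b i x)\<^sup>2) - Ra * \<tau> x" for x
  define v1 where "v1 x = u 1 x + Ra * pd 2 \<tau> x" for x
  define v2 where "v2 x = u 2 x + (- Ra) * pd 1 \<tau> x" for x
  have \<tau>: "per_smooth \<tau>" unfolding \<tau>_def by (intro per_smooth_vprimitive T)
  have q: "per_smooth q" unfolding q_def[abs_def] by (intro per_smooth_intros p b \<tau>)
  have v: "per_smooth v1" "per_smooth v2" unfolding v1_def[abs_def] v2_def[abs_def] by (intro per_smooth_intros u \<tau>)+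
  note s = per_smooth_smooth[OF u] per_smooth_smooth[OF b] per_smooth_smooth[OF p] per_smooth_smooth[OF T] per_smooth_smooth[OF \<tau>] per_smooth_smooth[OF q] per_smooth_smooth[OF v(1)] per_smooth_smooth[OF v(2)]
  define A where "A k x = adv b (b k) x" for k x
  have sA: "smooth (A k)" for k unfolding A_def[abs_def] by (intro smooth_intros s)
  \<comment> \<open>\<open>M\<close> is the magnetic tension divided by \<open>Ek\<close>,
    \<open>N\<close> the Laplacian of the thermal wind, and \<open>X\<close> below the Laplacian of
    the velocity.\<close>
  define M where "M k x = Lam / Ek * A k x" for k x
  define N where "N k x = (if k = 1 then - Ra * laplacian (pd 2 \<tau>) x else if k = 2 then Ra * laplacian (pd 1 \<tau>) x else 0)" for k :: 3 and x
  have sM: "smooth (M k)" for k unfolding M_def[abs_def] by (intro smooth_intros sA)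
  have sN: "smooth (N k)" for k
    using exhaust_3[of k] by (auto simp: N_def[abs_def] intro!: smooth_intros smooth_laplacian s)
  define X where "X k = laplacian (u k)" for k
  have sX: "smooth (X k)" for k unfolding X_def by (intro smooth_laplacian s)
  have lapv: "laplacian v1 x = X 1 x - N 1 x" "laplacian v2 x = X 2 x - N 2 x" "laplacian (u 3) x = X 3 x - N 3 x"
    if "x \<in> slab" for x
    unfolding v1_def[abs_def] v2_def[abs_def] N_def X_def using that
    by (simp_all add: laplacian_add laplacian_diff laplacian_cmult smooth_intros s)
  have dq: "pd k q x = pd k p x + Lam * (\<Sum>i\<in>UNIV. b i x * pd k (b i) x) - Ra * pd k \<tau> x" if x: "x \<in> slab" for k x
  proof -
    have 1: "pd k (\<lambda>x. (b i x)\<^sup>2) x = 2 * (b i x * pd k (b i) x)" for i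
      using x by (simp add: power2_eq_square pd_mult s)
    define S where "S x = (\<Sum>i\<in>UNIV. (b i x)\<^sup>2)" for x
    have S: "smooth S" unfolding S_def[abs_def] by (intro smooth_intros s)
    have 2: "pd k S x = 2 * (\<Sum>i\<in>UNIV. b i x * pd k (b i) x)"
      unfolding S_def[abs_def] by (subst pd_sum[OF _ x]) (simp_all add: smooth_intros s 1 sum_distrib_left)
    have "pd k q x = pd k (\<lambda>x. p x + Lam / 2 * S x) x - pd k (\<lambda>x. Ra * \<tau> x) x"
      unfolding q_def[abs_def] S_def[symmetric] by (intro pd_diff x smooth_intros S s)
    also have "pd k (\<lambda>x. p x + Lam / 2 * S x) x = pd k p x + pd k (\<lambda>x. Lam / 2 * S x) x"
      by (intro pd_add x smooth_intros S s)
    also have "pd k (\<lambda>x. Lam / 2 * S x) x = Lam / 2 * pd k S x" by (intro pd_cmult x S)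
    also have "pd k (\<lambda>x. Ra * \<tau> x) x = Ra * pd k \<tau> x" by (intro pd_cmult x s)
    finally show ?thesis by (simp add: 2)
  qed
  have eq1: "Ek * (X 1 x + M 1 x) = - v2 x + pd 1 q x"
    and eq2: "Ek * (X 2 x + M 2 x) = v1 x + pd 2 q x"
    and eq3: "Ek * (X 3 x + M 3 x) = pd 3 q x" if x: "x \<in> slab" for x
    using mom1[OF x] mom2[OF x] mom3[OF x] Ek pd_vprimitive(3)[OF per_smooth_smooth[OF T] x]
    by (simp_all add: dq[OF x] v1_def v2_def X_def M_def A_def \<tau>_def algebra_simps)
  \<comment> \<open>The vertical derivative of the thermal wind is, up to a factor, a horizontal
    derivative of \<open>T\<close>, which vanishes on the lids.\<close>
  have lidv': "pd 3 v1 x = 0" "pd 3 v2 x = 0" if x: "x \<in> lids" for x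
  proof -
    from x have xs: "x \<in> slab" by (auto simp: slab_def bottom_def top_lid_def)
    have "pd 3 (pd i \<tau>) x = pd i T x" for i
    proof -
      have "pd 3 (pd i \<tau>) x = pd i (pd 3 \<tau>) x" by (rule pd_commute[OF _ xs]) (intro s)
      also have "\<dots> = pd i T x" by (rule pd_cong[OF _ xs]) (simp add: \<tau>_def pd_vprimitive s)
      finally show ?thesis .
    qed
    then have "pd 3 v1 x = pd 3 (u 1) x + Ra * pd 2 T x" "pd 3 v2 x = pd 3 (u 2) x - Ra * pd 1 T x"
      unfolding v1_def[abs_def] v2_def[abs_def] using xs by (simp_all add: pd_add pd_diff pd_cmult pd_minus smooth_intros s)
    then show "pd 3 v1 x = 0" "pd 3 v2 x = 0" using x lid lidT by (auto simp: lid_zero_def)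
  qed
  then have lidv: "lid_zero (pd 3 v1)" "lid_zero (pd 3 v2)" by (simp_all add: lid_zero_def)
  \<comment> \<open>Both fields satisfy the Neumann condition, so Green's formula is symmetric in
    them; this is the cancellation of the Coriolis terms.\<close>
  have cor: "cint (\<lambda>x. v1 x * laplacian v2 x) = cint (\<lambda>x. v2 x * laplacian v1 x)"
    using green[OF v(1) v(2)] green[OF v(2) v(1)] lidv by (simp add: lid_zero_def mult.commute)
  \<comment> \<open>Needed for the boundary term of the vertical pressure gradient. The horizontal
    second derivatives vanish with \<open>u 3\<close>; incompressibility turns the vertical one into
    derivatives along the lid of \<open>pd 3 (u 1)\<close> and \<open>pd 3 (u 2)\<close>.\<close>
  have lap3: "laplacian (u 3) x = 0" if x: "x \<in> lids" for x
  proof -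
    have xs: "x \<in> slab" using x by (auto simp: slab_def bottom_def top_lid_def)
    have "pd 1 (pd 1 (u 3)) x = 0" "pd 2 (pd 2 (u 3)) x = 0"
      using lid_zero_pd[OF smooth_pd lid_zero_pd[OF _ lid(1)], of 1 1] lid_zero_pd[OF smooth_pd lid_zero_pd[OF _ lid(1)], of 2 2] x s
      by (auto simp: lid_zero_def)
    moreover have "pd 3 (\<lambda>x. pd 1 (u 1) x + pd 2 (u 2) x + pd 3 (u 3) x) x = pd 3 (\<lambda>x. 0) x"
      by (rule pd_cong[OF _ xs]) (use divu in \<open>simp add: sum_3\<close>)
    moreover have "pd 3 (pd 1 (u 1)) x = 0" "pd 3 (pd 2 (u 2)) x = 0"
      using lid_zero_pd[OF smooth_pd lid(2), of 1] lid_zero_pd[OF smooth_pd lid(3), of 2] x s pd_commute[OF s(1) xs, of 3]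
      by (auto simp: lid_zero_def)
    ultimately show ?thesis using xs by (simp add: laplacian_3 pd_add smooth_intros s)
  qed
  have divv: "pd 1 (laplacian v1) x + pd 2 (laplacian v2) x + pd 3 (laplacian (u 3)) x = 0" if x: "x \<in> slab" for x
  proof -
    have "pd 1 (laplacian v1) x + pd 2 (laplacian v2) x + pd 3 (laplacian (u 3)) x
      = laplacian (\<lambda>x. pd 1 v1 x + pd 2 v2 x + pd 3 (u 3) x) x"
      using x by (simp add: pd_laplacian laplacian_add smooth_intros s)
    also have "\<dots> = laplacian (\<lambda>x. 0) x"
    proof (rule laplacian_cong[OF _ x])
      fix y assume y: "y \<in> slab"
      have "pd 1 v1 y = pd 1 (u 1) y + Ra * pd 1 (pd 2 \<tau>) y" "pd 2 v2 y = pd 2 (u 2) y - Ra * pd 2 (pd 1 \<tau>) y"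
        unfolding v1_def[abs_def] v2_def[abs_def] using y by (simp_all add: pd_add pd_diff pd_minus pd_cmult smooth_intros s)
      then show "pd 1 v1 y + pd 2 v2 y + pd 3 (u 3) y = 0"
        using divu[OF y] pd_commute[of \<tau> y 1 2] y s by (simp add: sum_3)
    qed
    also have "\<dots> = 0" by (rule laplacian_zero[OF x])
    finally show ?thesis .
  qed
  have grad: "cint (\<lambda>x. pd 1 q x * laplacian v1 x) + cint (\<lambda>x. pd 2 q x * laplacian v2 x) + cint (\<lambda>x. pd 3 q x * laplacian (u 3) x) = 0"
  proof -
    have "cint (\<lambda>x. pd 1 q x * laplacian v1 x) = - cint (\<lambda>x. q x * pd 1 (laplacian v1) x)"
      "cint (\<lambda>x. pd 2 q x * laplacian v2 x) = - cint (\<lambda>x. q x * pd 2 (laplacian v2) x)"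
      "cint (\<lambda>x. pd 3 q x * laplacian (u 3) x) = - cint (\<lambda>x. q x * pd 3 (laplacian (u 3)) x)"
      by (rule ibp[OF q]; use lap3 in \<open>auto intro!: per_smooth_laplacian v u\<close>)+
    moreover have "cint (\<lambda>x. q x * pd 1 (laplacian v1) x) + cint (\<lambda>x. q x * pd 2 (laplacian v2) x) + cint (\<lambda>x. q x * pd 3 (laplacian (u 3)) x)
      = cint (\<lambda>x. q x * pd 1 (laplacian v1) x + q x * pd 2 (laplacian v2) x + q x * pd 3 (laplacian (u 3)) x)"
      by (simp add: cint_add smooth_intros smooth_laplacian s)
    moreover have "\<dots> = cint (\<lambda>x. 0)"
      by (rule cint_cong) (metis distrib_left divv mult_zero_right)
    ultimately show ?thesis by simp
  qed
  have orth: "cint (\<lambda>x. \<Sum>k\<in>UNIV. (X k x + M k x) * (X k x - N k x)) = 0"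
  proof -
    have "Ek * cint (\<lambda>x. \<Sum>k\<in>UNIV. (X k x + M k x) * (X k x - N k x))
      = cint (\<lambda>x. Ek * (\<Sum>k\<in>UNIV. (X k x + M k x) * (X k x - N k x)))" by simp
    also have "\<dots> = cint (\<lambda>x. v1 x * laplacian v2 x - v2 x * laplacian v1 x + pd 1 q x * laplacian v1 x + pd 2 q x * laplacian v2 x + pd 3 q x * laplacian (u 3) x)"
    proof (rule cint_cong)
      fix x assume x: "x \<in> slab"
      have "Ek * (\<Sum>k\<in>UNIV. (X k x + M k x) * (X k x - N k x)) =
        (Ek * (X 1 x + M 1 x)) * (X 1 x - N 1 x) + (Ek * (X 2 x + M 2 x)) * (X 2 x - N 2 x) + (Ek * (X 3 x + M 3 x)) * (X 3 x - N 3 x)"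
        by (simp add: sum_3 algebra_simps)
      also have "\<dots> = v1 x * laplacian v2 x - v2 x * laplacian v1 x + pd 1 q x * laplacian v1 x + pd 2 q x * laplacian v2 x + pd 3 q x * laplacian (u 3) x"
        unfolding eq1[OF x] eq2[OF x] eq3[OF x] lapv[OF x] by (simp add: algebra_simps)
      finally show "Ek * (\<Sum>k\<in>UNIV. (X k x + M k x) * (X k x - N k x)) = \<dots>" .
    qed
    also have "\<dots> = cint (\<lambda>x. v1 x * laplacian v2 x) - cint (\<lambda>x. v2 x * laplacian v1 x) +
       (cint (\<lambda>x. pd 1 q x * laplacian v1 x) + cint (\<lambda>x. pd 2 q x * laplacian v2 x) + cint (\<lambda>x. pd 3 q x * laplacian (u 3) x))"
      by (simp add: cint_add cint_diff smooth_intros smooth_laplacian s)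
    finally show ?thesis using cor grad Ek by simp
  qed
  have "(\<Sum>k\<in>UNIV. csq (X k)) = cint (\<lambda>x. \<Sum>k\<in>UNIV. (X k x)\<^sup>2)"
    by (simp add: cint_sum smooth_intros sX)
  also have "\<dots> \<le> cint (\<lambda>x. 2 * (\<Sum>k\<in>UNIV. (X k x + M k x) * (X k x - N k x)) + ((Lam / Ek)\<^sup>2 * (\<Sum>k\<in>UNIV. (A k x)\<^sup>2) +
      Ra\<^sup>2 * ((laplacian (pd 2 \<tau>) x)\<^sup>2 + (laplacian (pd 1 \<tau>) x)\<^sup>2)))"
  proof (rule cint_mono)
    fix x
    \<comment> \<open>The two sides differ by the square of \<open>X - N + M\<close>. Geometrically,
      orthogonality of \<open>X + M\<close> and \<open>X - N\<close> puts \<open>X\<close> on the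
      sphere whose diameter joins \<open>- M\<close> and \<open>N\<close>.\<close>
    have "(X k x)\<^sup>2 \<le> 2 * ((X k x + M k x) * (X k x - N k x)) + ((M k x)\<^sup>2 + (N k x)\<^sup>2)" for k
      using zero_le_power2[of "X k x - N k x + M k x"] by (simp add: power2_eq_square algebra_simps)
    then have "(\<Sum>k\<in>UNIV. (X k x)\<^sup>2) \<le> (\<Sum>k\<in>UNIV. 2 * ((X k x + M k x) * (X k x - N k x)) + ((M k x)\<^sup>2 + (N k x)\<^sup>2))"
      by (rule sum_mono)
    also have "\<dots> = 2 * (\<Sum>k\<in>UNIV. (X k x + M k x) * (X k x - N k x)) + ((\<Sum>k\<in>UNIV. (M k x)\<^sup>2) + (\<Sum>k\<in>UNIV. (N k x)\<^sup>2))"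
      by (simp add: sum.distrib sum_distrib_left)
    also have "(\<Sum>k\<in>UNIV. (M k x)\<^sup>2) = (Lam / Ek)\<^sup>2 * (\<Sum>k\<in>UNIV. (A k x)\<^sup>2)"
      by (simp only: M_def power_mult_distrib sum_distrib_left)
    also have "(\<Sum>k\<in>UNIV. (N k x)\<^sup>2) = Ra\<^sup>2 * ((laplacian (pd 2 \<tau>) x)\<^sup>2 + (laplacian (pd 1 \<tau>) x)\<^sup>2)"
      by (simp add: N_def sum_3 power_mult_distrib distrib_left)
    finally show "(\<Sum>k\<in>UNIV. (X k x)\<^sup>2) \<le> 2 * (\<Sum>k\<in>UNIV. (X k x + M k x) * (X k x - N k x)) + ((Lam / Ek)\<^sup>2 * (\<Sum>k\<in>UNIV. (A k x)\<^sup>2) +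
      Ra\<^sup>2 * ((laplacian (pd 2 \<tau>) x)\<^sup>2 + (laplacian (pd 1 \<tau>) x)\<^sup>2))" .
  qed (intro smooth_intros smooth_laplacian sX sM sN sA s)+
  also have "\<dots> = 2 * cint (\<lambda>x. \<Sum>k\<in>UNIV. (X k x + M k x) * (X k x - N k x)) +
     ((Lam / Ek)\<^sup>2 * cint (\<lambda>x. \<Sum>k\<in>UNIV. (A k x)\<^sup>2) + Ra\<^sup>2 * cint (\<lambda>x. (laplacian (pd 2 \<tau>) x)\<^sup>2 + (laplacian (pd 1 \<tau>) x)\<^sup>2))"
    by (subst cint_add, (intro smooth_intros smooth_laplacian sX sM sN sA s)+, subst cint_add, (intro smooth_intros smooth_laplacian sX sM sN sA s)+) (simp only: cint_cmult)
  finally show ?thesis unfolding orth by (simp add: X_def A_def \<tau>_def)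
qed

end

section \<open>Growth of the enstrophy\<close>

lemma smooth_on_component:
  fixes F :: "'a::euclidean_space \<Rightarrow> real^3"
  shows "boxlike S \<Longrightarrow> smooth_on F S \<Longrightarrow> smooth_on (\<lambda>x. F x $ i) S"
  by (simp add: smooth_on_def Ck_on_linear[OF bounded_linear_vec_nth])

lemma trivial_limit_boxlike:
  assumes "boxlike I" "t \<in> (I :: real set)"
  shows "at t within I \<noteq> bot"
proof -
  have "\<exists>d. 0 < \<bar>d\<bar> \<and> \<bar>d\<bar> < e \<and> t + d \<in> I" if "e > 0" for e
    using assms that unfolding boxlike_def by force
  then have "t islimpt I"
    unfolding islimpt_approachable dist_real_def by (metis add_diff_cancel_left' abs_zero add_cancel_right_right less_irrefl)
  then show ?thesis by (simp add: trivial_limit_within)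
qed

context periodic_cell begin

text \<open>Delivers the time derivative of \<open>B\<close> at \<open>t\<close> as a smooth field
  \<open>c\<close> on the slab. With partial derivatives taken on \<open>I \<times> slab\<close>,
  exchanging time derivative and curl is an instance of the symmetry of mixed derivatives, and their
  continuity justifies differentiation under the integral, also at an endpoint of
  \<open>I\<close>.\<close>

lemma enstrophy_derivative:
  fixes I :: "real set" and B :: "real \<Rightarrow> real^3 \<Rightarrow> real^3"
  assumes I: "is_interval I" "interior I \<noteq> {}" and t: "t \<in> I"
    and B: "smooth_field I B"
  obtains c :: "3 \<Rightarrow> real^3 \<Rightarrow> real" where
    "\<And>j. smooth (c j)"
    "\<And>j x. x \<in> slab \<Longrightarrow> ((\<lambda>s. B s x $ j) has_vector_derivative c j x) (at t within I)"
    "\<And>j x. x \<in> slab \<Longrightarrow> ddt I (\<lambda>s. B s x) t $ j = c j x"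
    "ddt I (enstrophy Lx Ly B) t = cint (\<lambda>x. \<Sum>k\<in>UNIV. curl (B t) x $ k * curl (\<lambda>y. \<chi> j. c j y) x $ k)"
proof -
  define S where "S = I \<times> slab"
  have bI: "boxlike I" by (rule boxlike_interval[OF I])
  have bS: "boxlike S" unfolding S_def by (intro boxlike_Times bI boxlike_slab)
  have lim: "at t within I \<noteq> bot" by (rule trivial_limit_boxlike[OF bI t])
  have BS: "smooth_on (\<lambda>p. B (fst p) (snd p)) S" using B by (simp add: smooth_field_def S_def split_def)
  define F where "F j p = B (fst p) (snd p) $ j" for j :: 3 and p :: "real \<times> (real^3)"
  have F: "smooth_on (F j) S" for j unfolding F_def[abs_def] by (rule smooth_on_component[OF bS BS])
  define E where "E i j p = frechet_derivative (F j) (at p within S) (0, axis i 1)" for i j p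
  define D where "D j p = frechet_derivative (F j) (at p within S) (1, 0)" for j p
  define G where "G i j p = frechet_derivative (D j) (at p within S) (0, axis i 1)" for i j p
  have basis: "(0, axis i 1) \<in> (Basis :: (real \<times> (real^3)) set)" "(1, 0) \<in> (Basis :: (real \<times> (real^3)) set)" for i
    by (auto simp: Basis_prod_def)
  have E: "smooth_on (E i j) S" and D: "smooth_on (D j) S" for i j
    unfolding E_def[abs_def] D_def[abs_def] by (intro smooth_on_derivative F basis)+
  have G: "smooth_on (G i j) S" for i j
    unfolding G_def[abs_def] by (intro smooth_on_derivative D basis)
  have pdE: "pd i (\<lambda>x. B s x $ j) x = E i j (s, x)" if "s \<in> I" "x \<in> slab" for s x i j
    using pd_slice[of "F j" I s x i] F that by (simp add: F_def E_def S_def)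
  have pdG: "pd i (\<lambda>x. D j (s, x)) x = G i j (s, x)" if "s \<in> I" "x \<in> slab" for s x i j
    using pd_slice[of "D j" I s x i] D that by (simp add: G_def S_def)
  have dE: "((\<lambda>s. E i j (s, x)) has_real_derivative G i j (s, x)) (at s within I)" if "s \<in> I" "x \<in> slab" for s x i j
  proof -
    have "frechet_derivative (E i j) (at (s, x) within S) (1, 0) = G i j (s, x)"
      unfolding G_def E_def[abs_def] D_def[abs_def]
      by (rule mixed_derivatives_commute[OF F bS]) (use that in \<open>auto simp: S_def basis\<close>)
    then show ?thesis
      using time_derivative[of "E i j" I s x] E that by (simp add: S_def has_real_derivative_iff_has_vector_derivative)
  qed
  define J where "J k p = (if k = 1 then E 2 3 p - E 3 2 p else if k = 2 then E 3 1 p - E 1 3 p else E 1 2 p - E 2 1 p)" for k :: 3 and p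
  define J' where "J' k p = (if k = 1 then G 2 3 p - G 3 2 p else if k = 2 then G 3 1 p - G 1 3 p else G 1 2 p - G 2 1 p)" for k :: 3 and p
  have curlB: "curl (B s) x $ k = J k (s, x)" if "s \<in> I" "x \<in> slab" for s x k
    using exhaust_3[of k] that by (auto simp: curl_nth J_def pdE)
  have curlD: "curl (\<lambda>y. \<chi> j. D j (s, y)) x $ k = J' k (s, x)" if "s \<in> I" "x \<in> slab" for s x k
    using exhaust_3[of k] that by (auto simp: curl_nth J'_def pdG)
  have dJ: "((\<lambda>s. J k (s, x)) has_real_derivative J' k (s, x)) (at s within I)" if "s \<in> I" "x \<in> slab" for s x k
    using exhaust_3[of k] dE[OF that] by (auto simp: J_def J'_def intro!: derivative_intros)
  have cJ: "continuous_on S (J k)" "continuous_on S (J' k)" for k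
    using exhaust_3[of k] smooth_on_continuous[OF E] smooth_on_continuous[OF G]
    by (auto simp: J_def[abs_def] J'_def[abs_def] intro!: continuous_intros)
  have Sc: "(s, x) \<in> S" if "s \<in> I" "x \<in> cell Lx Ly" for s x
    using that cell_subset_slab by (auto simp: S_def)
  have "((\<lambda>s. integral (cbox 0 (vector [Lx, Ly, 1])) (\<lambda>x. \<Sum>k\<in>UNIV. (J k (s, x))\<^sup>2)) has_real_derivative
     integral (cbox 0 (vector [Lx, Ly, 1])) (\<lambda>x. \<Sum>k\<in>UNIV. 2 * (J k (t, x) * J' k (t, x)))) (at t within I)"
  proof (rule leibniz_rule_field_derivative[where U=I])
    fix s and x :: "real^3" assume s: "s \<in> I" and x: "x \<in> cbox 0 (vector [Lx, Ly, 1])"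
    then have xs: "x \<in> slab" using cell_subset_slab cell_cbox by auto
    show "((\<lambda>s. \<Sum>k\<in>UNIV. (J k (s, x))\<^sup>2) has_real_derivative (\<Sum>k\<in>UNIV. 2 * (J k (s, x) * J' k (s, x)))) (at s within I)"
      by (rule DERIV_sum) (auto intro!: derivative_eq_intros dJ s xs)
  next
    fix s assume s: "s \<in> I"
    show "(\<lambda>x. \<Sum>k\<in>UNIV. (J k (s, x))\<^sup>2) integrable_on cbox 0 (vector [Lx, Ly, 1])"
      unfolding cell_cbox[symmetric]
      by (subst cell_cbox, intro integrable_continuous continuous_intros continuous_on_compose2[OF cJ(1)])
        (use Sc s cell_cbox in auto)
  next
    show "continuous_on (I \<times> cbox 0 (vector [Lx, Ly, 1])) (\<lambda>(s, x). \<Sum>k\<in>UNIV. 2 * (J k (s, x) * J' k (s, x)))"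
      unfolding cell_cbox[symmetric] split_def
      by (intro continuous_intros continuous_on_compose2[OF cJ(1)] continuous_on_compose2[OF cJ(2)]) (use Sc in auto)
  qed (use t I is_interval_convex in auto)
  then have L: "((\<lambda>s. 1 / 2 * cint (\<lambda>x. \<Sum>k\<in>UNIV. (J k (s, x))\<^sup>2)) has_real_derivative
     1 / 2 * cint (\<lambda>x. \<Sum>k\<in>UNIV. 2 * (J k (t, x) * J' k (t, x)))) (at t within I)"
    unfolding cell_cbox[symmetric] by (rule DERIV_cmult)
  have ens: "enstrophy Lx Ly B s = 1 / 2 * cint (\<lambda>x. \<Sum>k\<in>UNIV. (J k (s, x))\<^sup>2)" if "s \<in> I" for s
  proof -
    have "cint (\<lambda>x. (norm (curl (B s) x))\<^sup>2) = cint (\<lambda>x. \<Sum>k\<in>UNIV. (J k (s, x))\<^sup>2)"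
      by (rule cint_cong) (simp only: power2_norm_eq_inner inner_vec_def inner_real_def, simp add: curlB that power2_eq_square)
    then show ?thesis by (simp add: enstrophy_def)
  qed
  have "(enstrophy Lx Ly B has_real_derivative 1 / 2 * cint (\<lambda>x. \<Sum>k\<in>UNIV. 2 * (J k (t, x) * J' k (t, x)))) (at t within I)"
    using has_field_derivative_transform_within[OF L, of 1 "enstrophy Lx Ly B"] ens t by simp
  then have "ddt I (enstrophy Lx Ly B) t = 1 / 2 * cint (\<lambda>x. \<Sum>k\<in>UNIV. 2 * (J k (t, x) * J' k (t, x)))"
    unfolding ddt_def using lim by (intro vector_derivative_within) (auto simp: has_real_derivative_iff_has_vector_derivative)
  also have "\<dots> = cint (\<lambda>x. \<Sum>k\<in>UNIV. J k (t, x) * J' k (t, x))"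
    by (simp add: sum_distrib_left[symmetric])
  also have "\<dots> = cint (\<lambda>x. \<Sum>k\<in>UNIV. curl (B t) x $ k * curl (\<lambda>y. \<chi> j. D j (t, y)) x $ k)"
    by (rule cint_cong) (simp add: curlB[OF t] curlD[OF t])
  finally have main: "ddt I (enstrophy Lx Ly B) t = cint (\<lambda>x. \<Sum>k\<in>UNIV. curl (B t) x $ k * curl (\<lambda>y. \<chi> j. D j (t, y)) x $ k)" .
  have dB: "((\<lambda>s. B s x $ j) has_vector_derivative D j (t, x)) (at t within I)" if "x \<in> slab" for x j
    using time_derivative[of "F j" I t x] F t that by (simp add: S_def D_def F_def)
  \<comment> \<open>\<open>ddt\<close> denotes some derivative of the vector field; uniqueness at
    the limit point \<open>t\<close> identifies its components with those found above.\<close>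
  have "ddt I (\<lambda>s. B s x) t $ j = D j (t, x)" if x: "x \<in> slab" for x j
  proof -
    have "((\<lambda>s. B s x) has_vector_derivative ddt I (\<lambda>s. B s x) t) (at t within I)"
      using time_derivative[of "\<lambda>p. B (fst p) (snd p)" I t x] BS t x lim
      by (simp add: S_def ddt_def vector_derivative_within)
    then have "((\<lambda>s. B s x $ j) has_vector_derivative ddt I (\<lambda>s. B s x) t $ j) (at t within I)"
      by (rule bounded_linear.has_vector_derivative[OF bounded_linear_vec_nth])
    then show ?thesis using dB[OF x] vector_derivative_unique_within[OF lim] by blast
  qed
  then show thesis
    by (rule that[of "\<lambda>j x. D j (t, x)", rotated 2]) (use main dB smooth_on_slice[of "D _" I t] D t in \<open>auto simp: S_def\<close>)
qed

text \<open>In the boundary term of a curl only the tangential components of the differentiated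
  field appear, hence lid conditions on \<open>c 1\<close> and \<open>c 2\<close> alone.\<close>

lemma curl_by_parts:
  assumes a: "\<And>k. per_smooth (a k)" and c: "\<And>k. per_smooth (c k)" and lid: "lid_zero (c 1)" "lid_zero (c 2)"
  shows "cint (\<lambda>x. \<Sum>k\<in>UNIV. a k x * curl (\<lambda>y. \<chi> j. c j y) x $ k)
    = cint (\<lambda>x. \<Sum>k\<in>UNIV. curl (\<lambda>y. \<chi> j. a j y) x $ k * c k x)"
proof -
  have s: "smooth (a k)" "smooth (c k)" for k using a c per_smooth_smooth by auto
  have p: "cint (\<lambda>x. a k x * pd i (c j) x) = - cint (\<lambda>x. pd i (a k) x * c j x)" if "i = 3 \<Longrightarrow> lid_zero (c j)" for i j k
    using ibp[OF a[of k] c[of j], of i] that by (force simp: lid_zero_def)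
  have "cint (\<lambda>x. \<Sum>k\<in>UNIV. a k x * curl (\<lambda>y. \<chi> j. c j y) x $ k) =
     cint (\<lambda>x. a 1 x * pd 2 (c 3) x) - cint (\<lambda>x. a 1 x * pd 3 (c 2) x) + (cint (\<lambda>x. a 2 x * pd 3 (c 1) x) - cint (\<lambda>x. a 2 x * pd 1 (c 3) x))
     + (cint (\<lambda>x. a 3 x * pd 1 (c 2) x) - cint (\<lambda>x. a 3 x * pd 2 (c 1) x))"
    by (simp add: sum_3 curl_nth right_diff_distrib cint_add cint_diff smooth_intros s)
  also have "\<dots> = cint (\<lambda>x. pd 3 (a 1) x * c 2 x) - cint (\<lambda>x. pd 2 (a 1) x * c 3 x) + (cint (\<lambda>x. pd 1 (a 2) x * c 3 x) - cint (\<lambda>x. pd 3 (a 2) x * c 1 x))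
     + (cint (\<lambda>x. pd 2 (a 3) x * c 1 x) - cint (\<lambda>x. pd 1 (a 3) x * c 2 x))"
    using lid p[of 2 3 1] p[of 3 2 1] p[of 3 1 2] p[of 1 3 2] p[of 1 2 3] p[of 2 1 3] by simp
  also have "\<dots> = cint (\<lambda>x. \<Sum>k\<in>UNIV. curl (\<lambda>y. \<chi> j. a j y) x $ k * c k x)"
    by (simp add: sum_3 curl_nth left_diff_distrib cint_add cint_diff smooth_intros s)
  finally show ?thesis .
qed

text \<open>Both advection terms have norm at most \<open>s\<close> times that of the Laplacian of
  \<open>b\<close>. Young with weight \<open>s\<close> makes each of them cost \<open>s\<close>
  times the square of that norm, hence the factor \<open>2 * s\<close>. The common factor stays on
  both sides, to be cancelled once it is known to be positive.\<close>

lemma growth_bound: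
  fixes u b :: "3 \<Rightarrow> real^3 \<Rightarrow> real" and Rm s :: real
  assumes u: "\<And>i. compatible (u i)" and b: "\<And>i. compatible (b i)" and s: "0 < s"
    and growth: "0 \<le> cint (\<lambda>x. \<Sum>k\<in>UNIV. - laplacian (b k) x *
      (adv b (u k) x - adv u (b k) x + 1 / Rm * laplacian (b k) x))"
    and large: "slice_const * column_const * (\<Sum>k\<in>UNIV. csq (laplacian (u k))) \<le> s\<^sup>2"
  shows "1 / Rm * (\<Sum>k\<in>UNIV. csq (laplacian (b k))) \<le> 2 * s * (\<Sum>k\<in>UNIV. csq (laplacian (b k)))"
proof -
  have smooth: "smooth (u i)" "smooth (b i)" for i using u b compatible_per_smooth per_smooth_smooth by auto
  let ?U = "\<Sum>k\<in>UNIV. csq (laplacian (u k))" and ?B = "\<Sum>k\<in>UNIV. csq (laplacian (b k))"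
  define A where "A k x = adv b (u k) x" for k x
  define D where "D k x = adv u (b k) x" for k x
  have sA: "smooth (A k)" "smooth (D k)" for k unfolding A_def[abs_def] D_def[abs_def] by (intro smooth_intros smooth)+
  have B0: "0 \<le> ?B" by (intro sum_nonneg cint_nonneg smooth_intros smooth_laplacian smooth) auto
  have A2: "cint (\<lambda>x. \<Sum>k\<in>UNIV. (A k x)\<^sup>2) \<le> s\<^sup>2 * ?B"
  proof -
    have "cint (\<lambda>x. \<Sum>k\<in>UNIV. (A k x)\<^sup>2) \<le> slice_const * column_const * (?B * ?U)" unfolding A_def by (rule advection_estimate[OF b u])
    also have "\<dots> = (slice_const * column_const * ?U) * ?B" by (simp only: mult_ac)
    also have "\<dots> \<le> s\<^sup>2 * ?B" by (rule mult_right_mono[OF large B0])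
    finally show ?thesis .
  qed
  have D2: "cint (\<lambda>x. \<Sum>k\<in>UNIV. (D k x)\<^sup>2) \<le> s\<^sup>2 * ?B"
  proof -
    have "cint (\<lambda>x. \<Sum>k\<in>UNIV. (D k x)\<^sup>2) \<le> slice_const * column_const * (?U * ?B)" unfolding D_def by (rule advection_estimate[OF u b])
    also have "\<dots> = (slice_const * column_const * ?U) * ?B" by (simp only: mult_ac)
    also have "\<dots> \<le> s\<^sup>2 * ?B" by (rule mult_right_mono[OF large B0])
    finally show ?thesis .
  qed
  have "0 \<le> cint (\<lambda>x. \<Sum>k\<in>UNIV. - laplacian (b k) x * (A k x - D k x + 1 / Rm * laplacian (b k) x))"
    using growth by (simp add: A_def D_def)
  also have "\<dots> \<le> cint (\<lambda>x. (s - 1 / Rm) * (\<Sum>k\<in>UNIV. (laplacian (b k) x)\<^sup>2) + 1 / (2 * s) * ((\<Sum>k\<in>UNIV. (A k x)\<^sup>2) + (\<Sum>k\<in>UNIV. (D k x)\<^sup>2)))"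
  proof (rule cint_mono)
    fix x
    have "- laplacian (b k) x * (A k x - D k x + 1 / Rm * laplacian (b k) x)
      \<le> (s - 1 / Rm) * (laplacian (b k) x)\<^sup>2 + 1 / (2 * s) * ((A k x)\<^sup>2 + (D k x)\<^sup>2)" for k
    proof -
      have "- (laplacian (b k) x * A k x) \<le> s / 2 * (laplacian (b k) x)\<^sup>2 + 1 / (2 * s) * (A k x)\<^sup>2"
        "laplacian (b k) x * D k x \<le> s / 2 * (laplacian (b k) x)\<^sup>2 + 1 / (2 * s) * (D k x)\<^sup>2"
        using abs_mult_le_weighted[OF s, of "laplacian (b k) x"] by (simp_all add: abs_le_iff)
      moreover have "- laplacian (b k) x * (A k x - D k x + 1 / Rm * laplacian (b k) x) =
        - (laplacian (b k) x * A k x) + laplacian (b k) x * D k x - 1 / Rm * (laplacian (b k) x)\<^sup>2"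
        by (simp add: algebra_simps power2_eq_square)
      moreover have "(s - 1 / Rm) * (laplacian (b k) x)\<^sup>2 + 1 / (2 * s) * ((A k x)\<^sup>2 + (D k x)\<^sup>2) =
        (s / 2 * (laplacian (b k) x)\<^sup>2 + 1 / (2 * s) * (A k x)\<^sup>2) + (s / 2 * (laplacian (b k) x)\<^sup>2 + 1 / (2 * s) * (D k x)\<^sup>2)
        - 1 / Rm * (laplacian (b k) x)\<^sup>2"
        by (simp only: left_diff_distrib distrib_left)
      ultimately show ?thesis by linarith
    qed
    then have "(\<Sum>k\<in>UNIV. - laplacian (b k) x * (A k x - D k x + 1 / Rm * laplacian (b k) x))
      \<le> (\<Sum>k\<in>UNIV. (s - 1 / Rm) * (laplacian (b k) x)\<^sup>2 + 1 / (2 * s) * ((A k x)\<^sup>2 + (D k x)\<^sup>2))"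
      by (rule sum_mono)
    then show "(\<Sum>k\<in>UNIV. - laplacian (b k) x * (A k x - D k x + 1 / Rm * laplacian (b k) x))
      \<le> (s - 1 / Rm) * (\<Sum>k\<in>UNIV. (laplacian (b k) x)\<^sup>2) + 1 / (2 * s) * ((\<Sum>k\<in>UNIV. (A k x)\<^sup>2) + (\<Sum>k\<in>UNIV. (D k x)\<^sup>2))"
      by (simp only: sum.distrib sum_distrib_left distrib_left)
  qed (intro smooth_intros smooth_laplacian sA smooth)+
  also have "\<dots> = (s - 1 / Rm) * cint (\<lambda>x. \<Sum>k\<in>UNIV. (laplacian (b k) x)\<^sup>2) + 1 / (2 * s) * (cint (\<lambda>x. \<Sum>k\<in>UNIV. (A k x)\<^sup>2) + cint (\<lambda>x. \<Sum>k\<in>UNIV. (D k x)\<^sup>2))"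
    by (subst cint_add, (intro smooth_intros smooth_laplacian sA smooth)+, simp only: cint_cmult, subst cint_add, (intro smooth_intros sA)+) (rule refl)
  also have "cint (\<lambda>x. \<Sum>k\<in>UNIV. (laplacian (b k) x)\<^sup>2) = ?B"
    by (intro cint_sum smooth_intros smooth_laplacian smooth) simp
  also have "1 / (2 * s) * (cint (\<lambda>x. \<Sum>k\<in>UNIV. (A k x)\<^sup>2) + cint (\<lambda>x. \<Sum>k\<in>UNIV. (D k x)\<^sup>2)) \<le> 1 / (2 * s) * (s\<^sup>2 * ?B + s\<^sup>2 * ?B)"
    using A2 D2 s by (intro mult_left_mono add_mono) auto
  also have "\<dots> = s * ?B" using s by (simp add: power2_eq_square)
  finally show ?thesis by (simp add: algebra_simps)
qed

end

section \<open>The thermal forcing\<close>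

lemma vprimitive_add: "smooth f \<Longrightarrow> smooth g \<Longrightarrow> x \<in> slab \<Longrightarrow> vprimitive (\<lambda>x. f x + g x) x = vprimitive f x + vprimitive g x"
  unfolding vprimitive_def
  by (intro integral_add integrable_continuous_interval smooth_continuous_pt continuous_intros) (auto simp: slab_def)

lemma vprimitive_minus: "vprimitive (\<lambda>x. - f x) x = - vprimitive f x"
  by (simp add: vprimitive_def)

text \<open>Identifies the field in the claim, up to the factor \<open>Ra\<close>, with the
  Laplacian of the thermal wind. Primitives commute with horizontal derivatives, and the outer curl
  differentiates the horizontal components vertically, which undoes the primitive; so no values of
  \<open>T\<close> on the lower lid enter.\<close>

lemma curl_vprim_thermal:
  assumes T: "smooth T" and x: "x \<in> slab"
  shows "curl (vprim (curl (curl (\<lambda>x. T x *\<^sub>R ez)))) x $ 1 = - laplacian (pd 2 (vprimitive T)) x"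
    and "curl (vprim (curl (curl (\<lambda>x. T x *\<^sub>R ez)))) x $ 2 = laplacian (pd 1 (vprimitive T)) x"
    and "curl (vprim (curl (curl (\<lambda>x. T x *\<^sub>R ez)))) x $ 3 = 0"
proof -
  define Z where "Z = (\<lambda>x. T x *\<^sub>R ez)"
  have Z: "Z y $ 1 = 0" "Z y $ 2 = 0" "Z y $ 3 = T y" for y by (simp_all add: Z_def ez_def axis_def)
  have sZ: "smooth (\<lambda>y. Z y $ i)" for i using exhaust_3[of i] T smooth_const by (auto simp: Z)
  have c: "curl Z y $ 1 = pd 2 T y" "curl Z y $ 2 = - pd 1 T y" "curl Z y $ 3 = 0" if "y \<in> slab" for y
    using that by (simp_all add: curl_nth Z)
  have cc: "curl (curl Z) y $ 1 = pd 3 (pd 1 T) y" "curl (curl Z) y $ 2 = pd 3 (pd 2 T) y"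
    "curl (curl Z) y $ 3 = - (pd 1 (pd 1 T) y + pd 2 (pd 2 T) y)" if y: "y \<in> slab" for y
  proof -
    have "pd i (\<lambda>y. curl Z y $ 1) y = pd i (pd 2 T) y" "pd i (\<lambda>y. curl Z y $ 3) y = 0"
      "pd i (\<lambda>y. curl Z y $ 2) y = - pd i (pd 1 T) y" for i
      using pd_cong[of "\<lambda>y. curl Z y $ 1" "pd 2 T" y i] pd_cong[of "\<lambda>y. curl Z y $ 2" "\<lambda>y. - pd 1 T y" y i]
        pd_cong[of "\<lambda>y. curl Z y $ 3" "\<lambda>y. 0" y i] c y by (simp_all add: pd_minus smooth_intros T)
    then show "curl (curl Z) y $ 1 = pd 3 (pd 1 T) y" "curl (curl Z) y $ 2 = pd 3 (pd 2 T) y"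
      "curl (curl Z) y $ 3 = - (pd 1 (pd 1 T) y + pd 2 (pd 2 T) y)"
      by (simp_all add: curl_nth[of "curl Z"])
  qed
  have cont: "continuous_on slab (curl (curl Z))"
  proof -
    have "continuous_on slab (\<lambda>y. \<chi> k. curl (curl Z) y $ k)"
      by (intro continuous_on_vec_lambda smooth_on_continuous smooth_curl sZ)
    then show ?thesis by simp
  qed
  define W where "W = vprim (curl (curl Z))"
  define h where "h y = - (pd 1 (pd 1 T) y + pd 2 (pd 2 T) y)" for y
  have sh: "smooth h" unfolding h_def[abs_def] by (intro smooth_intros T)
  have W: "W y $ 1 = vprimitive (pd 3 (pd 1 T)) y" "W y $ 2 = vprimitive (pd 3 (pd 2 T)) y" "W y $ 3 = vprimitive h y" if y: "y \<in> slab" for y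
    unfolding W_def vprim_component[OF cont y] using cc y by (auto intro!: vprimitive_cong simp: h_def)
  have dW: "pd i (\<lambda>y. W y $ 1) x = pd i (vprimitive (pd 3 (pd 1 T))) x" "pd i (\<lambda>y. W y $ 2) x = pd i (vprimitive (pd 3 (pd 2 T))) x"
    "pd i (\<lambda>y. W y $ 3) x = pd i (vprimitive h) x" for i
    by (rule pd_cong[OF _ x]; simp add: W)+
  have s: "smooth (pd i T)" "smooth (pd i (pd j T))" "smooth (pd i (pd j (pd k T)))" for i j k by (intro smooth_intros T)+
  have v1: "pd 1 (vprimitive f) y = vprimitive (pd 1 f) y" "pd 2 (vprimitive f) y = vprimitive (pd 2 f) y" "pd 3 (vprimitive f) y = f y" if "smooth f" "y \<in> slab" for f y
    using pd_vprimitive[OF that] .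
  have vv: "pd i (vprimitive f) y = vprimitive (pd i f) y" if "smooth f" "y \<in> slab" "i \<noteq> 3" for f y i
    using v1[OF that(1,2)] that(3) exhaust_3[of i] by auto
  have vvv: "pd k (pd j (pd i (vprimitive f))) x = vprimitive (pd k (pd j (pd i f))) x" if f: "smooth f" and "i \<noteq> 3" "j \<noteq> 3" "k \<noteq> 3" for f i j k
  proof -
    have 1: "pd j (pd i (vprimitive f)) y = vprimitive (pd j (pd i f)) y" if y: "y \<in> slab" for y
      using pd_cong[of "pd i (vprimitive f)" "vprimitive (pd i f)" y j] vv[OF f _ \<open>i \<noteq> 3\<close>] vv[OF smooth_pd[OF f] y \<open>j \<noteq> 3\<close>, of i] y by simp
    show ?thesis
      using pd_cong[of "pd j (pd i (vprimitive f))" "vprimitive (pd j (pd i f))" x k] 1 vv[OF smooth_pd[OF smooth_pd[OF f]] x \<open>k \<noteq> 3\<close>, of j i] x by simp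
  qed
  have d3: "pd 3 (pd 3 (pd i (vprimitive T))) x = pd 3 (pd i T) x" if "i \<noteq> 3" for i
  proof -
    have "pd 3 (pd i (vprimitive T)) y = pd i T y" if y: "y \<in> slab" for y
      using pd_commute[OF smooth_vprimitive[OF T] y, of 3 i] pd_cong[of "pd 3 (vprimitive T)" T y i] v1(3)[OF T] y by simp
    then show ?thesis by (rule pd_cong[OF _ x])
  qed
  have lap: "laplacian (pd i (vprimitive T)) x = - vprimitive (pd i h) x + pd 3 (pd i T) x" if i: "i \<noteq> 3" for i
  proof -
    have "pd i h y = - (pd 1 (pd 1 (pd i T)) y + pd 2 (pd 2 (pd i T)) y)" if y: "y \<in> slab" for y
    proof -
      have "pd i (pd j (pd j T)) y = pd j (pd j (pd i T)) y" for j
      proof -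
        have "pd i (pd j (pd j T)) y = pd j (pd i (pd j T)) y" by (rule pd_commute[OF smooth_pd[OF T] y])
        also have "\<dots> = pd j (pd j (pd i T)) y" by (rule pd_cong[OF pd_commute[OF T] y])
        finally show ?thesis .
      qed
      then show ?thesis unfolding h_def[abs_def] using y by (simp add: pd_minus pd_add pd_diff smooth_intros T)
    qed
    then have "vprimitive (pd i h) x = - (vprimitive (pd 1 (pd 1 (pd i T))) x + vprimitive (pd 2 (pd 2 (pd i T))) x)"
      using vprimitive_cong[of "pd i h" "\<lambda>y. - (pd 1 (pd 1 (pd i T)) y + pd 2 (pd 2 (pd i T)) y)" x] x
      by (simp only: vprimitive_minus vprimitive_add s)
    then show ?thesis using i by (simp add: laplacian_3 vvv[OF T] d3)
  qed
  have "pd 1 (vprimitive (pd 3 (pd 2 T))) x = pd 2 (vprimitive (pd 3 (pd 1 T))) x"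
  proof -
    have "pd 1 (pd 3 (pd 2 T)) y = pd 2 (pd 3 (pd 1 T)) y" if y: "y \<in> slab" for y
    proof -
      have "pd 1 (pd 3 (pd 2 T)) y = pd 3 (pd 1 (pd 2 T)) y" by (rule pd_commute[OF s(1) y])
      also have "\<dots> = pd 3 (pd 2 (pd 1 T)) y" by (rule pd_cong[OF pd_commute[OF T] y])
      also have "\<dots> = pd 2 (pd 3 (pd 1 T)) y" by (rule pd_commute[OF s(1) y])
      finally show ?thesis .
    qed
    then have "vprimitive (pd 1 (pd 3 (pd 2 T))) x = vprimitive (pd 2 (pd 3 (pd 1 T))) x" by (rule vprimitive_cong[OF _ x])
    then show ?thesis by (simp add: v1 s x)
  qed
  then show "curl (vprim (curl (curl (\<lambda>x. T x *\<^sub>R ez)))) x $ 1 = - laplacian (pd 2 (vprimitive T)) x"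
    "curl (vprim (curl (curl (\<lambda>x. T x *\<^sub>R ez)))) x $ 2 = laplacian (pd 1 (vprimitive T)) x"
    "curl (vprim (curl (curl (\<lambda>x. T x *\<^sub>R ez)))) x $ 3 = 0"
    unfolding Z_def[symmetric] W_def[symmetric] curl_nth dW by (simp_all add: lap v1 s sh x)
qed

subsection \<open>The constants\<close>

text \<open>Here \<open>w\<close>, \<open>x\<close>, \<open>y\<close> stand for \<open>C\<^sub>P\<close>, \<open>C\<^sub>P / L\<^sub>x\<close>, \<open>C\<^sub>P / L\<^sub>y\<close>, which are at least
  \<open>1 / \<pi>\<close>, \<open>1 / (2 \<pi>)\<close>, \<open>1 / (2 \<pi>)\<close>; \<open>2/5 (2 w + x + y)\<close> is a lower bound for
  \<open>sqrt (w\<^sup>2 + x\<^sup>2 + y\<^sup>2)\<close>, and \<open>99/100\<close> one for the numerical factor in \<open>9/16 C\<^sub>S\<^sup>3\<close>.\<close>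

lemma constant_polynomial:
  fixes w x y :: real
  assumes "3/10 \<le> w" "3/20 \<le> x" "3/20 \<le> y"
  shows "((x + 1/2) * (y + 1/2) + (x + 1/2) / 2 + 1/8) * (w + 2) \<le> 99/100 * (1 + 2/5 * (2 * w + x + y))^3"
proof -
  define p q r where "p = 10 * w - 3" and "q = 20 * x - 3" and "r = 20 * y - 3"
  have w: "w = (p + 3) / 10" "x = (q + 3) / 20" "y = (r + 3) / 20" by (simp_all add: p_def q_def r_def)
  have n: "0 \<le> p" "0 \<le> q" "0 \<le> r" using assms by (simp_all add: p_def q_def r_def)
  \<comment> \<open>Some coefficients of the shifted difference are negative, those of
    \<open>q\<close> and \<open>q * r\<close> among them. The squares of \<open>q - r\<close> and
    \<open>q - 32\<close> absorb these, and every remaining term is visibly nonnegative.\<close>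
  have "99 * (68 + 4 * p + q + r)^3 - 3125 * ((q * r + 23 * q + 13 * r + 349) * (p + 23)) =
    15742 * (q - r)\<^sup>2 + q * r + 4454 * (q - 32)\<^sup>2 + 4454 * r\<^sup>2 + 1483497 + 5259 * q + 438953 * r
    + 99 * r^3 + 297 * (q * r\<^sup>2) + 297 * (q\<^sup>2 * r) + 99 * q^3 + 4402687 * p + 120943 * (p * r) + 89693 * (p * q)
    + p * (375 * (q - r)\<^sup>2 + q * r + 813 * q\<^sup>2 + 813 * r\<^sup>2) + 323136 * p\<^sup>2 + 4752 * (p\<^sup>2 * r) + 4752 * (p\<^sup>2 * q) + 6336 * p^3"
    by algebra
  also have "\<dots> \<ge> 0" using n by (intro add_nonneg_nonneg mult_nonneg_nonneg) auto
  finally have "3125 * ((q * r + 23 * q + 13 * r + 349) * (p + 23)) \<le> 99 * (68 + 4 * p + q + r)^3" by simp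
  moreover have "12500000 * (((x + 1/2) * (y + 1/2) + (x + 1/2) / 2 + 1/8) * (w + 2)) = 3125 * ((q * r + 23 * q + 13 * r + 349) * (p + 23))"
    unfolding w by (simp add: field_simps)
  moreover have "12500000 * (99/100 * (1 + 2/5 * (2 * w + x + y))^3) = 99 * (68 + 4 * p + q + r)^3"
  proof -
    have "1 + 2/5 * (2 * w + x + y) = (68 + 4 * p + q + r) / 50" unfolding w by (simp add: field_simps)
    then show ?thesis by (simp only: power_divide) simp
  qed
  ultimately show ?thesis by linarith
qed

context periodic_cell begin

lemma C_S_cube: "(C_S Lx Ly)^3 = 64 * sqrt 2 / (3 * sqrt 3 * pi\<^sup>2) * (1 + sqrt (1 + 1 / Lx\<^sup>2 + 1 / Ly\<^sup>2) / lam)^3"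
proof -
  have a: "(2 powr (2/3))^3 = (4::real)" "(pi powr (2/3))^3 = pi\<^sup>2"
    by (simp_all add: powr_power)
  have "sqrt 3 ^ 3 = 3 * sqrt 3" "sqrt 2 ^ 3 = 2 * sqrt 2" by (simp_all add: power3_eq_cube)
  then show ?thesis
    by (simp add: C_S_def C_3_def power_mult_distrib power_divide a)
qed

lemma C_S_pos: "0 < C_S Lx Ly"
proof -
  have "0 < C_3" by (simp add: C_3_def)
  moreover have "0 < 1 + sqrt (1 + 1 / Lx\<^sup>2 + 1 / Ly\<^sup>2) / lam"
    using lam_pos by (intro add_pos_nonneg divide_nonneg_pos) auto
  ultimately show ?thesis by (simp add: C_S_def)
qed

lemma C_m_sq: "(C_m Lx Ly)\<^sup>2 = 9 * (C_S Lx Ly)^3 * CP"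
proof -
  have "(C_S Lx Ly powr (3/2))\<^sup>2 = (C_S Lx Ly)^3" "(CP powr (1/2))\<^sup>2 = CP"
    using C_S_pos CP_pos by (simp_all add: powr_power)
  then show ?thesis by (simp add: C_m_def power_mult_distrib)
qed

text \<open>Both sides carry the factor \<open>CP^3\<close>. Since the weights are
  \<open>lam = 1 / CP\<close>, what remains on the left is a polynomial in \<open>CP\<close>,
  \<open>CP / Lx\<close>, \<open>CP / Ly\<close>, to be compared with the cube inside
  \<open>C_S^3\<close>.\<close>

lemma constant_bound: "slice_const * column_const \<le> (C_m Lx Ly)\<^sup>2 * CP\<^sup>2 / 16"
proof -
  define w where "w = CP"
  define x where "x = CP / Lx"
  define y where "y = CP / Ly"
  have w: "0 < w" and lam: "lam = 1 / w" using CP_pos lam_pos by (auto simp: w_def C_P_def)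
  have coeffs: "coeff_x = (x + 1/2) / w" "coeff_y = (y + 1/2) / w" "coeff_d = w / 2"
    using w Lx Ly by (simp_all add: coeff_x_def coeff_y_def coeff_d_def lam x_def y_def field_simps flip: w_def)
  have mx: "max coeff_x coeff_y = (max x y + 1/2) / w"
    using w by (simp add: coeffs max_def divide_le_cancel)
  have C12: "slice_const * column_const = w^3 * (((x + 1/2) * (y + 1/2) + (max x y + 1/2) / 2 + 1/8) * (w + 2))"
    unfolding slice_const_def column_const_def mx unfolding coeffs lam w_def[symmetric] using w
    by (simp add: field_simps power2_eq_square power3_eq_cube power4_eq_xxxx)
  have pi: "pi \<le> 3.1416" using pi_approx by simp
  have "3/10 \<le> 1 / pi" using pi by (simp add: field_simps)
  then have w3: "3/10 \<le> w" using CP_ge(1) by (simp add: w_def)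
  have "1 / (2 * pi) \<le> x" "1 / (2 * pi) \<le> y"
    using CP_ge(2,3) Lx Ly by (simp_all add: x_def y_def field_simps)
  moreover have "3/20 \<le> 1 / (2 * pi)" using pi by (simp add: field_simps)
  ultimately have xy: "3/20 \<le> x" "3/20 \<le> y" by linarith+
  define \<rho> where "\<rho> = sqrt (1 + 1 / Lx\<^sup>2 + 1 / Ly\<^sup>2) / lam"
  have "2/5 * (2 * w + x + y) \<le> \<rho>"
  proof -
    have "(2/5 * (2 * w + x + y))\<^sup>2 \<le> w\<^sup>2 + x\<^sup>2 + y\<^sup>2"
    proof -
      \<comment> \<open>Cauchy-Schwarz for the weights 2, 1, 1; the factor 2/5 is a rational number
        just below \<open>1 / sqrt 6\<close>.\<close>
      have "6 * (w\<^sup>2 + x\<^sup>2 + y\<^sup>2) - (2 * w + x + y)\<^sup>2 = (w - 2 * x)\<^sup>2 + (w - 2 * y)\<^sup>2 + (x - y)\<^sup>2"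
        by algebra
      also have "\<dots> \<ge> 0" by simp
      finally have "(2 * w + x + y)\<^sup>2 \<le> 6 * (w\<^sup>2 + x\<^sup>2 + y\<^sup>2)" by simp
      then have "4/25 * (2 * w + x + y)\<^sup>2 \<le> 4/25 * (6 * (w\<^sup>2 + x\<^sup>2 + y\<^sup>2))" by (rule mult_left_mono) simp
      also have "\<dots> \<le> w\<^sup>2 + x\<^sup>2 + y\<^sup>2" by simp
      also have "4/25 * (2 * w + x + y)\<^sup>2 = (2/5 * (2 * w + x + y))\<^sup>2" by (simp only: power_mult_distrib) (simp only: power_divide, simp)
      finally show ?thesis .
    qed
    also have "\<dots> = (1 + 1 / Lx\<^sup>2 + 1 / Ly\<^sup>2) * w\<^sup>2"
      by (simp add: x_def y_def w_def power_divide algebra_simps)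
    finally have "2/5 * (2 * w + x + y) \<le> sqrt ((1 + 1 / Lx\<^sup>2 + 1 / Ly\<^sup>2) * w\<^sup>2)"
      by (rule real_le_rsqrt)
    also have "\<dots> = \<rho>" using w by (simp add: \<rho>_def lam real_sqrt_mult)
    finally show ?thesis .
  qed
  then have "(1 + 2/5 * (2 * w + x + y))^3 \<le> (1 + \<rho>)^3"
    using w3 xy by (intro power_mono) auto
  \<comment> \<open>Whichever of \<open>x\<close> and \<open>y\<close> is larger, the polynomial
    bound is applied with that one in first place.\<close>
  moreover have "((x + 1/2) * (y + 1/2) + (max x y + 1/2) / 2 + 1/8) * (w + 2) \<le> 99/100 * (1 + 2/5 * (2 * w + x + y))^3"
    using constant_polynomial[OF w3 xy] constant_polynomial[OF w3 xy(2,1)]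
    by (auto simp: max_def mult.commute add.commute add.left_commute)
  ultimately have "((x + 1/2) * (y + 1/2) + (max x y + 1/2) / 2 + 1/8) * (w + 2) \<le> 99/100 * (1 + \<rho>)^3"
    by linarith
  also have "\<dots> \<le> (9 / 16 * (64 * sqrt 2 / (3 * sqrt 3 * pi\<^sup>2))) * (1 + \<rho>)^3"
  proof (rule mult_right_mono)
    \<comment> \<open>The numerical factor is \<open>12 * sqrt 2 / (sqrt 3 * pi^2)\<close>, about
      0.993, so 0.99 leaves little room and the decimal bounds have to be tight.\<close>
    have s2: "1.4142 \<le> sqrt 2" by (rule real_le_rsqrt) (simp add: power2_eq_square)
    have s3: "sqrt 3 \<le> 1.7321" by (rule real_le_lsqrt) (simp_all add: power2_eq_square)
    have "pi\<^sup>2 \<le> 3.1416\<^sup>2" using pi by (intro power_mono) auto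
    then have "sqrt 3 * pi\<^sup>2 \<le> 1.7321 * 3.1416\<^sup>2" using s3 by (intro mult_mono) auto
    also have "\<dots> \<le> 17.1" by (simp add: power2_eq_square)
    finally have "99/100 * (sqrt 3 * pi\<^sup>2) \<le> 99/100 * 17.1" by (rule mult_left_mono) simp
    also have "\<dots> \<le> 12 * 1.4142" by simp
    also have "\<dots> \<le> 12 * sqrt 2" using s2 by (rule mult_left_mono) simp
    finally have "99/100 * (sqrt 3 * pi\<^sup>2) \<le> 12 * sqrt 2" .
    then show "99/100 \<le> 9 / 16 * (64 * sqrt 2 / (3 * sqrt 3 * pi\<^sup>2))" by (simp add: field_simps)
    have "0 \<le> \<rho>" unfolding \<rho>_def using lam_pos by (intro divide_nonneg_pos) auto
    then show "0 \<le> (1 + \<rho>)^3" by simp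
  qed
  also have "\<dots> = 9 / 16 * (C_S Lx Ly)^3" by (simp only: C_S_cube \<rho>_def mult.assoc)
  finally have "w^3 * (((x + 1/2) * (y + 1/2) + (max x y + 1/2) / 2 + 1/8) * (w + 2)) \<le> w^3 * (9 / 16 * (C_S Lx Ly)^3)"
    using w by (intro mult_left_mono) auto
  also have "\<dots> = (C_m Lx Ly)\<^sup>2 * CP\<^sup>2 / 16"
    by (simp only: C_m_sq w_def) (simp add: power3_eq_cube power2_eq_square)
  finally show ?thesis unfolding C12 .
qed

text \<open>The terms of the series are nonnegative, hence so is \<open>infsum\<close>, which is 0
  for a family that is not summable.\<close>

lemma C_n_nonneg: "0 \<le> C_n Lx Ly"
proof -
  have if01: "0 \<le> (2 - (if k = 0 then 1 else 0) :: real)" for k :: nat by simp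
  have "0 \<le> C_b Lx Ly"
    unfolding C_b_def using Lx Ly if01
    by (intro real_sqrt_ge_zero mult_nonneg_nonneg infsum_nonneg divide_nonneg_nonneg)
      (auto simp: eigenv_def intro!: divide_nonneg_nonneg simp del: diff_ge_0_iff_ge)
  then show ?thesis by (simp add: C_n_def)
qed

end

section \<open>Comparison of norms and the final estimate\<close>

lemma L2norm_nonneg: "0 \<le> L2norm Lx Ly f"
proof (cases "(\<lambda>x. (norm (f x))\<^sup>2) integrable_on cell Lx Ly")
  case True
  then show ?thesis by (simp add: L2norm_def integral_nonneg)
\<comment> \<open>An integrand that is not integrable has integral 0 by convention.\<close>
qed (simp add: L2norm_def not_integrable_integral)

lemma sq_diff_le: "(a - b)\<^sup>2 \<le> 2 * a\<^sup>2 + 2 * (b::real)\<^sup>2"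
  using zero_le_power2[of "a + b"] by (simp add: power2_diff power2_sum)

lemma three_sq_diff_le:
  fixes a b c d e f :: real
  shows "(a - b)\<^sup>2 + (c - d)\<^sup>2 + (e - f)\<^sup>2 \<le> 2 * (a\<^sup>2 + b\<^sup>2 + c\<^sup>2 + d\<^sup>2 + e\<^sup>2 + f\<^sup>2)"
proof -
  have "(a - b)\<^sup>2 + (c - d)\<^sup>2 + (e - f)\<^sup>2 \<le> (2 * a\<^sup>2 + 2 * b\<^sup>2) + (2 * c\<^sup>2 + 2 * d\<^sup>2) + (2 * e\<^sup>2 + 2 * f\<^sup>2)"
    by (intro add_mono sq_diff_le)
  then show ?thesis by simp
qed

text \<open>The Laplacian is minus the curl of \<open>curl V\<close>, each component of which is a
  difference of two distinct entries of the gradient of \<open>curl V\<close>; squaring the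
  differences costs the factor 2.\<close>

lemma laplacian_le_grad_curl:
  assumes V: "\<And>i. smooth (\<lambda>y. V y $ i)" and div: "\<And>y. y \<in> slab \<Longrightarrow> divergence V y = 0" and x: "x \<in> slab"
  shows "(\<Sum>k\<in>UNIV. (laplacian (\<lambda>y. V y $ k) x)\<^sup>2) \<le> 2 * grad_norm_sq (curl V) x"
proof -
  let ?c = "\<lambda>i j. pd i (\<lambda>y. curl V y $ j) x"
  have "(\<Sum>k\<in>UNIV. (laplacian (\<lambda>y. V y $ k) x)\<^sup>2) = (\<Sum>k\<in>UNIV. (curl (curl V) x $ k)\<^sup>2)"
    by (simp add: curl_curl[OF V div x])
  also have "\<dots> = (?c 2 3 - ?c 3 2)\<^sup>2 + (?c 3 1 - ?c 1 3)\<^sup>2 + (?c 1 2 - ?c 2 1)\<^sup>2"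
    by (simp add: sum_3 curl_nth[of "curl V"])
  also have "\<dots> \<le> 2 * ((?c 2 3)\<^sup>2 + (?c 3 2)\<^sup>2 + (?c 3 1)\<^sup>2 + (?c 1 3)\<^sup>2 + (?c 1 2)\<^sup>2 + (?c 2 1)\<^sup>2)"
    by (rule three_sq_diff_le)
  also have "\<dots> \<le> 2 * grad_norm_sq (curl V) x"
    unfolding grad_norm_sq_def sum_3 by simp
  finally show ?thesis .
qed

text \<open>The converse comparison: combined with the Hessian identity it carries positivity from
  the gradient of the current to the Laplacian of the field.\<close>

lemma grad_curl_le_hessian:
  assumes V: "\<And>i. smooth (\<lambda>y. V y $ i)" and x: "x \<in> slab"
  shows "grad_norm_sq (curl V) x \<le> 2 * (\<Sum>k\<in>UNIV. \<Sum>i\<in>UNIV. \<Sum>j\<in>UNIV. (pd i (pd j (\<lambda>y. V y $ k)) x)\<^sup>2)"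
proof -
  let ?h = "\<lambda>i j k. pd i (pd j (\<lambda>y. V y $ k)) x"
  have "(\<Sum>j\<in>UNIV. (pd i (\<lambda>y. curl V y $ j) x)\<^sup>2) \<le> 2 * (\<Sum>j\<in>UNIV. \<Sum>k\<in>UNIV. (?h i j k)\<^sup>2)" for i
  proof -
    have "(\<Sum>j\<in>UNIV. (pd i (\<lambda>y. curl V y $ j) x)\<^sup>2) = (?h i 2 3 - ?h i 3 2)\<^sup>2 + (?h i 3 1 - ?h i 1 3)\<^sup>2 + (?h i 1 2 - ?h i 2 1)\<^sup>2"
      using x by (simp add: sum_3 curl_nth pd_diff smooth_intros V)
    also have "\<dots> \<le> 2 * ((?h i 2 3)\<^sup>2 + (?h i 3 2)\<^sup>2 + (?h i 3 1)\<^sup>2 + (?h i 1 3)\<^sup>2 + (?h i 1 2)\<^sup>2 + (?h i 2 1)\<^sup>2)"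
      by (rule three_sq_diff_le)
    also have "\<dots> \<le> 2 * (\<Sum>j\<in>UNIV. \<Sum>k\<in>UNIV. (?h i j k)\<^sup>2)"
      unfolding sum_3 by simp
    finally show ?thesis .
  qed
  then have "grad_norm_sq (curl V) x \<le> (\<Sum>i\<in>UNIV. 2 * (\<Sum>j\<in>UNIV. \<Sum>k\<in>UNIV. (?h i j k)\<^sup>2))"
    unfolding grad_norm_sq_def by (rule sum_mono)
  also have "\<dots> = 2 * (\<Sum>k\<in>UNIV. \<Sum>i\<in>UNIV. \<Sum>j\<in>UNIV. (?h i j k)\<^sup>2)"
    by (simp add: sum_3)
  finally show ?thesis .
qed

text \<open>Multiplying the upper bound by \<open>D / (8 * Ek)\<close> shows that
  \<open>D * Lam * G / (4 * Ek) + D * e / 8\<close> is at most half of \<open>1 / Rm\<close>. The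
  magnetic part of \<open>key\<close> fits under the first summand, which is where 16 comes from.
  Young with weight \<open>e\<close>, the power of \<open>Ek\<close> with exponent
  \<open>\<gamma> - 1\<close>, splits the thermal part into \<open>e * K\<close>, which fits under
  the second summand, and the term of the conclusion.\<close>

lemma threshold_arithmetic:
  fixes Rm Ek Lam Ra \<gamma> A G D K F :: real
  assumes pos: "0 < Rm" "0 < Ek" "0 < Lam" "0 < D" "0 \<le> K"
    and K: "K \<le> D / 16" and A: "A \<le> 2 * G" "0 \<le> G"
    and upper: "2 * Lam * G \<le> Ek powr \<gamma> * (4 / D * (1 / (Rm * Ek powr (\<gamma> - 1))) - 1)"
    and key: "1 / Rm \<le> 2 * (K * Lam * A / Ek + sqrt K * (Ra * F))"
  shows "1 / (2 * Rm) \<le> Ra\<^sup>2 * Ek powr (1 - \<gamma>) * F\<^sup>2"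
proof -
  define e where "e = Ek powr (\<gamma> - 1)"
  have e: "0 < e" "Ek powr \<gamma> = Ek * e" "Ek powr (1 - \<gamma>) = 1 / e"
    using pos powr_add[of Ek "\<gamma> - 1" 1] powr_minus_divide[of Ek "\<gamma> - 1"] by (simp_all add: e_def)
  have "2 * Lam * G \<le> Ek * e * (4 / D * (1 / (Rm * e)) - 1)" using upper by (simp add: e flip: e_def)
  also have "\<dots> = 4 * Ek / (D * Rm) - Ek * e" using pos e by (simp add: field_simps)
  finally have "(2 * Lam * G + Ek * e) * (D / (8 * Ek)) \<le> 4 * Ek / (D * Rm) * (D / (8 * Ek))"
    using pos by (intro mult_right_mono) auto
  then have 1: "D * Lam * G / (4 * Ek) + D * e / 8 \<le> 1 / (2 * Rm)" using pos by (simp add: field_simps)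
  have "2 * (sqrt K * (Ra * F)) \<le> e * K + 1 / e * (Ra * F)\<^sup>2"
    using abs_mult_le_weighted[OF e(1), of "sqrt K" "Ra * F"] pos by (simp add: abs_le_iff)
  moreover have "e * K \<le> e * (D / 16)" using K e by (intro mult_left_mono) auto
  moreover have "0 \<le> e * D" using e pos by simp
  moreover have "2 * (K * Lam * A / Ek) \<le> D * Lam * G / (4 * Ek)"
  proof -
    have "K * A \<le> K * (2 * G)" using A pos by (intro mult_left_mono) auto
    also have "\<dots> \<le> D / 16 * (2 * G)" using K A by (intro mult_right_mono) auto
    finally have "K * A * (2 * Lam / Ek) \<le> D / 16 * (2 * G) * (2 * Lam / Ek)" using pos by (intro mult_right_mono) auto
    then show ?thesis by (simp add: mult_ac)
  qed
  ultimately have "1 / Rm \<le> 1 / (2 * Rm) + 1 / e * (Ra * F)\<^sup>2"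
    using key 1 by (simp add: algebra_simps)
  then show ?thesis using pos by (simp add: e power_mult_distrib field_simps)
qed

theorem theorem3p11:
  fixes I :: "real set" and Lx Ly Ek Lam Ra Rm Pe Tminus Tplus \<gamma> t :: real
    and Q :: "real^3 \<Rightarrow> real"
    and u B :: "real \<Rightarrow> real^3 \<Rightarrow> real^3"
    and P T :: "real \<Rightarrow> real^3 \<Rightarrow> real"
  assumes "Lx > 0" and "Ly > 0"
    and "Ek > 0" and "Lam > 0" and "Ra > 0" and "Rm > 0" and "Pe > 0"
    and "is_interval I" and "interior I \<noteq> {}"
    and solution: "viscous_inertialess_solution I Lx Ly Ek Lam Ra Rm Pe Q u P B T"
    and nontrivial: "\<exists>s\<in>I. \<exists>x\<in>slab. B s x \<noteq> 0"
    and flux: "exact_magnetic_flux I Lx Ly B"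
    and temp: "isothermal I Tminus Tplus T"
    and "0 < \<gamma>" and "\<gamma> < 1"
    and Rm_bound: "Rm < 2 * Ek powr (1 - \<gamma>) / ((C_m Lx Ly)\<^sup>2 * (C_P Lx Ly)\<^sup>2)"
    and "t \<in> I"
    and growth: "ddt I (enstrophy Lx Ly B) t \<ge> 0"
  shows
    "C_n Lx Ly * Ra * L2norm Lx Ly (vprim (curl (curl (\<lambda>x. T t x *\<^sub>R ez))))
       + Ra\<^sup>2 * Ek powr (1 - \<gamma>) *
           (L2norm Lx Ly (curl (vprim (curl (curl (\<lambda>x. T t x *\<^sub>R ez))))))\<^sup>2
       \<ge> 1 / (2 * Rm)
     \<or> \<not> (Ek powr \<gamma> \<le> 2 * Lam * integral (cell Lx Ly) (grad_norm_sq (curl (B t))) \<and>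
          2 * Lam * integral (cell Lx Ly) (grad_norm_sq (curl (B t)))
            \<le> Ek powr \<gamma> * (4 / ((C_m Lx Ly)\<^sup>2 * (C_P Lx Ly)\<^sup>2) * (1 / (Rm * Ek powr (\<gamma> - 1))) - 1))"
proof (rule disjCI, simp only: not_not, elim conjE)
  interpret periodic_cell Lx Ly by standard fact+
  assume lower: "Ek powr \<gamma> \<le> 2 * Lam * cint (grad_norm_sq (curl (B t)))"
    and upper: "2 * Lam * cint (grad_norm_sq (curl (B t)))
            \<le> Ek powr \<gamma> * (4 / ((C_m Lx Ly)\<^sup>2 * CP\<^sup>2) * (1 / (Rm * Ek powr (\<gamma> - 1))) - 1)"
  note pos = \<open>Ek > 0\<close> \<open>Lam > 0\<close> \<open>Ra > 0\<close> \<open>Rm > 0\<close>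
  note t = \<open>t \<in> I\<close>
  have smooth: "smooth_field I u" "smooth_field I P" "smooth_field I B" "smooth_field I T"
    and per: "periodic Lx Ly (u t)" "periodic Lx Ly (P t)" "periodic Lx Ly (B t)" "periodic Lx Ly (T t)"
    and mom: "\<And>x. x \<in> slab \<Longrightarrow> cross3 ez (u t x) + gradient (P t) x - Ek *\<^sub>R laplacian (u t) x
          = Lam *\<^sub>R cross3 (curl (B t) x) (B t x) + (Ra * T t x) *\<^sub>R ez"
    and divu: "\<And>x. x \<in> slab \<Longrightarrow> divergence (u t) x = 0"
    and ind: "\<And>x. x \<in> slab \<Longrightarrow> ddt I (\<lambda>s. B s x) t - curl (\<lambda>y. cross3 (u t y) (B t y)) x
          = (1 / Rm) *\<^sub>R laplacian (B t) x"
    and divB: "\<And>x. x \<in> slab \<Longrightarrow> divergence (B t) x = 0"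
    and lids_eq: "\<And>s x. s \<in> I \<Longrightarrow> x \<in> bottom \<Longrightarrow> u s x \<bullet> (- ez) = 0 \<and> cross3 (curl (u s) x) (- ez) = 0 \<and> cross3 (B s x) (- ez) = 0"
      "\<And>s x. s \<in> I \<Longrightarrow> x \<in> top_lid \<Longrightarrow> u s x \<bullet> ez = 0 \<and> cross3 (curl (u s) x) ez = 0 \<and> cross3 (B s x) ez = 0"
    using solution t unfolding viscous_inertialess_solution_def by auto
  have smv: "smooth_on (u t) slab" "smooth (P t)" "smooth_on (B t) slab" "smooth (T t)"
    using smooth smooth_on_slice[of "\<lambda>(t, x). u t x" I t] smooth_on_slice[of "\<lambda>(t, x). P t x" I t]
      smooth_on_slice[of "\<lambda>(t, x). B t x" I t] smooth_on_slice[of "\<lambda>(t, x). T t x" I t] t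
    by (auto simp: smooth_field_def)
  define U where "U i x = u t x $ i" for i x
  define b where "b i x = B t x $ i" for i x
  have U: "per_smooth (U i)" and b: "per_smooth (b i)" for i
    using smooth_component[OF smv(1)] smooth_component[OF smv(3)] per by (simp_all add: per_smooth_def U_def[abs_def] b_def[abs_def] periodic_def)
  have PT: "per_smooth (P t)" "per_smooth (T t)" using smv per by (simp_all add: per_smooth_def)
  note s = per_smooth_smooth[OF U] per_smooth_smooth[OF b] per_smooth_smooth[OF PT(1)] per_smooth_smooth[OF PT(2)]
  have smB: "smooth (\<lambda>y. B t y $ i)" and smu: "smooth (\<lambda>y. u t y $ i)" for i
    using s by (simp_all add: b_def[abs_def] U_def[abs_def])
  have lap: "laplacian (u t) x $ k = laplacian (U k) x" "laplacian (B t) x $ k = laplacian (b k) x" if x: "x \<in> slab" for x k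
  proof -
    have "pd i (pd i V) x $ k = pd i (pd i (\<lambda>y. V y $ k)) x" if V: "smooth_on V slab" for V :: "real^3 \<Rightarrow> real^3" and i
    proof -
      have "pd i (pd i V) x $ k = pd i (\<lambda>y. pd i V y $ k) x" by (rule pd_component[OF smooth_pd[OF V] x])
      also have "\<dots> = pd i (pd i (\<lambda>y. V y $ k)) x" by (rule pd_cong[OF pd_component[OF V] x])
      finally show ?thesis .
    qed
    then show "laplacian (u t) x $ k = laplacian (U k) x" "laplacian (B t) x $ k = laplacian (b k) x"
      using smv by (simp_all add: laplacian_def U_def[abs_def] b_def[abs_def])
  qed
  have divU: "(\<Sum>i\<in>UNIV. pd i (U i) x) = 0" and divb: "(\<Sum>i\<in>UNIV. pd i (b i) x) = 0" if "x \<in> slab" for x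
    using divu[OF that] divB[OF that] by (simp_all add: divergence_def U_def[abs_def] b_def[abs_def])
  have ez: "ez $ 1 = 0" "ez $ 2 = 0" "ez $ 3 = 1" by (simp_all add: ez_def axis_def)
  have lidB: "B r x $ 1 = 0" "B r x $ 2 = 0" if "r \<in> I" "x \<in> lids" for r x
    using lids_eq[OF that(1), of x] that(2) by (auto simp: vec_eq_iff forall_3 cross_components ez)
  have lidu: "u t x $ 3 = 0" "curl (u t) x $ 1 = 0" "curl (u t) x $ 2 = 0" if "x \<in> lids" for x
    using lids_eq[OF t, of x] that by (auto simp: vec_eq_iff forall_3 cross_components ez inner_vec_def sum_3)
  have lids_slab: "x \<in> slab" if "x \<in> lids" for x using that by (auto simp: slab_def bottom_def top_lid_def)
  have lz: "lid_zero (U 3)" "lid_zero (b 1)" "lid_zero (b 2)"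
    using lidB[OF t] lidu by (auto simp: lid_zero_def U_def b_def)
  \<comment> \<open>The stress-free condition equates \<open>pd 3\<close> of a horizontal component
    with a horizontal derivative of \<open>U 3\<close>, which vanishes on the lids.\<close>
  have lz3: "lid_zero (pd 3 (U 1))" "lid_zero (pd 3 (U 2))"
    using lidu lid_zero_pd[OF s(1) lz(1), of 1] lid_zero_pd[OF s(1) lz(1), of 2]
    by (auto simp: lid_zero_def curl_nth U_def[abs_def])
  \<comment> \<open>The tangential field vanishes along the whole lid, so the zero divergence leaves
    only the vertical derivative of \<open>b 3\<close>.\<close>
  have lzb: "lid_zero (pd 3 (b 3))"
    using lid_zero_pd[OF s(2) lz(2), of 1] lid_zero_pd[OF s(2) lz(3), of 2] divb lids_slab
    by (force simp: lid_zero_def sum_3)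
  have lzT: "lid_zero (pd i (T t))" if "i \<noteq> 3" for i
    unfolding lid_zero_def
    using temp t pd_horizontal_zero[OF s(4), of 0 Tminus _ i] pd_horizontal_zero[OF s(4), of 1 Tplus _ i] that
    by (auto simp: isothermal_def bottom_def top_lid_def)
  have lorentz: "cross3 (curl (B t) x) (B t x) $ k = adv b (b k) x - (\<Sum>i\<in>UNIV. b i x * pd k (b i) x)" for x k
    unfolding b_def[abs_def] by (rule curl_cross_self)
  have momk: "cross3 ez (u t x) $ k + pd k (P t) x - Ek * laplacian (U k) x
      = Lam * (adv b (b k) x - (\<Sum>i\<in>UNIV. b i x * pd k (b i) x)) + Ra * T t x * ez $ k" if x: "x \<in> slab" for x k
    using arg_cong[OF mom[OF x], of "\<lambda>v. v $ k"] x by (simp add: gradient_def lap lorentz)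
  have mom1: "- U 2 x + pd 1 (P t) x - Ek * laplacian (U 1) x
      = Lam * (adv b (b 1) x - (\<Sum>i\<in>UNIV. b i x * pd 1 (b i) x))"
    and mom2: "U 1 x + pd 2 (P t) x - Ek * laplacian (U 2) x
      = Lam * (adv b (b 2) x - (\<Sum>i\<in>UNIV. b i x * pd 2 (b i) x))"
    and mom3: "pd 3 (P t) x - Ek * laplacian (U 3) x
      = Lam * (adv b (b 3) x - (\<Sum>i\<in>UNIV. b i x * pd 3 (b i) x)) + Ra * T t x" if x: "x \<in> slab" for x
    using momk[OF x, of 1] momk[OF x, of 2] momk[OF x, of 3] by (simp_all add: cross_components ez U_def)
  \<comment> \<open>Rotation crosses the indices: the first momentum component yields the mean of
    \<open>U 2\<close>, the second that of \<open>U 1\<close>.\<close>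
  have "cint (\<lambda>x. - U 2 x) = 0"
    by (rule mean_horizontal_velocity[OF U[of 1] _ b PT(1) _ mom1 divb lz3(1) lz(2)]) (auto intro: per_smooth_intros U)
  then have mean2: "cint (U 2) = 0" by simp
  have mean1: "cint (U 1) = 0"
    by (rule mean_horizontal_velocity[OF U[of 2] U[of 1] b PT(1) _ mom2 divb lz3(2) lz(3)]) auto
  have mean3: "cint (b 3) = 0"
  proof (rule mean_vertical_field[OF b divb])
    have "integral base (\<lambda>p. ez \<bullet> B t (vector [fst p, snd p, 1])) = 0"
      using flux t by (auto simp: exact_magnetic_flux_def split_def)
    then show "integral base (\<lambda>p. b 3 (pt p 1)) = 0"
      by (simp add: inner_vec_def sum_3 ez b_def pt_def)
  qed
  have gU: "compatible (U i)" and gb: "compatible (b i)" for i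
    using exhaust_3[of i] U b lz lz3 lzb mean1 mean2 mean3 by (auto simp: compatible_def)

  define K where "K = slice_const * column_const"
  define A where "A = (\<Sum>k\<in>UNIV. csq (laplacian (b k)))"
  define G where "G = cint (grad_norm_sq (curl (B t)))"
  define F where "F = L2norm Lx Ly (curl (vprim (curl (curl (\<lambda>x. T t x *\<^sub>R ez)))))"
  have K: "0 < K" using slice_const_pos column_const_pos by (simp add: K_def)
  have smG: "smooth (grad_norm_sq (curl (B t)))"
    unfolding grad_norm_sq_def[abs_def] by (intro smooth_intros smooth_curl smB)
  \<comment> \<open>The lower half of the two-sided inequality excludes a vanishing gradient of the
    current at time \<open>t\<close>.\<close>
  have Gpos: "0 < G"
  proof -
    have "0 < Ek powr \<gamma>" using pos by simp
    also note lower
    finally have "0 < 2 * Lam * G" by (simp add: G_def)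
    then show ?thesis using pos by (simp add: zero_less_mult_iff)
  qed
  have AG: "A \<le> 2 * G"
  proof -
    have "A = cint (\<lambda>x. \<Sum>k\<in>UNIV. (laplacian (b k) x)\<^sup>2)"
      unfolding A_def by (intro cint_sum[symmetric] smooth_intros smooth_laplacian s) simp
    also have "\<dots> \<le> cint (\<lambda>x. 2 * grad_norm_sq (curl (B t)) x)"
      using laplacian_le_grad_curl[OF smB divB]
      by (intro cint_mono smooth_intros smooth_laplacian s smG) (simp_all add: b_def[abs_def])
    finally show ?thesis by (simp add: G_def)
  qed
  have GA: "G \<le> 2 * A"
  proof -
    have "G \<le> cint (\<lambda>x. 2 * (\<Sum>k\<in>UNIV. \<Sum>i\<in>UNIV. \<Sum>j\<in>UNIV. (pd i (pd j (b k)) x)\<^sup>2))"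
      unfolding G_def using grad_curl_le_hessian[OF smB]
      by (intro cint_mono smooth_intros s smG) (simp add: b_def[abs_def])
    also have "\<dots> = 2 * (\<Sum>k\<in>UNIV. \<Sum>i\<in>UNIV. \<Sum>j\<in>UNIV. csq (pd i (pd j (b k))))"
      by (simp add: cint_sum smooth_intros s)
    also have "\<dots> = 2 * A"
      unfolding A_def by (simp add: hessian_identity[OF b compatible_lid_condition[OF gb]])
    finally show ?thesis .
  qed
  have Apos: "0 < A" using Gpos GA by simp
  have F0: "0 \<le> F" by (simp add: F_def L2norm_nonneg)
  have F2: "F\<^sup>2 = cint (\<lambda>x. (laplacian (pd 2 (vprimitive (T t))) x)\<^sup>2 + (laplacian (pd 1 (vprimitive (T t))) x)\<^sup>2)"
  proof -
    let ?h = "\<lambda>x. (laplacian (pd 2 (vprimitive (T t))) x)\<^sup>2 + (laplacian (pd 1 (vprimitive (T t))) x)\<^sup>2"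
    have "cint (\<lambda>x. (norm (curl (vprim (curl (curl (\<lambda>x. T t x *\<^sub>R ez)))) x))\<^sup>2) = cint ?h"
    proof (rule cint_cong)
      fix x assume "x \<in> slab"
      note c = curl_vprim_thermal[OF s(4) this]
      show "(norm (curl (vprim (curl (curl (\<lambda>x. T t x *\<^sub>R ez)))) x))\<^sup>2 = ?h x"
        by (simp only: power2_norm_eq_inner inner_vec_def inner_real_def sum_3 c) (simp add: power2_eq_square)
    qed
    moreover have "0 \<le> cint ?h" by (intro cint_nonneg smooth_intros smooth_laplacian smooth_vprimitive s) simp
    ultimately show ?thesis by (simp add: F_def L2norm_def)
  qed
  have vel: "(\<Sum>k\<in>UNIV. csq (laplacian (U k))) \<le> (Lam / Ek)\<^sup>2 * (K * (A * A)) + Ra\<^sup>2 * F\<^sup>2"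
  proof -
    have "(\<Sum>k\<in>UNIV. csq (laplacian (U k)))
      \<le> (Lam / Ek)\<^sup>2 * cint (\<lambda>x. \<Sum>k\<in>UNIV. (adv b (b k) x)\<^sup>2) + Ra\<^sup>2 * F\<^sup>2"
      unfolding F2 by (rule velocity_bound[OF U b PT pos(1) mom1 mom2 mom3 divU lz(1) lz3 lzT lzT]) auto
    also have "\<dots> \<le> (Lam / Ek)\<^sup>2 * (K * (A * A)) + Ra\<^sup>2 * F\<^sup>2"
      unfolding K_def A_def by (intro add_right_mono mult_left_mono advection_estimate gb) auto
    finally show ?thesis .
  qed

  obtain c where c: "\<And>j. smooth (c j)"
    and dc: "\<And>j x. x \<in> slab \<Longrightarrow> ((\<lambda>s. B s x $ j) has_vector_derivative c j x) (at t within I)"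
    and cd: "\<And>j x. x \<in> slab \<Longrightarrow> ddt I (\<lambda>s. B s x) t $ j = c j x"
    and ens: "ddt I (enstrophy Lx Ly B) t = cint (\<lambda>x. \<Sum>k\<in>UNIV. curl (B t) x $ k * curl (\<lambda>y. \<chi> j. c j y) x $ k)"
    by (rule enstrophy_derivative[OF \<open>is_interval I\<close> \<open>interior I \<noteq> {}\<close> t smooth(3)]) blast
  \<comment> \<open>The right side of the induction equation, which equals the time derivative
    \<open>c\<close> on the slab and is smooth and periodic by construction.\<close>
  define e where "e k x = adv b (U k) x - adv U (b k) x + 1 / Rm * laplacian (b k) x" for k x
  have e: "per_smooth (e k)" for k unfolding e_def[abs_def] by (intro per_smooth_intros per_smooth_laplacian U b)
  have ce: "c k x = e k x" if x: "x \<in> slab" for k x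
  proof -
    have "c k x = curl (\<lambda>y. cross3 (u t y) (B t y)) x $ k + 1 / Rm * laplacian (b k) x"
      using arg_cong[OF ind[OF x], of "\<lambda>v. v $ k"] cd[OF x, of k] lap(2)[OF x, of k] by simp
    then show ?thesis
      using curl_cross[OF smu divu[OF x] smB divB[OF x] x, of k] by (simp add: e_def U_def[abs_def] b_def[abs_def])
  qed
  have lim: "at t within I \<noteq> bot"
    by (rule trivial_limit_boxlike[OF boxlike_interval[OF \<open>is_interval I\<close> \<open>interior I \<noteq> {}\<close>] t])
  \<comment> \<open>The ferromagnetic condition holds at all times in \<open>I\<close>, so the
    tangential components are constant in time on the lids.\<close>
  have c0: "c j x = 0" if x: "x \<in> lids" and j: "j = 1 \<or> j = 2" for j x
  proof -
    have "((\<lambda>s. B s x $ j) has_vector_derivative 0) (at t within I)"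
      by (rule has_vector_derivative_transform[OF t _ has_vector_derivative_const[of 0]]) (use lidB x j in auto)
    then show ?thesis using dc[OF lids_slab[OF x]] vector_derivative_unique_within[OF lim] by blast
  qed
  have lze: "lid_zero (e 1)" "lid_zero (e 2)"
    using c0 ce lids_slab by (auto simp: lid_zero_def)
  have "0 \<le> cint (\<lambda>x. \<Sum>k\<in>UNIV. - laplacian (b k) x * e k x)"
  proof -
    define a where "a k x = curl (B t) x $ k" for k x
    have pa: "per_smooth (a k)" for k
      using exhaust_3[of k] b by (auto simp: a_def[abs_def] curl_nth b_def[abs_def] intro!: per_smooth_intros)
    have "0 \<le> cint (\<lambda>x. \<Sum>k\<in>UNIV. curl (B t) x $ k * curl (\<lambda>y. \<chi> j. c j y) x $ k)" using growth ens by simp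
    also have "\<dots> = cint (\<lambda>x. \<Sum>k\<in>UNIV. a k x * curl (\<lambda>y. \<chi> j. e j y) x $ k)"
    proof (intro cint_cong sum.cong refl)
      fix x k assume x: "x \<in> slab"
      have "pd i (c j) x = pd i (e j) x" for i j by (rule pd_cong[OF ce x])
      then have "curl (\<lambda>y. \<chi> j. c j y) x $ k = curl (\<lambda>y. \<chi> j. e j y) x $ k"
        using exhaust_3[of k] by (auto simp: curl_nth)
      then show "curl (B t) x $ k * curl (\<lambda>y. \<chi> j. c j y) x $ k = a k x * curl (\<lambda>y. \<chi> j. e j y) x $ k"
        by (simp add: a_def)
    qed
    also have "\<dots> = cint (\<lambda>x. \<Sum>k\<in>UNIV. curl (\<lambda>y. \<chi> j. a j y) x $ k * e k x)"
      by (rule curl_by_parts[OF pa e lze])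
    also have "\<dots> = cint (\<lambda>x. \<Sum>k\<in>UNIV. - laplacian (b k) x * e k x)"
    proof (intro cint_cong sum.cong refl)
      fix x k assume x: "x \<in> slab"
      have "(\<lambda>y. \<chi> j. a j y) = curl (B t)" by (simp add: a_def)
      then show "curl (\<lambda>y. \<chi> j. a j y) x $ k * e k x = - laplacian (b k) x * e k x"
        using curl_curl[OF smB divB x, of k] by (simp add: b_def[abs_def])
    qed
    finally show ?thesis .
  qed
  then have grow: "0 \<le> cint (\<lambda>x. \<Sum>k\<in>UNIV. - laplacian (b k) x *
      (adv b (U k) x - adv U (b k) x + 1 / Rm * laplacian (b k) x))"
    by (simp only: e_def)
  \<comment> \<open>The summands are square roots of \<open>K\<close> times the two parts of
    \<open>vel\<close>; squaring their sum adds only a nonnegative cross term.\<close>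
  define v where "v = K * Lam * A / Ek + sqrt K * (Ra * F)"
  have v: "0 < v" unfolding v_def using K Apos pos F0 by (intro add_pos_nonneg) auto
  have "K * (\<Sum>k\<in>UNIV. csq (laplacian (U k))) \<le> K * ((Lam / Ek)\<^sup>2 * (K * (A * A)) + Ra\<^sup>2 * F\<^sup>2)"
    using vel K by (intro mult_left_mono) auto
  also have "\<dots> = (K * Lam * A / Ek)\<^sup>2 + (sqrt K * (Ra * F))\<^sup>2"
    using K by (simp add: power_mult_distrib power_divide) (simp add: power2_eq_square algebra_simps)
  also have "\<dots> \<le> v\<^sup>2"
    unfolding v_def power2_sum using K Apos pos F0 by simp
  finally have "slice_const * column_const * (\<Sum>k\<in>UNIV. csq (laplacian (U k))) \<le> v\<^sup>2" by (simp add: K_def)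
  from growth_bound[OF gU gb v grow this] have "1 / Rm * A \<le> 2 * v * A" by (simp add: A_def)
  then have "1 / Rm \<le> 2 * v" using Apos by (rule mult_right_le_imp_le)
  then have key: "1 / Rm \<le> 2 * (K * Lam * A / Ek + sqrt K * (Ra * F))" by (simp only: v_def)
  have "0 < (C_m Lx Ly)\<^sup>2 * CP\<^sup>2"
    using CP_pos C_S_pos by (simp add: C_m_sq)
  from threshold_arithmetic[OF pos(4,1,2) this _ _ AG _ upper[folded G_def] key]
  have "1 / (2 * Rm) \<le> Ra\<^sup>2 * Ek powr (1 - \<gamma>) * F\<^sup>2"
    using K Gpos constant_bound by (simp add: K_def)
  moreover have "0 \<le> C_n Lx Ly * Ra * L2norm Lx Ly (vprim (curl (curl (\<lambda>x. T t x *\<^sub>R ez))))"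
    using C_n_nonneg pos by (intro mult_nonneg_nonneg) (auto intro: L2norm_nonneg)
  ultimately show "1 / (2 * Rm) \<le> C_n Lx Ly * Ra * L2norm Lx Ly (vprim (curl (curl (\<lambda>x. T t x *\<^sub>R ez))))
       + Ra\<^sup>2 * Ek powr (1 - \<gamma>) * (L2norm Lx Ly (curl (vprim (curl (curl (\<lambda>x. T t x *\<^sub>R ez))))))\<^sup>2"
    by (simp add: F_def)
qed

end
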